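(* Let $F:\mathbb{R}^2\to\mathbb{R}^2$ be a differentiable map with $\det DF(z)=1$ for all $z\in\mathbb{R}^2$. If $F$ satisfies the $W$-condition, then $F$ is a globally injective, (Lebesgue) measure-preserving map with convex image.
   Context: Differentiable means (Fréchet) differentiable at every point. Measure-preserving means that for every Lebesgue measurable set $\Omega\subset\mathbb{R}^2$, the image $F(\Omega)$ has the same Lebesgue measure as $\Omega$. For $\theta\in\mathbb{R}$ let $R_\theta=\begin{pmatrix}\cos\theta&-\sin\theta\\ \sin\theta&\cos\theta\end{pmatrix}$ and $F_\theta=R_\theta\circ F\circ R_{-\theta}$. Let $\mathbb{R}^+=(0,+\infty)$ and let $\mathcal{P}$ be the set of all nondecreasing functions $P:\mathbb{R}^+\to\mathbb{R}^+$ such that for every $M>0$ there exists a large constant $N$ (depending on $M$ and $P$) with $\int_2^N\frac{1}{P(x)}\,dx>M$. $W$-condition: $F$ satisfies the $W$-condition if there is a function $P\in\mathcal{P}$ such that, for each $\theta\in\mathbb{R}$, there does not exist a sequence $(x_k,y_k)\in\mathbb{R}^2$ with $x_k\to+\infty$ such that $F_\theta(x_k,y_k)\to T$ for some $T\in\mathbb{R}^2$ and $DF_\theta(x_k,y_k)$ has a real eigenvalue $\lambda_k$ satisfying $\lambda_kP(x_k)\to 0$. *)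

theory Defs
  imports "HOL-Analysis.Analysis"
begin

definition rot :: "real \<Rightarrow> real^2^2" where
  "rot \<theta> = vector [vector [cos \<theta>, - sin \<theta>], vector [sin \<theta>, cos \<theta>]]"

definition rot_conj :: "real \<Rightarrow> (real^2 \<Rightarrow> real^2) \<Rightarrow> real^2 \<Rightarrow> real^2" where
  "rot_conj \<theta> F = (\<lambda>z. rot \<theta> *v F (rot (- \<theta>) *v z))"

definition real_eigenvalue :: "real^'n^'n \<Rightarrow> real \<Rightarrow> bool" where
  "real_eigenvalue A c \<longleftrightarrow> (\<exists>v. v \<noteq> 0 \<and> A *v v = c *\<^sub>R v)"

(* A function on the positive half-line is encoded as a total function on the reals;
   its values outside the half-line are arbitrary. *)
definition weight_functions :: "(real \<Rightarrow> real) set" where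
  "weight_functions = {P. (\<forall>x>0. P x > 0) \<and> mono_on {0<..} P \<and>
     (\<forall>M>0. \<exists>N>2. integral {2..N} (\<lambda>x. 1 / P x) > M)}"

(* Since x k tends to infinity, P is evaluated at nonpositive arguments for at most finitely
   many k, so the arbitrary values of P there do not influence the limit. *)
definition W_condition :: "(real^2 \<Rightarrow> real^2) \<Rightarrow> bool" where
  "W_condition F \<longleftrightarrow> (\<exists>P \<in> weight_functions. \<forall>\<theta>.
     \<not> (\<exists>(x :: nat \<Rightarrow> real) (y :: nat \<Rightarrow> real) (T :: real^2) (ev :: nat \<Rightarrow> real).
          filterlim x at_top sequentially \<and>
          (\<lambda>k. rot_conj \<theta> F (vector [x k, y k])) \<longlonglongrightarrow> T \<and>
          (\<forall>k. real_eigenvalue (jacobian (rot_conj \<theta> F) (at (vector [x k, y k]))) (ev k)) \<and>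
          (\<lambda>k. ev k * P (x k)) \<longlonglongrightarrow> 0))"

(* Invariance of measure under images (not preimages); measurability of the image is part
   of the notion. *)
definition lebesgue_measure_preserving :: "(real^2 \<Rightarrow> real^2) \<Rightarrow> bool" where
  "lebesgue_measure_preserving F \<longleftrightarrow>
     (\<forall>S \<in> sets lebesgue. F ` S \<in> sets lebesgue \<and> emeasure lebesgue (F ` S) = emeasure lebesgue S)"

end

theory Submission
  imports Defs
begin

text \<open>
  Idea of the proof. Since \<open>F\<close> is locally injective, a straight segment starting at \<open>F p\<close> has at
  most one continuous lift starting at \<open>p\<close>. Let \<open>reach F p\<close> be the star-shaped open set of
  end points of segments that do lift, with the inverse branch \<open>branch F p\<close> on it. If every
  \<open>reach F p\<close> is convex, then ``the segment from \<open>F p\<close> to \<open>F q\<close> lifts to a path from \<open>p\<close> to \<open>q\<close>''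
  is an equivalence relation with open classes, so it relates all pairs of points; injectivity and
  convexity of the range follow at once (\<open>convex_reach_imp_injective_convex_range\<close>), and the change
  of variables formula gives the statement on measures.

  So suppose that \<open>reach F p\<close> contains two points but not the segment between them. Sweep the triangle
  that they form with the apex \<open>F p\<close> by chords parallel to the segment, from the apex outwards, until they first hit
  the complement of \<open>reach F p\<close>. This cuts off a triangle with apex \<open>F p\<close> that lies in \<open>reach F p\<close> except
  for part of the side \<open>[b, c]\<close> opposite to the apex, where the branch \<open>G\<close> escapes to infinity.
  The W-condition now controls one coordinate of \<open>G\<close>. On each chord parallel to \<open>d = c - b\<close> take a
  point where the coordinate of \<open>G\<close> perpendicular to \<open>d\<close> is maximal. There \<open>DG\<close> maps \<open>d\<close> to a multiple
  \<open>k d\<close>, and since the Jacobian is one, \<open>k\<close> is a real eigenvalue of \<open>DF\<close> and the maximum changes at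
  rate proportional to \<open>1 / k\<close> as the chord moves towards \<open>[b, c]\<close>. The W-condition bounds this rate
  by a multiple of \<open>P\<close> of the maximum, and as the integral of \<open>1 / P\<close> diverges, the maximum
  cannot become infinite in finite time. Hence \<open>G\<close> maps the triangle into a strip in direction \<open>d\<close>
  (\<open>triangle_strip\<close>).

  The chords can be tilted: sweeping with chords of a slightly different direction gives another triangle
  of the same kind, hence another exit point and another strip. Elementary convexity shows that the exit points, seen from the apex,
  are ordered in the sense opposite to the directions of the strips. Choose three
  tilts for which \<open>G\<close> escapes to the same end of its strip. The three segments from the apex to points
  close to the exit points form a tripod, which \<open>G\<close> would embed with its cyclic order reversed. This
  contradicts \<open>det DG = 1 > 0\<close> and is excluded by following angles along the isotopy
  \<open>(G (a + t w) - G a) / t\<close>, which joins the embedding to the linear map \<open>DG\<close>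
  (\<open>no_three_reversed_legs\<close>).

  Local injectivity is itself not a consequence of the inverse function theorem, because \<open>F\<close> need not be
  continuously differentiable. It is a degree argument: all zeros of \<open>F - y\<close> count with index
  \<open>+1\<close>, and the total count in a small disc is one (\<open>locally_injective_of_positive_derivative\<close>).
\<close>

section \<open>Plane vectors and cross products\<close>

lemma vec2_eqI: "x $ 1 = y $ 1 \<Longrightarrow> x $ 2 = y $ 2 \<Longrightarrow> x = (y :: real^2)"
  unfolding vec_eq_iff forall_2 by blast

definition cross2 :: "real^2 \<Rightarrow> real^2 \<Rightarrow> real" where
  "cross2 u v = u $ 1 * v $ 2 - u $ 2 * v $ 1"

definition to_complex :: "real^2 \<Rightarrow> complex" where
  "to_complex v = Complex (v $ 1) (v $ 2)"

definition from_complex :: "complex \<Rightarrow> real^2" where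
  "from_complex z = vector [Re z, Im z]"

lemma from_to_complex [simp]: "from_complex (to_complex v) = v"
  by (rule vec2_eqI) (simp_all add: to_complex_def from_complex_def)

lemma bounded_linear_to_complex: "bounded_linear to_complex"
  unfolding linear_conv_bounded_linear[symmetric]
  by (rule linearI) (simp_all add: to_complex_def complex_eq_iff)

lemma bounded_linear_from_complex: "bounded_linear from_complex"
  unfolding linear_conv_bounded_linear[symmetric]
  by (rule linearI; rule vec2_eqI) (simp_all add: from_complex_def)

lemma cross2_to_complex: "Im (cnj (to_complex u) * to_complex v) = cross2 u v"
  by (simp add: to_complex_def cross2_def)

lemma bilinear_cross2: "bounded_bilinear cross2"
  unfolding bilinear_conv_bounded_bilinear[symmetric] bilinear_def
  by (auto intro!: linearI simp: cross2_def algebra_simps)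

lemmas cross2_simps =
  bounded_bilinear.add_left[OF bilinear_cross2] bounded_bilinear.add_right[OF bilinear_cross2]
  bounded_bilinear.diff_left[OF bilinear_cross2] bounded_bilinear.diff_right[OF bilinear_cross2]
  bounded_bilinear.scaleR_left[OF bilinear_cross2] bounded_bilinear.scaleR_right[OF bilinear_cross2]
  bounded_bilinear.minus_left[OF bilinear_cross2] bounded_bilinear.minus_right[OF bilinear_cross2]

lemma cross2_self [simp]: "cross2 u u = 0" by (simp add: cross2_def)

lemma cross2_swap: "cross2 v u = - cross2 u v" by (simp add: cross2_def)

lemma matrix_vector_mult_2:
  fixes A :: "real^2^2"
  shows "(A *v x) $ 1 = A$1$1 * x$1 + A$1$2 * x$2" "(A *v x) $ 2 = A$2$1 * x$1 + A$2$2 * x$2"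
  by (simp_all add: matrix_vector_mult_def sum_2)

lemma cross2_matrix: "cross2 (A *v u) (A *v v) = det A * cross2 u v"
  by (simp add: cross2_def matrix_vector_mult_2 det_2 algebra_simps)

lemma inner_2: "x \<bullet> y = x $ 1 * y $ 1 + x $ 2 * y $ 2" for x y :: "real^2"
  by (simp add: inner_vec_def sum_2)

lemma parallel_of_cross2_zero:
  assumes "cross2 d x = 0" "d \<noteq> 0"
  obtains k where "x = k *\<^sub>R d"
proof
  have dd: "d \<bullet> d \<noteq> 0" using assms by simp
  have eq: "(d \<bullet> d) *\<^sub>R x = (d \<bullet> x) *\<^sub>R d"
    using assms(1) by (intro vec2_eqI) (simp_all add: cross2_def inner_2, algebra+)
  show "x = ((d \<bullet> x) / (d \<bullet> d)) *\<^sub>R d"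
    using arg_cong[OF eq, of "\<lambda>y. inverse (d \<bullet> d) *\<^sub>R y"] dd
    by (simp add: divide_inverse mult.commute)
qed

lemma singular_iff_kernel: "det A = 0 \<longleftrightarrow> (\<exists>v. v \<noteq> 0 \<and> A *v v = 0)" for A :: "real^'n^'n"
  using invertible_det_nz[of A] matrix_left_invertible_ker[of A] invertible_left_inverse[of A] by blast

text \<open>
  In dimension two a matrix of determinant one and its inverse have the same eigenvalues; this is why
  the eigenvalue of \<open>A\<close> in direction \<open>d\<close> can be fed into a condition on \<open>J\<close>. The last conclusion says
  that \<open>A\<close> moves points across the direction \<open>d\<close> at the reciprocal rate \<open>1 / k\<close>.
\<close>
lemma eigenvalue_of_inverse_area_preserving:
  fixes A J :: "real^2^2"
  assumes AJ: "J ** A = mat 1" "A ** J = mat 1" and det: "det A = 1" and d: "d \<noteq> 0" "cross2 d (A *v d) = 0"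
  obtains k where "k \<noteq> 0" "real_eigenvalue J k" "\<And>y. k * cross2 d (A *v y) = cross2 d y"
proof -
  obtain k where k: "A *v d = k *\<^sub>R d" using parallel_of_cross2_zero[OF d(2,1)] by blast
  have key: "k * cross2 d (A *v y) = cross2 d y" for y
    using cross2_matrix[of A d y] det k by (simp add: cross2_simps)
  have "k \<noteq> 0"
  proof
    assume "k = 0"
    then have "J *v (A *v d) = 0" using k by simp
    then have "d = 0" by (simp add: matrix_vector_mul_assoc AJ)
    then show False using d by simp
  qed
  have "det (A - k *\<^sub>R mat 1) = 0"
  proof -
    have "(A - k *\<^sub>R mat 1) *v d = 0" using k by (simp add: matrix_vector_mult_diff_rdistrib scaleR_matrix_vector_assoc[symmetric])
    then show ?thesis using d singular_iff_kernel by blast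
  qed
  have "det J = 1" using det_mul[of J A] AJ det by simp
  have "J$1$1 = A$2$2 \<and> J$1$2 = - A$1$2 \<and> J$2$1 = - A$2$1 \<and> J$2$2 = A$1$1"
  proof -
    define B :: "real^2^2" where "B = vector [vector [A$2$2, - A$1$2], vector [- A$2$1, A$1$1]]"
    have "B ** A = mat 1"
      unfolding vec_eq_iff forall_2 using det
      by (simp add: B_def matrix_matrix_mult_def sum_2 mat_def det_2 algebra_simps)
    then have "B = J" using AJ by (metis matrix_mul_assoc matrix_mul_lid matrix_mul_rid)
    then show ?thesis by (auto simp: B_def)
  qed
  then have "det (J - k *\<^sub>R mat 1) = det (A - k *\<^sub>R mat 1)"
    by (simp add: det_2 mat_def algebra_simps)
  then have "det (J - k *\<^sub>R mat 1) = 0" using \<open>det (A - k *\<^sub>R mat 1) = 0\<close> by simp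
  then obtain v where "v \<noteq> 0" "(J - k *\<^sub>R mat 1) *v v = 0" using singular_iff_kernel by blast
  then have "real_eigenvalue J k"
    unfolding real_eigenvalue_def
    by (intro exI[of _ v]) (simp add: matrix_vector_mult_diff_rdistrib scaleR_matrix_vector_assoc[symmetric])
  then show thesis using that \<open>k \<noteq> 0\<close> key by blast
qed

lemma cross2_resolve: "cross2 d e *\<^sub>R x = cross2 x e *\<^sub>R d + cross2 d x *\<^sub>R e"
  by (rule vec2_eqI; simp add: cross2_def; algebra)

lemma inner_cross2_pythagoras: "(d \<bullet> d) * (x \<bullet> x) = (d \<bullet> x)\<^sup>2 + (cross2 d x)\<^sup>2"
  unfolding cross2_def inner_2 by algebra

text \<open>
  A vector far out in a strip along \<open>d\<close> has almost the direction of \<open>d\<close> or of \<open>- d\<close>. For two such vectors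
  at the same end of their strips the orientation is therefore that of the strips, and each of them lies outside
  the other strip.
\<close>
lemma far_vectors_cross:
  assumes c: "0 < cross2 d1 d2" and M: "0 \<le> M"
  shows "\<exists>K>0. \<forall>E1 E2 \<epsilon>. \<bar>\<epsilon>\<bar> = 1 \<and> \<bar>cross2 d1 E1\<bar> \<le> M \<and> \<bar>cross2 d2 E2\<bar> \<le> M \<and>
      K \<le> \<epsilon> * (d1 \<bullet> E1) \<and> K \<le> \<epsilon> * (d2 \<bullet> E2) \<longrightarrow>
      0 < cross2 E1 E2 \<and> M < \<bar>cross2 d2 E1\<bar> \<and> M < \<bar>cross2 d1 E2\<bar>"
proof -
  define c where "c = cross2 d1 d2"
  define g where "g = d1 \<bullet> d2"
  define n1 n2 where "n1 = d1 \<bullet> d1" and "n2 = d2 \<bullet> d2"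
  have c0: "c > 0" using assms by (simp add: c_def)
  have "d1 \<noteq> 0" "d2 \<noteq> 0" using assms by (auto simp: cross2_def)
  then have n: "n1 > 0" "n2 > 0" by (auto simp: n1_def n2_def)
  define q where "q = M * \<bar>g\<bar>"
  have q: "q \<ge> 0" using M by (simp add: q_def)
  define N where "N = 4 * q + M * n1 + M * n2"
  \<comment> \<open>Large enough for \<open>K * c\<close> to dominate every error term in the identities \<open>A\<close>, \<open>B\<close>, \<open>C\<close> below.\<close>
  define K where "K = N / c + (2 * M + 1)"
  have "K * c = N + (2 * M + 1) * c" using c0 by (simp add: K_def distrib_right)
  then have Kc: "K * c = 4 * q + M * n1 + M * n2 + (2 * M + 1) * c" by (simp only: N_def)
  have K1: "2 * M + 1 \<le> K" using c0 q M n by (simp add: K_def N_def)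
  then have K0: "K > 0" using M by linarith
  have Mn: "0 \<le> M * n1" "0 \<le> M * n2" "0 < (2 * M + 1) * c" using M n c0 by auto
  have "0 < cross2 E1 E2 \<and> M < \<bar>cross2 d2 E1\<bar> \<and> M < \<bar>cross2 d1 E2\<bar>"
    if e: "\<bar>\<epsilon>\<bar> = 1" and f: "\<bar>cross2 d1 E1\<bar> \<le> M" "\<bar>cross2 d2 E2\<bar> \<le> M"
      and u: "K \<le> \<epsilon> * (d1 \<bullet> E1)" "K \<le> \<epsilon> * (d2 \<bullet> E2)" for E1 E2 :: "real^2" and \<epsilon> :: real
  proof -
    define f1 f2 u1 u2 where "f1 = cross2 d1 E1" and "f2 = cross2 d2 E2" and "u1 = d1 \<bullet> E1" and "u2 = d2 \<bullet> E2"
    define v1 v2 where "v1 = \<epsilon> * u1" and "v2 = \<epsilon> * u2"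
    have ee: "\<epsilon> * \<epsilon> = 1" using e by (metis abs_mult_self_eq mult_1)
    have v: "K \<le> v1" "K \<le> v2" using u by (auto simp: v1_def v2_def u1_def u2_def)
    have v0: "0 < v1" "0 < v2" using v K0 by auto
    have au: "\<bar>u1\<bar> = v1" "\<bar>u2\<bar> = v2" using v0 e by (auto simp: v1_def v2_def abs_mult[symmetric] dest: abs_of_pos) (metis abs_mult abs_of_pos mult_1)+
    have vv: "v1 * v2 = u1 * u2" using ee by (simp add: v1_def v2_def mult_ac)
    have fb: "\<bar>f1\<bar> \<le> M" "\<bar>f2\<bar> \<le> M" using f by (auto simp: f1_def f2_def)
    have fg: "\<bar>f1 * g\<bar> \<le> q" "\<bar>f2 * g\<bar> \<le> q" using fb by (auto simp: q_def abs_mult intro!: mult_right_mono)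
    have A: "n1 * cross2 d2 E1 = f1 * g - u1 * c" and B: "n2 * cross2 d1 E2 = f2 * g + u2 * c"
      and C: "n1 * n2 * cross2 E1 E2 = u1 * u2 * c - (f1 * g) * u2 + (f2 * g) * u1 + f1 * f2 * c"
      unfolding n1_def n2_def f1_def f2_def u1_def u2_def g_def c_def cross2_def inner_2 by algebra+
    have cv: "K * c \<le> v1 * c" "K * c \<le> v2 * c" using v c0 by auto
    have "n1 * M < n1 * \<bar>cross2 d2 E1\<bar>"
    proof -
      have "\<bar>u1 * c\<bar> - \<bar>f1 * g\<bar> \<le> \<bar>n1 * cross2 d2 E1\<bar>" unfolding A by linarith
      moreover have "\<bar>u1 * c\<bar> = v1 * c" using c0 au by (simp add: abs_mult)
      moreover have "\<bar>n1 * cross2 d2 E1\<bar> = n1 * \<bar>cross2 d2 E1\<bar>" using n by (simp add: abs_mult)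
      ultimately have "v1 * c - q \<le> n1 * \<bar>cross2 d2 E1\<bar>" using fg by linarith
      moreover have "M * n1 < v1 * c - q" using cv Kc q Mn by linarith
      ultimately show ?thesis by (simp only: mult.commute[of n1 M])
    qed
    then have 1: "M < \<bar>cross2 d2 E1\<bar>" using n by simp
    have "n2 * M < n2 * \<bar>cross2 d1 E2\<bar>"
    proof -
      have "\<bar>u2 * c\<bar> - \<bar>f2 * g\<bar> \<le> \<bar>n2 * cross2 d1 E2\<bar>" unfolding B by linarith
      moreover have "\<bar>u2 * c\<bar> = v2 * c" using c0 au by (simp add: abs_mult)
      moreover have "\<bar>n2 * cross2 d1 E2\<bar> = n2 * \<bar>cross2 d1 E2\<bar>" using n by (simp add: abs_mult)
      ultimately have "v2 * c - q \<le> n2 * \<bar>cross2 d1 E2\<bar>" using fg by linarith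
      moreover have "M * n2 < v2 * c - q" using cv Kc q Mn by linarith
      ultimately show ?thesis by (simp only: mult.commute[of n2 M])
    qed
    then have 2: "M < \<bar>cross2 d1 E2\<bar>" using n by simp
    have "0 < n1 * n2 * cross2 E1 E2"
    proof -
      have q4: "4 * q \<le> v1 * c" "4 * q \<le> v2 * c" using cv Kc Mn q by linarith+
      have t1: "4 * (q * v2) \<le> v1 * v2 * c" using mult_right_mono[OF q4(1), of v2] v0 by (simp add: mult_ac)
      have t2: "4 * (q * v1) \<le> v1 * v2 * c" using mult_right_mono[OF q4(2), of v1] v0 by (simp add: mult_ac)
      have "2 * M * (2 * M) \<le> v1 * v2" using v K1 M v0 by (intro mult_mono) auto
      then have t3: "4 * (M * M * c) \<le> v1 * v2 * c" using c0 by (simp add: mult_ac)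
      have t4: "0 < v1 * v2 * c" using v0 c0 by simp
      have b1: "\<bar>(f1 * g) * u2\<bar> \<le> q * v2" unfolding abs_mult[of "f1 * g"] au using fg v0 by (intro mult_right_mono) auto
      have b2: "\<bar>(f2 * g) * u1\<bar> \<le> q * v1" unfolding abs_mult[of "f2 * g"] au using fg v0 by (intro mult_right_mono) auto
      have "\<bar>f1 * f2\<bar> \<le> M * M" unfolding abs_mult using fb M by (intro mult_mono) auto
      then have "\<bar>f1 * f2\<bar> * c \<le> M * M * c" using c0 by (intro mult_right_mono) auto
      then have b3: "\<bar>f1 * f2 * c\<bar> \<le> M * M * c" using c0 by (simp add: abs_mult)
      have "u1 * u2 * c = v1 * v2 * c" by (simp add: vv)
      then show ?thesis unfolding C using t1 t2 t3 t4 b1 b2 b3 by linarith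
    qed
    then have "0 < cross2 E1 E2" by (rule zero_less_mult_pos[OF _ mult_pos_pos[OF n]])
    then show ?thesis using 1 2 by blast
  qed
  then show ?thesis using K0 by blast
qed

section \<open>Real eigenvalues and the W-condition\<close>

lemma rot_nth:
  "(rot t *v x) $ 1 = cos t * x $ 1 - sin t * x $ 2"
  "(rot t *v x) $ 2 = sin t * x $ 1 + cos t * x $ 2"
  by (simp_all add: rot_def matrix_vector_mult_def sum_2)

lemma rot_inverse: "rot (- t) *v (rot t *v x) = x"
proof -
  have "cos t * (cos t * c) + sin t * (sin t * c) = ((sin t)\<^sup>2 + (cos t)\<^sup>2) * c" for c :: real
    unfolding power2_eq_square by (simp only: distrib_right mult.assoc add.commute)
  then have c: "cos t * (cos t * c) + sin t * (sin t * c) = c" for c :: real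
    by simp
  have "cos t * (cos t * a - sin t * b) + sin t * (sin t * a + cos t * b) = a"
       "cos t * (sin t * a + cos t * b) - sin t * (cos t * a - sin t * b) = b" for a b :: real
    using c[of a] c[of b] by (simp_all add: right_diff_distrib distrib_left mult.left_commute)
  then show ?thesis
    by (intro vec2_eqI) (simp_all only: rot_nth cos_minus sin_minus mult_minus_left diff_minus_eq_add minus_mult_minus add_uminus_conv_diff, simp_all)
qed

lemma rot_nonzero: "v \<noteq> 0 \<Longrightarrow> rot t *v v \<noteq> 0"
  by (metis rot_inverse matrix_vector_mult_0_right)

lemma derivative_jacobian:
  fixes F :: "real^2 \<Rightarrow> real^2"
  assumes "F differentiable (at x)"
  shows "(F has_derivative (\<lambda>v. jacobian F (at x) *v v)) (at x)"
  using assms jacobian_works by blast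

lemma jacobian_eqI:
  fixes F :: "real^2 \<Rightarrow> real^2"
  assumes "(F has_derivative D) (at x)"
  shows "jacobian F (at x) *v v = D v"
  unfolding jacobian_def frechet_derivative_at[OF assms, symmetric]
  by (simp add: has_derivative_linear[OF assms])

text \<open>
  Rotating source and target together conjugates the derivative by the rotation.
\<close>
lemma eigenvalue_rot_conj:
  fixes F :: "real^2 \<Rightarrow> real^2"
  assumes F: "F differentiable (at x)" and ev: "real_eigenvalue (jacobian F (at x)) c"
  shows "real_eigenvalue (jacobian (rot_conj t F) (at (rot t *v x))) c"
proof -
  obtain v where v: "v \<noteq> 0" "jacobian F (at x) *v v = c *\<^sub>R v"
    using ev unfolding real_eigenvalue_def by blast
  let ?D = "\<lambda>v. jacobian F (at x) *v v"
  have D: "(F has_derivative ?D) (at (rot (- t) *v (rot t *v x)))"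
    using derivative_jacobian[OF F] by (simp add: rot_inverse)
  have R: "((\<lambda>z. A *v z) has_derivative (\<lambda>z. A *v z)) (at y)" for A :: "real^2^2" and y
    by (rule bounded_linear_imp_has_derivative) simp
  have "(rot_conj t F has_derivative (\<lambda>v. rot t *v ?D (rot (- t) *v v))) (at (rot t *v x))"
    unfolding rot_conj_def
    by (rule has_derivative_compose[OF has_derivative_compose[OF R D] R])
  then have "jacobian (rot_conj t F) (at (rot t *v x)) *v (rot t *v v) = c *\<^sub>R (rot t *v v)"
    by (simp add: jacobian_eqI rot_inverse v(2) matrix_vector_mult_scaleR)
  then show ?thesis
    unfolding real_eigenvalue_def using rot_nonzero[OF v(1)] by blast
qed

text \<open>
  The W-condition in the form used below: rotations turn the first coordinate into an arbitrary unit
  functional \<open>m\<close>, and boundedness of the values of \<open>F\<close> replaces convergence, by compactness.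
\<close>
lemma W_condition_eigenvalue_bound:
  fixes F :: "real^2 \<Rightarrow> real^2"
  assumes F: "\<And>x. F differentiable (at x)" and W: "W_condition F"
  obtains P where "P \<in> weight_functions"
    "\<And>m R. norm m = 1 \<Longrightarrow> \<exists>\<delta>>0. \<exists>X. \<forall>x c. m \<bullet> x \<ge> X \<and> norm (F x) \<le> R \<and>
       real_eigenvalue (jacobian F (at x)) c \<longrightarrow> \<delta> \<le> \<bar>c\<bar> * P (m \<bullet> x)"
proof -
  obtain P where P: "P \<in> weight_functions"
    and seq: "\<forall>\<theta>. \<not> (\<exists>x y T ev. filterlim x at_top sequentially \<and>
          (\<lambda>k. rot_conj \<theta> F (vector [x k, y k])) \<longlonglongrightarrow> T \<and>
          (\<forall>k. real_eigenvalue (jacobian (rot_conj \<theta> F) (at (vector [x k, y k]))) (ev k)) \<and>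
          (\<lambda>k. ev k * P (x k)) \<longlonglongrightarrow> 0)"
    using W unfolding W_condition_def by (elim bexE) (rule that)
  have noseq: False if "filterlim x at_top sequentially"
      "(\<lambda>k. rot_conj \<theta> F (vector [x k, y k])) \<longlonglongrightarrow> T"
      "\<forall>k. real_eigenvalue (jacobian (rot_conj \<theta> F) (at (vector [x k, y k]))) (ev k)"
      "(\<lambda>k. ev k * P (x k)) \<longlonglongrightarrow> 0" for x y T \<theta> ev
    using seq[rule_format, of \<theta>] that by (elim notE) (intro exI conjI)
  have "\<exists>\<delta>>0. \<exists>X. \<forall>x c. m \<bullet> x \<ge> X \<and> norm (F x) \<le> R \<and>
       real_eigenvalue (jacobian F (at x)) c \<longrightarrow> \<delta> \<le> \<bar>c\<bar> * P (m \<bullet> x)"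
    if m: "norm m = 1" for m R
  proof (rule ccontr)
    assume neg: "\<not> ?thesis"
    have "\<exists>x c. m \<bullet> x \<ge> real k \<and> norm (F x) \<le> R \<and> real_eigenvalue (jacobian F (at x)) c
        \<and> \<bar>c\<bar> * P (m \<bullet> x) < inverse (real (Suc k))" for k
      using neg by (meson not_le inverse_positive_iff_positive of_nat_0_less_iff zero_less_Suc)
    then obtain x c where xc: "\<And>k. m \<bullet> x k \<ge> real k" "\<And>k. norm (F (x k)) \<le> R"
        "\<And>k. real_eigenvalue (jacobian F (at (x k))) (c k)"
        "\<And>k. \<bar>c k\<bar> * P (m \<bullet> x k) < inverse (real (Suc k))"
      by metis
    have m2: "(m$1)\<^sup>2 + (- m$2)\<^sup>2 = 1"
      using m by (simp add: norm_vec_def L2_set_def sum_2)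
    obtain \<theta> where th: "m$1 = cos \<theta>" "- m$2 = sin \<theta>"
      using sincos_total_2pi[OF m2] by metis
    have rx: "rot \<theta> *v z = vector [m \<bullet> z, (rot \<theta> *v z)$2]" for z
      by (intro vec2_eqI) (simp_all add: rot_nth inner_vec_def sum_2 th[symmetric])
    have "bounded (range (\<lambda>k. F (x k)))"
      using xc(2) by (auto simp: bounded_iff)
    then obtain T r where r: "strict_mono r" "(\<lambda>k. F (x (r k))) \<longlonglongrightarrow> T"
      using bounded_imp_convergent_subsequence[of "\<lambda>k. F (x k)"] unfolding comp_def by blast
    let ?x = "\<lambda>k. m \<bullet> x (r k)" and ?y = "\<lambda>k. (rot \<theta> *v x (r k))$2"
    have rk: "k \<le> r k" for k
      by (rule seq_suble[OF r(1)])
    show False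
    proof (rule noseq[of ?x \<theta> ?y "rot \<theta> *v T" "\<lambda>k. c (r k)"])
      show "filterlim ?x at_top sequentially"
      proof (rule filterlim_at_top_mono[OF filterlim_real_sequentially], rule always_eventually, rule allI)
        show "real k \<le> ?x k" for k
          using xc(1)[of "r k"] rk[of k] by linarith
      qed
      have "rot_conj \<theta> F (vector [?x k, ?y k]) = rot \<theta> *v F (x (r k))" for k
        by (simp add: rot_conj_def rx[symmetric] rot_inverse)
      moreover have "(\<lambda>k. rot \<theta> *v F (x (r k))) \<longlonglongrightarrow> rot \<theta> *v T"
        by (intro bounded_linear.tendsto[OF matrix_vector_mul_bounded_linear] r(2))
      ultimately show "(\<lambda>k. rot_conj \<theta> F (vector [?x k, ?y k])) \<longlonglongrightarrow> rot \<theta> *v T"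
        by simp
      show "\<forall>k. real_eigenvalue (jacobian (rot_conj \<theta> F) (at (vector [?x k, ?y k]))) (c (r k))"
        using eigenvalue_rot_conj[OF F xc(3)] by (simp add: rx[symmetric])
      show "(\<lambda>k. c (r k) * P (?x k)) \<longlonglongrightarrow> 0"
      proof (rule Lim_null_comparison)
        have pos: "P (?x k) > 0" if "k > 0" for k
          using P xc(1)[of "r k"] rk[of k] that unfolding weight_functions_def by auto
        have "norm (c (r k) * P (?x k)) \<le> inverse (real (Suc k))" if "k > 0" for k
        proof -
          have "norm (c (r k) * P (?x k)) < inverse (real (Suc (r k)))"
            using xc(4)[of "r k"] pos[OF that] by (simp add: abs_mult)
          also have "\<dots> \<le> inverse (real (Suc k))"
            using rk[of k] by (simp add: field_simps)
          finally show ?thesis by simp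
        qed
        then show "\<forall>\<^sub>F k in sequentially. norm (c (r k) * P (?x k)) \<le> inverse (real (Suc k))"
          by (intro eventually_mono[OF eventually_gt_at_top[of 0]])
        show "(\<lambda>k. inverse (real (Suc k))) \<longlonglongrightarrow> 0"
          by (rule LIMSEQ_inverse_real_of_nat)
      qed
    qed
  qed
  then show thesis
    using that P by blast
qed

section \<open>Growth controlled by a weight function\<close>

text \<open>
  Comparison of integral and series for the nonincreasing function \<open>1 / P\<close>.
\<close>
lemma weight_sum_unbounded:
  assumes P: "P \<in> weight_functions"
  shows "\<exists>n. C < (\<Sum>j=k..<k+n. 1 / P (real (Suc j)))"
proof (rule ccontr)
  assume "\<not> ?thesis"
  then have bd: "(\<Sum>j=k..<k+n. 1 / P (real (Suc j))) \<le> C" for n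
    by (simp add: not_less)
  have pos: "x > 0 \<Longrightarrow> P x > 0" and mono: "0 < x \<Longrightarrow> x \<le> y \<Longrightarrow> P x \<le> P y" for x y
    using P unfolding weight_functions_def mono_on_def by auto
  define f where "f x = 1 / P x" for x
  have decr: "f y \<le> f x" if "0 < x" "x \<le> y" for x y
    using pos[OF that(1)] mono[OF that] unfolding f_def by (simp add: frac_le)
  have intf: "f integrable_on {x..y}" if "0 < x" for x y
  proof -
    have "(\<lambda>x. - f x) integrable_on {x..y}"
      by (rule integrable_on_mono_on) (use decr that in \<open>auto simp: mono_on_def\<close>)
    then show ?thesis
      using integrable_neg by fastforce
  qed
  have fnn: "0 \<le> f x" if "0 < x" for x
    using pos[OF that] by (simp add: f_def)
  \<comment> \<open>Starting at \<open>k + 2\<close> keeps the left end of the interval of integration to the right of \<open>2\<close>.\<close>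
  define m where "m = Suc (Suc k)"
  have step: "integral {real m..real (m + n)} f \<le> (\<Sum>j=m..<m+n. f (real j))" for n
  proof (induction n)
    case (Suc n)
    have "integral {real m..real (m + Suc n)} f
        = integral {real m..real (m + n)} f + integral {real (m+n)..real (m + Suc n)} f"
      by (rule Henstock_Kurzweil_Integration.integral_combine[symmetric]) (auto intro: intf simp: m_def)
    also have "integral {real (m+n)..real (m + Suc n)} f
        \<le> integral {real (m+n)..real (m + Suc n)} (\<lambda>_. f (real (m + n)))"
      by (rule integral_le) (auto intro!: intf decr simp: m_def)
    finally show ?case
      using Suc by (simp del: of_nat_add)
  qed simp
  have sums: "(\<Sum>j=m..<m+n. f (real j)) \<le> C" for n
  proof -
    have "(\<Sum>j=m..<m+n. f (real j)) = (\<Sum>j=Suc k..<Suc (k+n). f (real (Suc j)))"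
      unfolding m_def using sum.shift_bounds_Suc_ivl[of "\<lambda>j. f (real j)" "Suc k" "Suc (k+n)"] by simp
    also have "\<dots> \<le> (\<Sum>j=k..<k+Suc n. f (real (Suc j)))"
      by (rule sum_mono2) (auto intro: fnn)
    finally show ?thesis
      using bd[of "Suc n"] unfolding f_def by linarith
  qed
  define M where "M = \<bar>integral {2..real m} f\<bar> + \<bar>C\<bar> + 1"
  obtain N where N: "N > 2" "integral {2..N} f > M"
  proof -
    have "M > 0" unfolding M_def by simp
    then show thesis
      using P that unfolding weight_functions_def f_def by blast
  qed
  obtain n where n: "N \<le> real n"
    using real_arch_simple by blast
  have "integral {2..N} f \<le> integral {2..real (m + n)} f"
    by (rule integral_subset_le) (use n intf fnn in auto)
  also have "\<dots> = integral {2..real m} f + integral {real m..real (m+n)} f"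
    by (rule Henstock_Kurzweil_Integration.integral_combine[symmetric]) (auto intro: intf simp: m_def)
  also have "\<dots> \<le> M"
    using step[of n] sums[of n] unfolding M_def by linarith
  finally show False using N by simp
qed

text \<open>
  Heuristically \<open>\<phi>' \<le> K P(\<phi>)\<close>, so \<open>\<phi>\<close> needs infinite time to reach infinity. The derivative is replaced by a
  smooth function touching \<open>\<phi>\<close> from below, as is available for a maximum of smooth functions.
  Since \<open>P\<close> may jump, the comparison is made separately between consecutive integer heights.
\<close>
lemma slow_growth_bounded:
  fixes \<phi> :: "real \<Rightarrow> real"
  assumes P: "P \<in> weight_functions" and K: "K > 0"
    and cont: "continuous_on {0..<1} \<phi>"
    and slope: "\<And>s. 0 < s \<Longrightarrow> s < 1 \<Longrightarrow> \<phi> s \<ge> X \<Longrightarrow>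
      \<exists>\<psi> \<mu>. (\<psi> has_real_derivative \<mu>) (at s) \<and> \<psi> s = \<phi> s \<and> \<mu> \<le> K * P (\<phi> s) \<and>
        (\<forall>t. 0 \<le> t \<and> t < s \<longrightarrow> \<psi> t \<le> \<phi> t)"
  shows "\<exists>B. \<forall>s\<in>{0..<1}. \<phi> s \<le> B"
proof (rule ccontr)
  assume unb: "\<not> ?thesis"
  have pos: "x > 0 \<Longrightarrow> P x > 0" and mono: "0 < x \<Longrightarrow> x \<le> y \<Longrightarrow> P x \<le> P y" for x y
    using P unfolding weight_functions_def mono_on_def by auto
  obtain k0 :: nat where k0: "real k0 \<ge> max 1 (max X (\<phi> 0))"
    using real_arch_simple by blast
  have climb: "1 / (K * P (real (Suc k))) \<le> s - s'"
    if k: "k0 \<le> k" and s': "0 \<le> s'" "s' < s" "s < 1" and lo: "\<phi> s' \<le> real k"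
      and hi: "real (Suc k) \<le> \<phi> s" for k s s'
  proof (rule ccontr)
    assume neg: "\<not> ?thesis"
    let ?p = "K * P (real (Suc k))"
    have p: "?p > 0" using K pos by simp
    have "s - s' < 1 / ?p" using neg by (simp only: not_le)
    then have "?p * (s - s') < 1" using p by (simp only: pos_less_divide_eq mult.commute)
    then have "?p < 1 / (s - s')" using s' by (simp add: field_simps)
    then obtain q where q: "?p < q" "q < 1 / (s - s')" using dense by blast
    have q1: "q * (s - s') < 1" using q(2) s' by (simp add: field_simps)
    \<comment> \<open>A line through the point reached at time \<open>s\<close>, too steep for \<open>\<phi>\<close>; look at where \<open>\<phi>\<close> first meets it.\<close>
    define l where "l x = real (Suc k) - q * (s - x)" for x
    let ?S = "{x \<in> {s'..s}. l x \<le> \<phi> x}"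
    have cphi: "continuous_on {s'..s} \<phi>"
      by (rule continuous_on_subset[OF cont]) (use s' in auto)
    have cl: "continuous_on {s'..s} l"
      unfolding l_def by (intro continuous_intros)
    have "closed ?S"
      by (rule continuous_on_closed_Collect_le[OF cl cphi]) simp
    moreover have "?S \<subseteq> {s'..s}" by blast
    ultimately have "compact ?S"
      using compact_Icc compact_Int_closed[of "{s'..s}" ?S] by (simp add: Int_absorb1)
    moreover have "s \<in> ?S" using s' hi by (simp add: l_def)
    ultimately obtain x where x: "x \<in> ?S" "\<And>y. y \<in> ?S \<Longrightarrow> x \<le> y"
      using compact_attains_inf[of ?S] by blast
    have ls': "l s' > \<phi> s'" using lo q1 by (simp add: l_def)
    then have xs': "s' < x" "x \<le> s" using x(1) by (auto simp: less_le)
    have below: "\<phi> t < l t" if "s' \<le> t" "t < x" for t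
      using x(2)[of t] that xs' by force
    have "\<phi> x = l x"
    proof (rule ccontr)
      assume "\<phi> x \<noteq> l x"
      then have "\<phi> x > l x" using x(1) by auto
      then have "\<exists>t\<ge>s'. t \<le> x \<and> \<phi> t - l t = 0"
        by (intro IVT') (use ls' xs' in \<open>auto intro!: continuous_intros continuous_on_subset[OF cphi] continuous_on_subset[OF cl]\<close>)
      then obtain t where t: "s' \<le> t" "t \<le> x" "\<phi> t = l t" by auto
      then have "t \<in> ?S" using xs' by auto
      then have "t = x" using x(2)[of t] t by force
      then show False using t \<open>\<phi> x > l x\<close> by simp
    qed
    then have phix: "\<phi> x = real (Suc k) - q * (s - x)" by (simp add: l_def)
    have qpos: "q > 0" using p q(1) by linarith
    have "q * (s - x) \<le> q * (s - s')" "0 \<le> q * (s - x)" using qpos xs' by simp_all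
    then have range: "real k \<le> \<phi> x" "\<phi> x \<le> real (Suc k)"
      unfolding phix of_nat_Suc using q1 by linarith+
    have "X \<le> \<phi> x" "0 < \<phi> x" using k k0 range by auto
    then obtain \<psi> \<mu> where psi: "(\<psi> has_real_derivative \<mu>) (at x)" "\<psi> x = \<phi> x" "\<mu> \<le> K * P (\<phi> x)"
        "\<And>t. 0 \<le> t \<Longrightarrow> t < x \<Longrightarrow> \<psi> t \<le> \<phi> t"
      using slope[of x] xs' s' by (metis le_less_trans less_trans order_le_less_trans)
    have "\<mu> \<le> ?p"
      using psi(3) mono[OF \<open>0 < \<phi> x\<close> range(2)] K by (smt (verit) mult_left_mono)
    then have mq: "\<mu> - q < 0" using q(1) by linarith
    have dl: "((\<lambda>t. \<psi> t - l t) has_real_derivative (\<mu> - q)) (at x)"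
      unfolding l_def by (auto intro!: derivative_eq_intros psi(1))
    obtain d where d: "d > 0" "\<And>h. h > 0 \<Longrightarrow> h < d \<Longrightarrow> \<psi> x - l x < \<psi> (x - h) - l (x - h)"
      using DERIV_neg_dec_left[OF dl mq] by blast
    define h where "h = min (d/2) (x - s')"
    have h: "h > 0" "h < d" "s' \<le> x - h" using d xs' by (auto simp: h_def)
    have "0 < \<psi> (x - h) - l (x - h)" using d(2)[OF h(1,2)] psi(2) \<open>\<phi> x = l x\<close> by simp
    moreover have "\<psi> (x - h) \<le> \<phi> (x - h)" using psi(4)[of "x - h"] h s' by simp
    moreover have "\<phi> (x - h) < l (x - h)" using below[of "x - h"] h by simp
    ultimately show False by linarith
  qed
  have total: "(\<Sum>j=k0..<k0+n. 1 / (K * P (real (Suc j)))) \<le> s"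
    if "0 \<le> s" "s < 1" "real (k0 + n) \<le> \<phi> s" for n s
    using that
  proof (induction n arbitrary: s)
    case (Suc n)
    have "\<exists>s'\<ge>0. s' \<le> s \<and> \<phi> s' = real (k0 + n)"
      by (intro IVT') (use Suc.prems k0 in \<open>auto intro!: continuous_on_subset[OF cont]\<close>)
    then obtain s' where s': "0 \<le> s'" "s' \<le> s" "\<phi> s' = real (k0 + n)" by blast
    then have "s' < s" using Suc.prems(3) by (cases "s' = s") auto
    then have "1 / (K * P (real (Suc (k0 + n)))) \<le> s - s'"
      using climb[of "k0 + n" s' s] s' Suc.prems by simp
    moreover have "(\<Sum>j=k0..<k0+n. 1 / (K * P (real (Suc j)))) \<le> s'"
      by (rule Suc.IH) (use s' Suc.prems in auto)
    ultimately show ?case by simp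
  qed simp
  obtain n where n: "K < (\<Sum>j=k0..<k0+n. 1 / P (real (Suc j)))"
    using weight_sum_unbounded[OF P] by blast
  obtain s where "s \<in> {0..<1}" "real (k0 + n) < \<phi> s" using unb by (meson not_le)
  then have "(\<Sum>j=k0..<k0+n. 1 / (K * P (real (Suc j)))) \<le> 1"
    using total[of s n] by simp
  moreover have "(\<Sum>j=k0..<k0+n. 1 / (K * P (real (Suc j)))) = (\<Sum>j=k0..<k0+n. 1 / P (real (Suc j))) / K"
    by (simp add: sum_divide_distrib mult.commute)
  ultimately have "(\<Sum>j=k0..<k0+n. 1 / P (real (Suc j))) / K \<le> 1" by simp
  then show False using n K by (simp only: pos_divide_le_eq mult_1)
qed

lemma continuous_on_slice_max:
  fixes h :: "real \<times> real \<Rightarrow> real"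
  assumes h: "continuous_on ({0..<1} \<times> {0..1}) h"
    and attained: "\<And>t. t \<in> {0..<1} \<Longrightarrow> \<exists>s\<in>{0..1}. \<phi> t = h (t, s)"
    and upper: "\<And>t s. t \<in> {0..<1} \<Longrightarrow> s \<in> {0..1} \<Longrightarrow> h (t, s) \<le> \<phi> t"
  shows "continuous_on {0..<1} \<phi>"
  unfolding continuous_on_iff
proof (intro ballI allI impI)
  fix t0 e :: real assume t0: "t0 \<in> {0..<1}" and e: "0 < e"
  define T where "T = (t0 + 1) / 2"
  have T: "t0 < T" "T < 1" using t0 by (auto simp: T_def)
  have "uniformly_continuous_on ({0..T} \<times> {0..1}) h"
    by (rule compact_uniformly_continuous[OF continuous_on_subset[OF h]]) (use T in \<open>auto intro: compact_Times\<close>)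
  then obtain \<delta> where d: "\<delta> > 0" "\<And>x y. x \<in> {0..T} \<times> {0..1} \<Longrightarrow> y \<in> {0..T} \<times> {0..1} \<Longrightarrow> dist y x < \<delta> \<Longrightarrow> dist (h y) (h x) < e"
    using e unfolding uniformly_continuous_on_def by meson
  have "dist (\<phi> t) (\<phi> t0) < e" if t: "t \<in> {0..<1}" "dist t t0 < min \<delta> (T - t0)" for t
  proof -
    have tT: "t \<in> {0..T}" "t0 \<in> {0..T}" using t t0 T by (auto simp: dist_real_def)
    have close: "\<bar>h (t, s) - h (t0, s)\<bar> < e" if "s \<in> {0..1}" for s
      using d(2)[of "(t0, s)" "(t, s)"] tT t that by (simp add: dist_Pair_Pair dist_real_def)
    obtain s where s: "s \<in> {0..1}" "\<phi> t = h (t, s)" using attained[OF t(1)] by blast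
    obtain s0 where s0: "s0 \<in> {0..1}" "\<phi> t0 = h (t0, s0)" using attained[OF t0] by blast
    show ?thesis
      using close[OF s(1)] close[OF s0(1)] upper[OF t(1) s0(1)] upper[OF t0 s(1)] s(2) s0(2)
      by (simp add: dist_real_def abs_less_iff)
  qed
  then show "\<exists>d>0. \<forall>t\<in>{0..<1}. dist t t0 < d \<longrightarrow> dist (\<phi> t) (\<phi> t0) < e"
    using d(1) T by (intro exI[of _ "min \<delta> (T - t0)"]) auto
qed

section \<open>Local injectivity from positive Jacobians\<close>

text \<open>
  Near \<open>x\<close> the function is \<open>c (z - x)\<close> up to a relative error less than one, so a zero at \<open>x\<close> is
  isolated and of index one. Allowing a fixed error instead of a vanishing one admits zeros with a merely
  real-linear, orientation preserving derivative.
\<close>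
definition positive_zero :: "(complex \<Rightarrow> complex) \<Rightarrow> complex \<Rightarrow> bool" where
  "positive_zero f x \<longleftrightarrow> (\<exists>c \<delta>. c \<noteq> 0 \<and> \<delta> < 1 \<and>
     (\<forall>\<^sub>F z in at x. norm (f z / (c * (z - x)) - 1) \<le> \<delta>))"

lemma positive_zero_mult:
  assumes f: "positive_zero f x" and u: "isCont u x" "u x \<noteq> 0"
  shows "positive_zero (\<lambda>z. f z * u z) x"
proof -
  obtain c \<delta> where c: "c \<noteq> 0" "\<delta> < 1" "\<forall>\<^sub>F z in at x. norm (f z / (c * (z - x)) - 1) \<le> \<delta>"
    using f unfolding positive_zero_def by blast
  define e where "e = (1 - \<delta>) / 4"
  have e: "e > 0" using c by (simp add: e_def)
  have "((\<lambda>z. u z / u x) \<longlongrightarrow> u x / u x) (at x)"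
    using u by (intro tendsto_intros) (auto simp: isCont_def)
  then have "\<forall>\<^sub>F z in at x. dist (u z / u x) 1 < e"
    using e u(2) tendstoD by fastforce
  with c(3) have "\<forall>\<^sub>F z in at x. norm (f z * u z / ((c * u x) * (z - x)) - 1) \<le> \<delta> + 2 * e"
  proof eventually_elim
    case (elim z)
    let ?a = "f z / (c * (z - x))" and ?b = "u z / u x"
    have "0 \<le> \<delta>" using elim(1) norm_ge_zero order_trans by blast
    have b: "norm (?b - 1) \<le> e" using elim(2) by (simp add: dist_norm)
    have a2: "norm ?a \<le> 2"
      using elim(1) c(2) norm_triangle_sub[of ?a 1] by simp
    have "f z * u z / ((c * u x) * (z - x)) = ?a * ?b"
      by (simp add: mult_ac)
    then have "f z * u z / ((c * u x) * (z - x)) - 1 = (?a - 1) + ?a * (?b - 1)"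
      by (simp only: right_diff_distrib) simp
    also have "norm \<dots> \<le> norm (?a - 1) + norm ?a * norm (?b - 1)"
      by (metis norm_mult norm_triangle_ineq)
    also have "\<dots> \<le> \<delta> + 2 * e"
      using elim(1) a2 b by (intro add_mono mult_mono) auto
    finally show ?case .
  qed
  moreover have "\<delta> + 2 * e < 1" using c(2) by (simp add: e_def field_simps)
  ultimately show ?thesis
    unfolding positive_zero_def using c(1) u(2) by (intro exI[of _ "c * u x"] exI[of _ "\<delta> + 2*e"]) auto
qed

lemma positive_zero_cong:
  assumes "positive_zero f x" "\<forall>\<^sub>F z in at x. f z = g z"
  shows "positive_zero g x"
proof -
  obtain c \<delta> where c: "c \<noteq> 0" "\<delta> < 1" "\<forall>\<^sub>F z in at x. norm (f z / (c * (z - x)) - 1) \<le> \<delta>"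
    using assms unfolding positive_zero_def by blast
  have "\<forall>\<^sub>F z in at x. norm (g z / (c * (z - x)) - 1) \<le> \<delta>"
    using c(3) assms(2) by eventually_elim simp
  then show ?thesis unfolding positive_zero_def using c by blast
qed

text \<open>
  The quotient by \<open>z - x\<close> need not have a limit at \<open>x\<close>, but it stays in a disc around \<open>c\<close> that avoids \<open>0\<close>, so it
  can be redefined near \<open>x\<close> to become continuous and nonzero. The change is confined to the
  neighbourhood \<open>N\<close>, which can be taken away from the boundary circle and from all other zeros.
\<close>
lemma positive_zero_divide_out:
  fixes f :: "complex \<Rightarrow> complex"
  assumes f: "continuous_on (cball p r) f" and x: "x \<in> ball p r" and pz: "positive_zero f x" and fx: "f x = 0"
    and N: "open N" "x \<in> N"
  obtains g where "continuous_on (cball p r) g" "g x \<noteq> 0"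
    "\<And>z. z \<in> N \<Longrightarrow> z \<in> cball p r \<Longrightarrow> z \<noteq> x \<Longrightarrow> f z \<noteq> 0 \<Longrightarrow> g z \<noteq> 0"
    "\<And>z. z \<notin> N \<Longrightarrow> g z = f z / (z - x)"
proof -
  obtain c \<delta> where c: "c \<noteq> 0" "\<delta> < 1" "\<forall>\<^sub>F z in at x. norm (f z / (c * (z - x)) - 1) \<le> \<delta>"
    using pz unfolding positive_zero_def by blast
  have "open (N \<inter> ball p r)" "x \<in> N \<inter> ball p r" using N x by auto
  then obtain e1 where e1: "e1 > 0" "ball x e1 \<subseteq> N \<inter> ball p r" using openE by blast
  obtain e2 where e2: "e2 > 0" "\<And>z. z \<noteq> x \<Longrightarrow> dist z x < e2 \<Longrightarrow> norm (f z / (c * (z - x)) - 1) \<le> \<delta>"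
    using c(3) unfolding eventually_at by auto
  define \<rho> where "\<rho> = min e1 e2 / 2"
  have rho: "\<rho> > 0" "\<rho> < e1" "\<rho> < e2" using e1(1) e2(1) by (auto simp: \<rho>_def)
  define t where "t z = min 1 (norm (z - x) / \<rho>)" for z
  define \<zeta> where "\<zeta> z = f z / (c * (z - x)) - 1" for z
  have zeta: "norm (\<zeta> z) \<le> \<delta>" if "z \<noteq> x" "dist z x \<le> \<rho>" for z
    using e2(2)[of z] that rho by (auto simp: \<zeta>_def)
  \<comment> \<open>On the small disc the quotient is contracted towards the constant \<open>c\<close>, which fills in its value at \<open>x\<close>.\<close>
  define g where "g z = c * (1 + of_real (t z) * \<zeta> z)" for z
  have t01: "0 \<le> t z" "t z \<le> 1" for z using rho by (auto simp: t_def)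
  have gx: "g x = c" by (simp add: g_def t_def)
  have tx: "t x = 0" by (simp add: t_def)
  have cont_t: "continuous_on A t" for A unfolding t_def using rho by (intro continuous_intros) auto
  have gout: "g z = f z / (z - x)" if "dist z x \<ge> \<rho>" for z
  proof -
    have "t z = 1" using that rho by (auto simp: t_def dist_norm min_def field_simps)
    moreover have "z \<noteq> x" using that rho by auto
    ultimately show ?thesis using c by (simp add: g_def \<zeta>_def field_simps)
  qed
  have gne: "g z \<noteq> 0" if "z \<noteq> x" "dist z x \<le> \<rho>" for z
  proof
    assume "g z = 0"
    then have "of_real (t z) * \<zeta> z = -1" using c(1) by (simp add: g_def eq_neg_iff_add_eq_0 add.commute)
    then have "t z * norm (\<zeta> z) = 1" using t01[of z] by (metis abs_of_nonneg norm_minus_cancel norm_mult norm_of_real norm_one)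
    moreover have "t z * norm (\<zeta> z) \<le> 1 * \<delta>" using t01[of z] zeta[OF that] by (intro mult_mono) auto
    ultimately show False using c(2) by simp
  qed
  have "continuous (at z within cball p r) g" if z: "z \<in> cball p r" for z
  proof (cases "z = x")
    case True
    have "((\<lambda>y. of_real (t y) * \<zeta> y) \<longlongrightarrow> 0) (at x within cball p r)"
    proof (rule Lim_null_comparison)
      show "\<forall>\<^sub>F y in at x within cball p r. norm (of_real (t y) * \<zeta> y) \<le> t y * \<delta>"
        unfolding eventually_at
        by (rule exI[of _ \<rho>]) (use rho zeta t01 in \<open>auto simp: norm_mult intro!: mult_left_mono\<close>)
      have "((\<lambda>y. t y) \<longlongrightarrow> t x) (at x within cball p r)"
        using cont_t[of "cball p r"] x by (auto simp: continuous_on_def)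
      then show "((\<lambda>y. t y * \<delta>) \<longlongrightarrow> 0) (at x within cball p r)"
        using tx by (auto intro: tendsto_eq_intros)
    qed
    then have "(g \<longlongrightarrow> c * (1 + 0)) (at x within cball p r)"
      unfolding g_def by (intro tendsto_intros)
    then show ?thesis using True gx by (simp add: continuous_within)
  next
    case False
    have "continuous (at z within cball p r) f" using f z continuous_on_eq_continuous_within by blast
    moreover have "continuous (at z within cball p r) t" using cont_t z continuous_on_eq_continuous_within by blast
    ultimately show ?thesis
      unfolding g_def \<zeta>_def using False c by (intro continuous_intros) auto
  qed
  then have "continuous_on (cball p r) g" using continuous_on_eq_continuous_within by blast
  then show thesis
  proof (rule that)
    show "g x \<noteq> 0" using gx c by simp
    show "g z \<noteq> 0" if "z \<in> N" "z \<in> cball p r" "z \<noteq> x" "f z \<noteq> 0" for z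
    proof (cases "dist z x \<le> \<rho>")
      case True then show ?thesis using gne that by blast
    next
      case False then show ?thesis using gout[of z] that by simp
    qed
    show "g z = f z / (z - x)" if "z \<notin> N" for z
    proof -
      have "\<not> dist z x < e1" using that e1(2) by (auto simp: dist_commute)
      then show ?thesis using gout[of z] rho by simp
    qed
  qed
qed

text \<open>
  Once all zeros are divided out, what remains is a nonvanishing function on a disc and has a continuous
  logarithm. This is the argument principle for continuous functions with finitely many zeros of index one.
\<close>
lemma log_of_quotient_by_zeros:
  fixes f :: "complex \<Rightarrow> complex"
  assumes "finite X" "X \<subseteq> ball p r" "continuous_on (cball p r) f"
    "\<And>z. z \<in> cball p r \<Longrightarrow> f z = 0 \<longleftrightarrow> z \<in> X" "\<And>x. x \<in> X \<Longrightarrow> positive_zero f x"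
  shows "\<exists>h. continuous_on (cball p r) h \<and> (\<forall>z\<in>sphere p r. f z = (\<Prod>x\<in>X. z - x) * exp (h z))"
  using assms
proof (induction X arbitrary: f rule: finite_induct)
  case empty
  then have "continuous_on (cball p r) f" "\<And>z. z \<in> cball p r \<Longrightarrow> f z \<noteq> 0" by auto
  then obtain h where "continuous_on (cball p r) h" "\<And>z. z \<in> cball p r \<Longrightarrow> f z = exp (h z)"
    using continuous_logarithm_on_cball by blast
  then show ?case by (intro exI[of _ h]) (auto simp: sphere_cball[THEN subsetD])
next
  case (insert x X)
  have "closed X" using insert by (simp add: finite_imp_closed)
  then have "open (ball p r - X)" "x \<in> ball p r - X" using insert by auto
  then obtain e where e: "e > 0" "cball x e \<subseteq> ball p r - X" using open_contains_cball by blast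
  define N where "N = ball x e"
  have N: "open N" "x \<in> N" "N \<subseteq> ball p r - X" using e subset_trans[OF ball_subset_cball e(2)] by (simp_all add: N_def)
  obtain g where g: "continuous_on (cball p r) g" "g x \<noteq> 0"
    "\<And>z. z \<in> N \<Longrightarrow> z \<in> cball p r \<Longrightarrow> z \<noteq> x \<Longrightarrow> f z \<noteq> 0 \<Longrightarrow> g z \<noteq> 0"
    "\<And>z. z \<notin> N \<Longrightarrow> g z = f z / (z - x)"
    proof (rule positive_zero_divide_out[of p r f x N])
    show "f x = 0" using insert.prems(1,3) ball_subset_cball by blast
  qed (use insert.prems N in auto)
  have "\<exists>h. continuous_on (cball p r) h \<and> (\<forall>z\<in>sphere p r. g z = (\<Prod>x\<in>X. z - x) * exp (h z))"
  proof (rule insert.IH)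
    show "g z = 0 \<longleftrightarrow> z \<in> X" if "z \<in> cball p r" for z
    proof (cases "z \<in> N")
      case True
      then show ?thesis using g(2) g(3)[of z] insert.prems(3)[OF that] that N(3) by (cases "z = x") auto
    next
      case False
      then show ?thesis using g(4)[of z] insert.prems(3)[OF that] N by auto
    qed
    show "positive_zero g y" if y: "y \<in> X" for y
    proof -
      have yx: "y \<noteq> x" using y insert by blast
      have "positive_zero (\<lambda>z. f z * inverse (z - x)) y"
        by (rule positive_zero_mult) (use insert.prems y yx in \<open>auto intro!: continuous_intros\<close>)
      moreover have "\<forall>\<^sub>F z in at y. f z * inverse (z - x) = g z"
      proof -
        have "open (- cball x e)" "y \<in> - cball x e" using e y by auto
        then have "\<forall>\<^sub>F z in at y. z \<in> - cball x e" by (rule eventually_at_in_open')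
        then show ?thesis
          by eventually_elim (use g(4) in \<open>auto simp: N_def divide_inverse\<close>)
      qed
      ultimately show ?thesis by (rule positive_zero_cong)
    qed
  qed (use insert g in auto)
  then obtain h where h: "continuous_on (cball p r) h" "\<And>z. z\<in>sphere p r \<Longrightarrow> g z = (\<Prod>x\<in>X. z - x) * exp (h z)" by blast
  have "f z = (\<Prod>x\<in>insert x X. z - x) * exp (h z)" if z: "z \<in> sphere p r" for z
  proof -
    have "z \<notin> N" "z \<noteq> x" using z N by auto
    then have "f z = (z - x) * g z" using g(4)[of z] by simp
    then show ?thesis using h(2)[OF z] insert by simp
  qed
  then show ?case using h by blast
qed

lemma positive_zero_isolated:
  assumes "positive_zero f x"
  shows "\<forall>\<^sub>F z in at x. f z \<noteq> 0"
proof -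
  obtain c \<delta> where c: "\<delta> < 1" "\<forall>\<^sub>F z in at x. norm (f z / (c * (z - x)) - 1) \<le> \<delta>"
    using assms unfolding positive_zero_def by blast
  from c(2) show ?thesis
    by eventually_elim (use c(1) in auto)
qed

text \<open>
  A real-linear map of the complex plane has the form \<open>\<alpha> w + \<beta> (cnj w)\<close>, with determinant
  \<open>|\<alpha>|\<^sup>2 - |\<beta>|\<^sup>2\<close>. If this is positive, the relative distance from \<open>w \<mapsto> \<alpha> w\<close> is \<open>|\<beta>| / |\<alpha>| < 1\<close>.
\<close>
lemma positive_zero_of_derivative:
  assumes f: "(f has_derivative (\<lambda>w. \<alpha> * w + \<beta> * cnj w)) (at x)" "f x = 0"
    and ab: "norm \<beta> < norm \<alpha>"
  shows "positive_zero f x"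
proof -
  have a0: "norm \<alpha> > 0" using ab norm_ge_zero le_less_trans by blast
  define e where "e = (norm \<alpha> - norm \<beta>) / 2"
  have e: "e > 0" using ab by (simp add: e_def)
  have "((\<lambda>z. norm (f z - f x - (\<alpha> * (z - x) + \<beta> * cnj (z - x))) / norm (z - x)) \<longlongrightarrow> 0) (at x)"
    using f(1) unfolding has_derivative_iff_norm by blast
  then have "\<forall>\<^sub>F z in at x. norm (f z - f x - (\<alpha> * (z - x) + \<beta> * cnj (z - x))) / norm (z - x) < e"
    using e order_tendstoD(2) by blast
  moreover have "\<forall>\<^sub>F z in at x. z \<noteq> x" by (simp add: eventually_at_filter)
  ultimately have "\<forall>\<^sub>F z in at x. norm (f z / (\<alpha> * (z - x)) - 1) \<le> (norm \<beta> + e) / norm \<alpha>"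
  proof eventually_elim
    case (elim z)
    let ?w = "z - x"
    have w: "norm ?w > 0" using elim by simp
    have 1: "norm (f z - (\<alpha> * ?w + \<beta> * cnj ?w)) \<le> e * norm ?w"
      using elim(1) f(2) w by (simp add: divide_simps)
    have "norm (f z - \<alpha> * ?w) \<le> norm (f z - (\<alpha> * ?w + \<beta> * cnj ?w)) + norm (\<beta> * cnj ?w)"
      using norm_triangle_ineq[of "f z - (\<alpha> * ?w + \<beta> * cnj ?w)" "\<beta> * cnj ?w"]
      by (simp only: diff_diff_eq[symmetric] diff_add_cancel)
    also have "\<dots> \<le> (norm \<beta> + e) * norm ?w"
      using 1 by (simp only: norm_mult complex_mod_cnj distrib_right)
    finally have 2: "norm (f z - \<alpha> * ?w) \<le> (norm \<beta> + e) * norm ?w" .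
    have "f z / (\<alpha> * ?w) - 1 = (f z - \<alpha> * ?w) / (\<alpha> * ?w)"
      using a0 w by (simp add: diff_divide_distrib)
    then have "norm (f z / (\<alpha> * ?w) - 1) = norm (f z - \<alpha> * ?w) / (norm \<alpha> * norm ?w)"
      by (simp add: norm_divide norm_mult)
    also have "\<dots> \<le> ((norm \<beta> + e) * norm ?w) / (norm \<alpha> * norm ?w)"
      using 2 a0 w by (intro divide_right_mono) auto
    also have "\<dots> = (norm \<beta> + e) / norm \<alpha>" using w by simp
    finally show ?case .
  qed
  moreover have "(norm \<beta> + e) / norm \<alpha> < 1" using a0 ab by (simp add: e_def field_simps)
  ultimately show ?thesis
    unfolding positive_zero_def using a0 by (intro exI[of _ \<alpha>] exI[of _ "(norm \<beta> + e) / norm \<alpha>"]) auto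
qed

lemma power_on_circle_no_log:
  fixes g :: "complex \<Rightarrow> complex"
  assumes r: "r > 0" and g: "continuous_on (sphere p r) g"
    and eq: "\<And>z. z \<in> sphere p r \<Longrightarrow> (z - p) ^ n = exp (g z)"
  shows "n = 0"
proof -
  define c where "c t = p + of_real r * cis t" for t
  have c: "c t \<in> sphere p r" for t using r by (simp add: c_def dist_norm norm_mult)
  define F where "F t = g (c t) - of_real (real n * t) * \<i>" for t
  have exps: "exp (F t) = of_real r ^ n" for t
  proof -
    have "exp (g (c t)) = of_real r ^ n * cis (real n * t)"
    proof -
      have "exp (g (c t)) = (of_real r * cis t) ^ n"
        using eq[OF c, of t] by (simp add: c_def)
      then show ?thesis by (simp only: power_mult_distrib Complex.DeMoivre)
    qed
    moreover have "exp (of_real (real n * t) * \<i>) = cis (real n * t)"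
      by (simp add: cis_conv_exp mult.commute)
    ultimately show ?thesis by (simp add: F_def exp_diff)
  qed
  have "continuous_on UNIV c" unfolding c_def cis_conv_exp by (intro continuous_intros)
  then have "continuous_on UNIV F"
    unfolding F_def by (intro continuous_intros continuous_on_compose2[OF g]) (use c in auto)
  then have "F constant_on (UNIV :: real set)"
  proof (rule continuous_discrete_range_constant[OF connected_UNIV])
    fix t :: real
    have "2 * pi \<le> norm (F s - F t)" if "F s \<noteq> F t" for s
    proof -
      have "exp (F s) = exp (F t)" using exps by simp
      then obtain k :: int where k: "F s = F t + (of_int (2 * k) * pi) * \<i>" using exp_eq by blast
      then have "k \<noteq> 0" using that by auto
      then have "1 \<le> \<bar>real_of_int k\<bar>" by linarith
      then have "2 * pi * 1 \<le> 2 * pi * \<bar>real_of_int k\<bar>" by (intro mult_left_mono) auto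
      then show ?thesis using k by (simp add: norm_mult abs_mult)
    qed
    then show "\<exists>e>0. \<forall>y. y \<in> UNIV \<and> F y \<noteq> F t \<longrightarrow> e \<le> norm (F y - F t)"
      by (intro exI[of _ "2 * pi"]) auto
  qed
  then have "F (2 * pi) = F 0" unfolding constant_on_def by auto
  moreover have "c (2 * pi) = c 0" by (simp add: c_def)
  ultimately show ?thesis by (simp add: F_def)
qed

text \<open>
  On a small circle around \<open>p\<close>, the function \<open>f - y\<close> winds around \<open>0\<close> exactly once, for all \<open>y\<close> close to \<open>f p\<close>,
  because it is close to the derivative at \<open>p\<close>. As every solution of \<open>f z = y\<close> has index one,
  there is at most one solution in the disc.
\<close>
lemma locally_injective_of_positive_derivative:
  fixes f :: "complex \<Rightarrow> complex"
  assumes der: "\<And>x. \<exists>\<alpha> \<beta>. norm \<beta> < norm \<alpha> \<and> (f has_derivative (\<lambda>w. \<alpha> * w + \<beta> * cnj w)) (at x)"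
  shows "\<exists>s>0. inj_on f (ball p s)"
proof -
  have cont: "continuous_on A f" for A
    using der by (meson continuous_at_imp_continuous_on has_derivative_continuous)
  obtain \<alpha> \<beta> where ab: "norm \<beta> < norm \<alpha>" and D: "(f has_derivative (\<lambda>w. \<alpha> * w + \<beta> * cnj w)) (at p)"
    using der by blast
  have a0: "norm \<alpha> > 0" using ab norm_ge_zero le_less_trans by blast
  define m where "m = (norm \<alpha> - norm \<beta>) / 2"
  have m: "m > 0" "norm \<beta> + m + m = norm \<alpha>" using ab by (auto simp: m_def)
  obtain d where d: "d > 0"
    "\<And>z. norm (z - p) < d \<Longrightarrow> norm (f z - f p - (\<alpha> * (z - p) + \<beta> * cnj (z - p))) \<le> m * norm (z - p)"
    using D m(1) unfolding has_derivative_at_alt by blast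
  define R where "R = d / 2"
  have R: "R > 0" "R < d" using d(1) by (auto simp: R_def)
  have "isCont f p" using D has_derivative_continuous by blast
  then obtain s0 where s0: "s0 > 0" "\<And>x. dist x p < s0 \<Longrightarrow> dist (f x) (f p) < m * R"
    using m R unfolding continuous_at_eps_delta by (metis mult_pos_pos)
  define s where "s = min s0 R"
  have s: "s > 0" "s \<le> s0" "s \<le> R" using s0 R by (auto simp: s_def)
  have unique: "x1 = x2" if x: "x1 \<in> ball p s" "x2 \<in> ball p s" "f x1 = f x2" for x1 x2
  proof -
    define y where "y = f x1"
    have yp: "norm (y - f p) < m * R" using s0(2)[of x1] x(1) s by (auto simp: y_def dist_norm norm_minus_commute)
    define q where "q z = (f z - y) / (\<alpha> * (z - p))" for z
    have q: "norm (q z - 1) < 1" if z: "z \<in> sphere p R" for z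
    proof -
      let ?w = "z - p"
      have w: "norm ?w = R" using z by (simp add: dist_norm norm_minus_commute)
      let ?e = "f z - f p - (\<alpha> * ?w + \<beta> * cnj ?w)"
      have "norm ?e \<le> m * R" using d(2)[of z] w R by simp
      moreover have eq: "f z - y - \<alpha> * ?w = ?e - (y - f p) + \<beta> * cnj ?w" by simp
      moreover have "norm (?e - (y - f p) + \<beta> * cnj ?w) \<le> norm ?e + norm (y - f p) + norm (\<beta> * cnj ?w)"
        by (rule norm_triangle_le[OF add_right_mono[OF norm_triangle_ineq4]])
      moreover have "norm (\<beta> * cnj ?w) = norm \<beta> * R" using w by (simp only: norm_mult complex_mod_cnj)
      ultimately have "norm (f z - y - \<alpha> * ?w) < m * R + m * R + norm \<beta> * R" unfolding eq using yp by linarith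
      also have "\<dots> = norm \<alpha> * R" by (simp add: m(2)[symmetric] algebra_simps)
      finally have "norm (f z - y - \<alpha> * ?w) < norm \<alpha> * R" .
      moreover have "q z - 1 = (f z - y - \<alpha> * ?w) / (\<alpha> * ?w)"
        using a0 w R by (auto simp: q_def diff_divide_distrib)
      ultimately show ?thesis using a0 w R by (simp add: norm_divide norm_mult)
    qed
    have halfplane: "u \<notin> \<real>\<^sub>\<le>\<^sub>0 \<and> u \<noteq> 0" if "norm (u - 1) < 1" for u :: complex
    proof -
      have "Re u > 0" using that abs_Re_le_cmod[of "u - 1"] by (simp add: abs_less_iff)
      then show ?thesis by (auto simp: complex_nonpos_Reals_iff)
    qed
    define X where "X = {z \<in> cball p R. f z = y}"
    have pz: "positive_zero (\<lambda>z. f z - y) x" if "x \<in> X" for x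
    proof -
      obtain a b where "norm b < norm a" "(f has_derivative (\<lambda>w. a * w + b * cnj w)) (at x)"
        using der by blast
      then show ?thesis
        using that by (intro positive_zero_of_derivative[of _ a b]) (auto simp: X_def intro!: derivative_eq_intros)
    qed
    have X_sub: "X \<subseteq> cball p R" by (auto simp: X_def)
    have "finite X"
    proof (rule ccontr)
      assume "infinite X"
      then obtain x where x: "x \<in> cball p R" "x islimpt X"
        using Heine_Borel_imp_Bolzano_Weierstrass[OF compact_cball, of X p R] X_sub by blast
      have "closed X"
        unfolding X_def by (intro continuous_closed_preimage_constant cont closed_cball)
      then have "x \<in> X" using x(2) closed_limpt by blast
      then have "\<forall>\<^sub>F z in at x. f z - y \<noteq> 0" using pz positive_zero_isolated by blast
      then have "\<forall>\<^sub>F z in at x. z \<notin> X" by eventually_elim (auto simp: X_def)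
      then show False using x(2) by (simp add: islimpt_iff_eventually)
    qed
    have Xball: "X \<subseteq> ball p R"
    proof
      fix z assume z: "z \<in> X"
      have "z \<notin> sphere p R"
      proof
        assume "z \<in> sphere p R"
        from q[OF this] show False using z by (simp add: q_def X_def)
      qed
      then show "z \<in> ball p R" using z by (auto simp: X_def)
    qed
    have "\<exists>h. continuous_on (cball p R) h \<and> (\<forall>z\<in>sphere p R. f z - y = (\<Prod>x\<in>X. z - x) * exp (h z))"
      by (rule log_of_quotient_by_zeros[OF \<open>finite X\<close> Xball])
         (auto intro!: continuous_intros cont pz simp: X_def)
    then obtain h where h: "continuous_on (cball p R) h"
        "\<And>z. z \<in> sphere p R \<Longrightarrow> f z - y = (\<Prod>x\<in>X. z - x) * exp (h z)" by blast
    \<comment> \<open>On the circle \<open>z - x\<close> is \<open>z - p\<close> up to the factor \<open>u x z\<close>, which has a logarithm.\<close>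
    define u where "u x z = 1 - (x - p) / (z - p)" for x z
    have u: "norm (u x z - 1) < 1" if "x \<in> X" "z \<in> sphere p R" for x z
      using that Xball R by (auto simp: u_def norm_divide dist_norm norm_minus_commute)
    have sne: "z - p \<noteq> 0" if "z \<in> sphere p R" for z using that R by auto
    define G where "G z = Ln \<alpha> + Ln (q z) - h z - (\<Sum>x\<in>X. Ln (u x z))" for z
    have "continuous_on (sphere p R) G"
      unfolding G_def
    proof (intro continuous_intros)
      show "continuous_on (sphere p R) q"
        unfolding q_def using sne a0 by (intro continuous_intros cont) auto
      show "continuous_on (sphere p R) (u x)" if "x \<in> X" for x
        unfolding u_def using sne by (intro continuous_intros) auto
      show "continuous_on (sphere p R) h" by (rule continuous_on_subset[OF h(1)]) auto
    qed (use halfplane[OF q] halfplane[OF u] in blast)+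
    moreover have "(z - p) ^ (card X - 1) = exp (G z)" if z: "z \<in> sphere p R" for z
    proof -
      have "exp (\<Sum>x\<in>X. Ln (u x z)) = (\<Prod>x\<in>X. u x z)"
        using halfplane[OF u[OF _ z]] by (simp add: exp_sum \<open>finite X\<close>)
      also have "\<dots> = (\<Prod>x\<in>X. (z - x) / (z - p))"
        using sne[OF z] by (intro prod.cong) (auto simp: u_def field_simps)
      also have "\<dots> = (\<Prod>x\<in>X. z - x) / (z - p) ^ card X"
        by (simp add: prod_dividef)
      finally have 1: "exp (\<Sum>x\<in>X. Ln (u x z)) = (\<Prod>x\<in>X. z - x) / (z - p) ^ card X" .
      have ne: "(\<Prod>x\<in>X. z - x) \<noteq> 0" using \<open>finite X\<close> z Xball by auto
      have "exp (G z) = \<alpha> * q z / exp (h z) / ((\<Prod>x\<in>X. z - x) / (z - p) ^ card X)"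
        using a0 halfplane[OF q[OF z]] by (simp add: G_def exp_diff exp_add 1)
      also have "\<alpha> * q z = (f z - y) / (z - p)" using a0 by (simp add: q_def)
      also have "f z - y = (\<Prod>x\<in>X. z - x) * exp (h z)" by (rule h(2)[OF z])
      also have "(\<Prod>x\<in>X. z - x) * exp (h z) / (z - p) / exp (h z) / ((\<Prod>x\<in>X. z - x) / (z - p) ^ card X)
          = (z - p) ^ card X / (z - p)"
      proof -
        have "A * H / w / H / (A / B) = B / w" if "A \<noteq> 0" "H \<noteq> 0" for A H w B :: complex
          using that by (cases "w = 0"; cases "B = 0") (simp_all add: field_simps)
        then show ?thesis using ne exp_not_eq_zero by blast
      qed
      also have "\<dots> = (z - p) ^ (card X - 1)"
      proof -
        have "x1 \<in> X" using x s by (auto simp: X_def y_def)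
        then have "card X > 0" using \<open>finite X\<close> card_gt_0_iff by blast
        then show ?thesis using sne[OF z] by (cases "card X") auto
      qed
      finally show ?thesis by simp
    qed
    ultimately have "card X - 1 = 0" using power_on_circle_no_log[OF R(1)] by blast
    then have "card X \<le> 1" by simp
    moreover have "x1 \<in> X" "x2 \<in> X" using x s by (auto simp: X_def y_def)
    ultimately show ?thesis using \<open>finite X\<close> by (metis One_nat_def card_le_Suc0_iff_eq)
  qed
  then show ?thesis using s(1) unfolding inj_on_def by blast
qed

section \<open>Lifting straight segments\<close>

definition segment_lift :: "('a::real_normed_vector \<Rightarrow> 'a) \<Rightarrow> 'a \<Rightarrow> 'a \<Rightarrow> (real \<Rightarrow> 'a) \<Rightarrow> bool" where
  "segment_lift F p z l \<longleftrightarrow> continuous_on {0..1} l \<and> l 0 = p \<and>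
     (\<forall>t\<in>{0..1}. F (l t) = F p + t *\<^sub>R (z - F p))"

definition reach :: "('a::real_normed_vector \<Rightarrow> 'a) \<Rightarrow> 'a \<Rightarrow> 'a set" where
  "reach F p = {z. \<exists>l. segment_lift F p z l}"

text \<open>
  For \<open>z \<in> reach F p\<close> this is the end point of the lift of the segment from \<open>F p\<close> to \<open>z\<close> that starts at \<open>p\<close>; the
  choice is immaterial when \<open>F\<close> is locally injective. Outside \<open>reach F p\<close> the value is arbitrary.
\<close>
definition branch :: "('a::real_normed_vector \<Rightarrow> 'a) \<Rightarrow> 'a \<Rightarrow> 'a \<Rightarrow> 'a" where
  "branch F p z = (SOME l. segment_lift F p z l) 1"

locale locally_injective =
  fixes F :: "'a::euclidean_space \<Rightarrow> 'a"
  assumes cont: "continuous_on UNIV F"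
    and locally_inj: "\<And>p. \<exists>s>0. inj_on F (ball p s)"
begin

lemma isCont_F: "isCont F x"
  using cont continuous_on_eq_continuous_at open_UNIV by blast

lemma lifts_agree:
  fixes W :: "'b::metric_space set"
  assumes W: "connected W" and g: "continuous_on W g" and h: "continuous_on W h"
    and eq: "\<And>z. z \<in> W \<Longrightarrow> F (g z) = F (h z)" and z0: "z0 \<in> W" "g z0 = h z0" and z: "z \<in> W"
  shows "g z = h z"
proof -
  let ?T = "{z \<in> W. g z = h z}"
  have "closedin (top_of_set W) ?T"
    using continuous_closedin_preimage_constant[of W "\<lambda>z. g z - h z" 0] g h by (auto intro: continuous_intros)
  moreover have "openin (top_of_set W) ?T"
    unfolding openin_euclidean_subtopology_iff
  proof (intro conjI ballI)
    fix x assume x: "x \<in> ?T"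
    obtain s where s: "s > 0" "inj_on F (ball (g x) s)" using locally_inj by blast
    obtain d1 where d1: "d1 > 0" "\<And>y. y \<in> W \<Longrightarrow> dist y x < d1 \<Longrightarrow> dist (g y) (g x) < s"
      using g s(1) x unfolding continuous_on_iff by blast
    obtain d2 where d2: "d2 > 0" "\<And>y. y \<in> W \<Longrightarrow> dist y x < d2 \<Longrightarrow> dist (h y) (h x) < s"
      using h s(1) x unfolding continuous_on_iff by blast
    have "y \<in> ?T" if y: "y \<in> W" "dist y x < min d1 d2" for y
    proof -
      have "g y \<in> ball (g x) s" "h y \<in> ball (g x) s"
        using d1(2)[of y] d2(2)[of y] y x by (auto simp: dist_commute)
      then show ?thesis using s(2) eq[OF y(1)] y(1) by (simp add: inj_on_eq_iff)
    qed
    then show "\<exists>e>0. \<forall>x'\<in>W. dist x' x < e \<longrightarrow> x' \<in> ?T"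
      using d1(1) d2(1) by (intro exI[of _ "min d1 d2"]) auto
  qed auto
  ultimately have "?T = {} \<or> ?T = W" using W unfolding connected_clopen by blast
  then show ?thesis using z0 z by blast
qed

text \<open>
  Otherwise pairs of distinct points with equal images would accumulate at pairs of points of \<open>K\<close> with equal
  images, that is, at a single point of \<open>K\<close>, where local injectivity fails.
\<close>
lemma inj_near_compact:
  assumes K: "compact K" and inj: "inj_on F K"
  obtains N where "open N" "K \<subseteq> N" "inj_on F N"
proof (rule ccontr)
  assume no: "\<not> thesis"
  define N where "N n = (\<Union>x\<in>K. ball x (inverse (real (Suc n))))" for n
  have "\<exists>x y. x \<in> N n \<and> y \<in> N n \<and> x \<noteq> y \<and> F x = F y" for n
  proof -
    have "open (N n)" "K \<subseteq> N n" by (auto simp: N_def)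
    then have "\<not> inj_on F (N n)" using no that by blast
    then show ?thesis unfolding inj_on_def by blast
  qed
  then obtain x y where xy: "\<And>n. x n \<in> N n" "\<And>n. y n \<in> N n" "\<And>n. x n \<noteq> y n" "\<And>n. F (x n) = F (y n)"
    by metis
  have "\<exists>a. a \<in> K \<and> dist a (x n) < inverse (real (Suc n))" for n using xy(1)[of n] by (auto simp: N_def)
  then obtain a where a: "\<And>n. a n \<in> K" "\<And>n. dist (a n) (x n) < inverse (real (Suc n))" by metis
  have "\<exists>a. a \<in> K \<and> dist a (y n) < inverse (real (Suc n))" for n using xy(2)[of n] by (auto simp: N_def)
  then obtain b where b: "\<And>n. b n \<in> K" "\<And>n. dist (b n) (y n) < inverse (real (Suc n))" by metis
  have ab: "\<forall>n. (a n, b n) \<in> K \<times> K" using a(1) b(1) by simp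
  have "compact (K \<times> K)" by (rule compact_Times[OF K K])
  then obtain c r where c: "c \<in> K \<times> K" and r: "strict_mono r" and lim: "((\<lambda>n. (a n, b n)) \<circ> r) \<longlonglongrightarrow> c"
    using seq_compactE[OF compact_imp_seq_compact[OF \<open>compact (K \<times> K)\<close>], of "\<lambda>n. (a n, b n)"] ab by blast
  obtain u v where uv: "c = (u, v)" "u \<in> K" "v \<in> K" using c by auto
  have la: "(\<lambda>n. a (r n)) \<longlonglongrightarrow> u" using tendsto_fst[OF lim] uv by (simp add: comp_def)
  have lb: "(\<lambda>n. b (r n)) \<longlonglongrightarrow> v" using tendsto_snd[OF lim] uv by (simp add: comp_def)
  have inv0: "(\<lambda>n. inverse (real (Suc (r n)))) \<longlonglongrightarrow> 0"
    using LIMSEQ_subseq_LIMSEQ[OF LIMSEQ_inverse_real_of_nat r] by (simp add: comp_def)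
  have "(\<lambda>n. x (r n) - a (r n)) \<longlonglongrightarrow> 0"
  proof (rule Lim_null_comparison[OF always_eventually inv0], rule allI)
    show "norm (x (r n) - a (r n)) \<le> inverse (real (Suc (r n)))" for n
      using less_imp_le[OF a(2)[of "r n"]] by (simp only: dist_norm norm_minus_commute)
  qed
  from tendsto_add[OF this la] have lx: "(\<lambda>n. x (r n)) \<longlonglongrightarrow> u" by simp
  have "(\<lambda>n. y (r n) - b (r n)) \<longlonglongrightarrow> 0"
  proof (rule Lim_null_comparison[OF always_eventually inv0], rule allI)
    show "norm (y (r n) - b (r n)) \<le> inverse (real (Suc (r n)))" for n
      using less_imp_le[OF b(2)[of "r n"]] by (simp only: dist_norm norm_minus_commute)
  qed
  from tendsto_add[OF this lb] have ly: "(\<lambda>n. y (r n)) \<longlonglongrightarrow> v" by simp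
  have "(\<lambda>n. F (x (r n))) \<longlonglongrightarrow> F u" using isCont_tendsto_compose[OF isCont_F lx] .
  moreover have "(\<lambda>n. F (x (r n))) \<longlonglongrightarrow> F v" using isCont_tendsto_compose[OF isCont_F ly] xy(4) by simp
  ultimately have "F u = F v" by (rule LIMSEQ_unique)
  then have "u = v" using inj uv by (simp add: inj_on_eq_iff)
  obtain s where s: "s > 0" "inj_on F (ball u s)" using locally_inj by blast
  have "\<forall>\<^sub>F n in sequentially. dist (x (r n)) u < s" "\<forall>\<^sub>F n in sequentially. dist (y (r n)) u < s"
    using lx ly s(1) \<open>u = v\<close> by (auto dest: tendstoD)
  then have "\<forall>\<^sub>F n in sequentially. False"
  proof eventually_elim
    case (elim n)
    then have "x (r n) = y (r n)"
      by (intro inj_onD[OF s(2) xy(4)[of "r n"]]) (auto simp: dist_commute)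
    then show False using xy(3) by blast
  qed
  then show False by simp
qed

lemma local_section:
  assumes "open N" "inj_on F N"
  shows "open (F ` N)" "continuous_on (F ` N) (inv_into N F)"
    "\<And>z. z \<in> F ` N \<Longrightarrow> F (inv_into N F z) = z" "\<And>x. x \<in> N \<Longrightarrow> inv_into N F (F x) = x"
  using assms invariance_of_domain[of N F] continuous_on_inverse_open[of N F] continuous_on_subset[OF cont]
  by (auto simp: f_inv_into_f)

lemma segment_lift_scale:
  assumes l: "segment_lift F p z l" and t: "t \<in> {0..1}"
  shows "segment_lift F p (F p + t *\<^sub>R (z - F p)) (\<lambda>s. l (s * t))"
proof -
  have st: "s * t \<in> {0..1}" if "s \<in> {0..1}" for s using that t by (auto simp: mult_le_one)
  have "continuous_on {0..1} (\<lambda>s. l (s * t))"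
    by (rule continuous_on_compose2[of "{0..1}" l]) (use l st in \<open>auto simp: segment_lift_def intro!: continuous_intros\<close>)
  then show ?thesis using l st by (auto simp: segment_lift_def)
qed

lemma branch_eq:
  assumes l: "segment_lift F p z l" shows "branch F p z = l 1"
proof -
  let ?m = "SOME l. segment_lift F p z l"
  have m: "segment_lift F p z ?m" using someI[of "segment_lift F p z", OF l] by simp
  have "?m 1 = l 1"
    by (rule lifts_agree[of "{0..1}" _ _ 0]) (use l m in \<open>auto simp: segment_lift_def\<close>)
  then show ?thesis by (simp add: branch_def)
qed

lemma branch_along:
  assumes l: "segment_lift F p z l" and t: "t \<in> {0..1}"
  shows "F p + t *\<^sub>R (z - F p) \<in> reach F p" "branch F p (F p + t *\<^sub>R (z - F p)) = l t"
  using segment_lift_scale[OF assms] branch_eq[OF segment_lift_scale[OF assms]] by (auto simp: reach_def)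

lemma reach_star:
  assumes "z \<in> reach F p" "t \<in> {0..1}" shows "F p + t *\<^sub>R (z - F p) \<in> reach F p"
  using assms branch_along(1) unfolding reach_def by blast

lemma F_branch: assumes "z \<in> reach F p" shows "F (branch F p z) = z"
proof -
  obtain l where l: "segment_lift F p z l" using assms unfolding reach_def by blast
  then have "F (l 1) = F p + 1 *\<^sub>R (z - F p)" unfolding segment_lift_def by auto
  then show ?thesis using branch_eq[OF l] by simp
qed

text \<open>
  Any continuous section on a star-shaped set restricts to lifts of segments, so it agrees with the branch.
\<close>
lemma reach_of_section:
  assumes star: "\<And>z t. z \<in> W \<Longrightarrow> t \<in> {0..1} \<Longrightarrow> F p + t *\<^sub>R (z - F p) \<in> W"
    and g: "continuous_on W g" "g (F p) = p" "\<And>z. z \<in> W \<Longrightarrow> F (g z) = z" and z: "z \<in> W"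
  shows "z \<in> reach F p" "branch F p z = g z"
proof -
  have "segment_lift F p z (\<lambda>t. g (F p + t *\<^sub>R (z - F p)))"
    unfolding segment_lift_def using star[OF z] g
    by (auto intro!: continuous_on_compose2[OF g(1)] continuous_intros)
  then show "z \<in> reach F p" "branch F p z = g z"
    using branch_eq by (auto simp: reach_def)
qed

lemma start_in_reach: "F p \<in> reach F p" "branch F p (F p) = p"
  using reach_of_section[of "{F p}" p "\<lambda>_. p" "F p"] by auto

text \<open>
  If the segment is not degenerate then \<open>F\<close> is injective on its lift, hence on a neighbourhood of the lift, and
  the inverse there lifts all nearby segments.
\<close>
lemma reach_neighborhood:
  assumes z0: "z0 \<in> reach F p"
  obtains \<delta> where "\<delta> > 0" "ball z0 \<delta> \<subseteq> reach F p" "continuous_on (ball z0 \<delta>) (branch F p)"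
proof -
  obtain l where l: "segment_lift F p z0 l" using z0 unfolding reach_def by blast
  then have lc: "continuous_on {0..1} l" and l0: "l 0 = p"
    and Fl: "\<And>t. t \<in> {0..1} \<Longrightarrow> F (l t) = F p + t *\<^sub>R (z0 - F p)" by (auto simp: segment_lift_def)
  have "inj_on F (l ` {0..1})"
  proof (cases "z0 = F p")
    case True
    have "l t = p" if "t \<in> {0..1}" for t
      by (rule lifts_agree[of "{0..1}" _ _ 0]) (use lc l0 Fl True that in auto)
    then have "l ` {0..1} \<subseteq> {p}" by blast
    then show ?thesis unfolding inj_on_def by blast
  next
    case False
    then show ?thesis by (auto simp: inj_on_def Fl)
  qed
  then obtain N where N: "open N" "l ` {0..1} \<subseteq> N" "inj_on F N"
    using inj_near_compact compact_continuous_image[OF lc] by blast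
  let ?V = "F ` N" and ?g = "inv_into N F"
  note V = local_section[OF N(1,3)]
  let ?A = "(\<lambda>t. F p + t *\<^sub>R (z0 - F p)) ` {0..1}"
  have "compact ?A" by (intro compact_continuous_image continuous_intros) auto
  moreover have "?A \<subseteq> ?V" 
  proof (rule image_subsetI)
    fix t :: real assume t: "t \<in> {0..1}"
    then have "l t \<in> N" using N(2) by blast
    then show "F p + t *\<^sub>R (z0 - F p) \<in> ?V" using Fl[OF t] by (metis imageI)
  qed
  ultimately obtain \<delta> where d: "\<delta> > 0" "(\<Union>x\<in>?A. ball x \<delta>) \<subseteq> ?V"
    using compact_subset_open_imp_ball_epsilon_subset[OF _ V(1)] by blast
  define W where "W = {F p + t *\<^sub>R (z - F p) | t z. t \<in> {0..1} \<and> z \<in> ball z0 \<delta>}"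
  have WV: "W \<subseteq> ?V"
  proof
    fix w assume "w \<in> W"
    then obtain t z where w: "w = F p + t *\<^sub>R (z - F p)" "t \<in> {0..1}" "z \<in> ball z0 \<delta>" by (auto simp: W_def)
    have "dist (F p + t *\<^sub>R (z0 - F p)) w = t * dist z0 z"
      using w by (simp add: dist_norm flip: scaleR_diff_right)
    also have "\<dots> \<le> 1 * dist z0 z" using w by (intro mult_right_mono) auto
    also have "\<dots> < \<delta>" using w by simp
    finally have "w \<in> ball (F p + t *\<^sub>R (z0 - F p)) \<delta>" by simp
    then show "w \<in> ?V" using d(2) w(2) by blast
  qed
  have bW: "ball z0 \<delta> \<subseteq> W"
  proof
    fix z assume "z \<in> ball z0 \<delta>"
    then show "z \<in> W" unfolding W_def by (intro CollectI exI[of _ 1] exI[of _ z]) auto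
  qed
  have star: "F p + t *\<^sub>R (w - F p) \<in> W" if ww: "w \<in> W" and t: "t \<in> {0..1}" for w t
  proof -
    obtain u z where w: "w = F p + u *\<^sub>R (z - F p)" "u \<in> {0..1}" "z \<in> ball z0 \<delta>" using ww unfolding W_def by blast
    have "t * u \<in> {0..1}" using t w by (auto simp: mult_le_one)
    then show ?thesis unfolding W_def using w by (intro CollectI exI[of _ "t * u"] exI[of _ z]) auto
  qed
  have pN: "p \<in> N" using N(2) l0 by force
  have R: "z \<in> reach F p" "branch F p z = ?g z" if "z \<in> W" for z
    using reach_of_section[OF star continuous_on_subset[OF V(2) WV] V(4)[OF pN] _ that] V(3) WV by blast+
  show thesis
  proof (rule that[OF d(1)])
    show "ball z0 \<delta> \<subseteq> reach F p" using R(1) bW by blast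
    have "continuous_on (ball z0 \<delta>) ?g" using continuous_on_subset[OF V(2)] bW WV by blast
    then show "continuous_on (ball z0 \<delta>) (branch F p)"
      using R(2) bW by (subst continuous_on_cong[OF refl, of _ _ ?g]) auto
  qed
qed

lemma open_reach: "open (reach F p)"
  unfolding open_contains_ball using reach_neighborhood by metis

lemma continuous_branch: "continuous_on (reach F p) (branch F p)"
proof (rule continuous_at_imp_continuous_on, rule ballI)
  fix z assume "z \<in> reach F p"
  then obtain \<delta> where "\<delta> > 0" "continuous_on (ball z \<delta>) (branch F p)" using reach_neighborhood by metis
  then show "isCont (branch F p) z" by (simp add: continuous_on_eq_continuous_at)
qed

text \<open>
  If the lift stayed bounded it would accumulate at some \<open>x\<close> with \<open>F x = z\<close>; the local inverse at \<open>x\<close> then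
  continues the lift up to \<open>z\<close>.
\<close>
lemma branch_unbounded_at_first_exit:
  assumes z: "z \<notin> reach F p" and inside: "\<And>t. t \<in> {0..<1} \<Longrightarrow> F p + t *\<^sub>R (z - F p) \<in> reach F p"
  shows "\<exists>t\<in>{0..<1}. B < norm (branch F p (F p + t *\<^sub>R (z - F p)))"
proof (rule ccontr)
  assume neg: "\<not> ?thesis"
  define \<gamma> where "\<gamma> t = F p + t *\<^sub>R (z - F p)" for t
  define k where "k t = branch F p (\<gamma> t)" for t
  have bd: "norm (k t) \<le> B" if "t \<in> {0..<1}" for t
    using neg that by (auto simp: k_def \<gamma>_def not_less)
  have kc: "continuous_on {0..<1} k"
    unfolding k_def by (rule continuous_on_compose2[OF continuous_branch])
      (use inside in \<open>auto simp: \<gamma>_def intro!: continuous_intros\<close>)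
  have Fk: "F (k t) = \<gamma> t" if "t \<in> {0..<1}" for t
    using F_branch inside[OF that] by (simp add: k_def \<gamma>_def)
  define \<tau> where "\<tau> n = 1 - inverse (real (Suc n))" for n
  have tau: "\<tau> n \<in> {0..<1}" for n by (auto simp: \<tau>_def field_simps)
  have tau1: "\<tau> \<longlonglongrightarrow> 1" unfolding \<tau>_def using tendsto_diff[OF tendsto_const LIMSEQ_inverse_real_of_nat, of 1] by simp
  have "bounded (range (\<lambda>n. k (\<tau> n)))" using bd tau by (auto simp: bounded_iff)
  then obtain x r where r: "strict_mono r" "(\<lambda>n. k (\<tau> (r n))) \<longlonglongrightarrow> x"
    using bounded_imp_convergent_subsequence[of "\<lambda>n. k (\<tau> n)"] unfolding comp_def by blast
  have tr: "(\<lambda>n. \<tau> (r n)) \<longlonglongrightarrow> 1" using LIMSEQ_subseq_LIMSEQ[OF tau1 r(1)] by (simp add: comp_def)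
  have "(\<lambda>n. F (k (\<tau> (r n)))) \<longlonglongrightarrow> F x" by (rule isCont_tendsto_compose[OF isCont_F r(2)])
  moreover have "(\<lambda>n. F (k (\<tau> (r n)))) \<longlonglongrightarrow> F p + 1 *\<^sub>R (z - F p)"
    unfolding Fk[OF tau] \<gamma>_def by (intro tendsto_intros tr)
  ultimately have Fx: "F x = z" using LIMSEQ_unique by fastforce
  obtain s where s: "s > 0" "inj_on F (ball x s)" using locally_inj by blast
  let ?N = "ball x s" and ?g = "inv_into (ball x s) F"
  note V = local_section[OF open_ball s(2)]
  have "z \<in> F ` ?N" using Fx s(1) by force
  then obtain \<delta> where d: "\<delta> > 0" "ball z \<delta> \<subseteq> F ` ?N" using V(1) openE by blast
  have "isCont \<gamma> 1" unfolding \<gamma>_def by (intro continuous_intros)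
  then obtain e where e: "e > 0" "\<And>t. dist t 1 < e \<Longrightarrow> dist (\<gamma> t) (\<gamma> 1) < \<delta>"
    using d(1) unfolding continuous_at_eps_delta by metis
  have gam1: "\<gamma> 1 = z" by (simp add: \<gamma>_def)
  define J where "J = {max 0 (1 - e / 2)..<1}"
  have J: "\<gamma> t \<in> ball z \<delta>" if "t \<in> J \<or> t = 1" for t
    using e(2)[of t] that e(1) d(1) gam1 by (auto simp: J_def dist_real_def dist_commute max_def split: if_splits)
  have Jsub: "J \<subseteq> {0..<1}" by (auto simp: J_def)
  have "\<forall>\<^sub>F n in sequentially. k (\<tau> (r n)) \<in> ?N"
    using tendstoD[OF r(2) s(1)] by eventually_elim (simp add: dist_commute)
  moreover have "\<forall>\<^sub>F n in sequentially. \<tau> (r n) > 1 - e / 2"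
    using tr e(1) by (intro order_tendstoD(1)[OF tr]) simp
  ultimately have "\<forall>\<^sub>F n in sequentially. k (\<tau> (r n)) \<in> ?N \<and> \<tau> (r n) \<in> J"
    by eventually_elim (use tau in \<open>auto simp: J_def\<close>)
  then obtain t1 where t1: "k t1 \<in> ?N" "t1 \<in> J"
    using eventually_happens sequentially_bot by blast
  have gamc: "continuous_on A \<gamma>" for A unfolding \<gamma>_def by (intro continuous_intros)
  have gc: "continuous_on (J \<union> {1}) (\<lambda>t. ?g (\<gamma> t))"
    by (rule continuous_on_compose2[OF V(2)]) (use J d(2) gamc in blast)+
  have agree: "k t = ?g (\<gamma> t)" if "t \<in> J" for t
  proof (rule lifts_agree[of J _ _ t1])
    show "connected J" unfolding J_def by simp
    show "continuous_on J k" by (rule continuous_on_subset[OF kc Jsub])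
    show "continuous_on J (\<lambda>t. ?g (\<gamma> t))" by (rule continuous_on_subset[OF gc]) auto
    show "F (k u) = F (?g (\<gamma> u))" if "u \<in> J" for u
    proof -
      have "\<gamma> u \<in> F ` ?N" using J[of u] that d(2) by blast
      then show ?thesis using V(3) Fk[of u] that Jsub by (metis subsetD)
    qed
    show "k t1 = ?g (\<gamma> t1)" using V(4)[OF t1(1)] Fk[of t1] t1(2) Jsub by auto
  qed (use t1 that in auto)
  define l where "l t = (if t < 1 then k t else ?g (\<gamma> t))" for t
  have "segment_lift F p z l"
    unfolding segment_lift_def
  proof (intro conjI ballI)
    show "continuous_on {0..1} l"
    proof -
      define c where "c = max 0 (1 - e / 2)"
      have c: "0 \<le> c" "c < 1" "J = {c..<1}" using e(1) by (auto simp: c_def J_def)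
      have "continuous_on {0..c} k" by (rule continuous_on_subset[OF kc]) (use c in auto)
      then have "continuous_on {0..c} l" by (rule continuous_on_eq) (use c in \<open>auto simp: l_def\<close>)
      moreover have "continuous_on {c..1} (\<lambda>t. ?g (\<gamma> t))"
        by (rule continuous_on_subset[OF gc]) (use c in auto)
      then have "continuous_on {c..1} l"
        by (rule continuous_on_eq) (use c agree in \<open>auto simp: l_def\<close>)
      ultimately have "continuous_on ({0..c} \<union> {c..1}) l" by (intro continuous_on_closed_Un) auto
      moreover have "{0..c} \<union> {c..1} = {0..1}" using c by auto
      ultimately show ?thesis by simp
    qed
    show "l 0 = p" using start_in_reach by (simp add: l_def k_def \<gamma>_def)
    show "F (l t) = F p + t *\<^sub>R (z - F p)" if "t \<in> {0..1}" for t
    proof (cases "t < 1")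
      case True then show ?thesis using Fk[of t] that by (simp add: l_def \<gamma>_def)
    next
      case False
      then have "t = 1" using that by simp
      then show ?thesis using V(3)[OF \<open>z \<in> F ` ?N\<close>] by (simp add: l_def gam1)
    qed
  qed
  then show False using z by (auto simp: reach_def)
qed

lemma branch_reverse:
  assumes q: "F q \<in> reach F p" "branch F p (F q) = q"
  shows "F p \<in> reach F q" "branch F q (F p) = p"
proof -
  obtain l where l: "segment_lift F p (F q) l" using q unfolding reach_def by blast
  then have lc: "continuous_on {0..1} l" and l0: "l 0 = p"
    and Fl: "\<And>t. t \<in> {0..1} \<Longrightarrow> F (l t) = F p + t *\<^sub>R (F q - F p)" by (auto simp: segment_lift_def)
  have l1: "l 1 = q" using branch_eq[OF l] q by simp
  have "segment_lift F q (F p) (\<lambda>t. l (1 - t))"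
    unfolding segment_lift_def
  proof (intro conjI ballI)
    show "continuous_on {0..1} (\<lambda>t. l (1 - t))"
      by (auto intro!: continuous_on_compose2[OF lc] continuous_intros)
    show "F (l (1 - t)) = F q + t *\<^sub>R (F p - F q)" if "t \<in> {0..1}" for t
      using Fl[of "1 - t"] that by (simp add: algebra_simps)
  qed (simp add: l1)
  then show "F p \<in> reach F q" "branch F q (F p) = p"
    using branch_eq l0 by (auto simp: reach_def)
qed

text \<open>
  Convexity gives transitivity of the relation: if \<open>p\<close> and \<open>q\<close> are both joined to \<open>r\<close>, the segment from \<open>F p\<close> to
  \<open>F q\<close> lies in \<open>reach F r\<close> and is lifted by the branch at \<open>r\<close>.
\<close>
lemma convex_reach_imp_all_reached:
  assumes conv: "\<And>p. convex (reach F p)"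
  shows "F q \<in> reach F p \<and> branch F p (F q) = q"
proof -
  define R where "R p q \<longleftrightarrow> F q \<in> reach F p \<and> branch F p (F q) = q" for p q
  have sym: "R q p" if "R p q" for p q using branch_reverse that by (auto simp: R_def)
  have trans: "R p q" if "R p r" "R r q" for p q r
  proof -
    have p: "F p \<in> reach F r" "branch F r (F p) = p" using sym[OF that(1)] by (auto simp: R_def)
    have q: "F q \<in> reach F r" "branch F r (F q) = q" using that(2) by (auto simp: R_def)
    have seg: "F p + t *\<^sub>R (F q - F p) \<in> reach F r" if "t \<in> {0..1}" for t
      using convexD_alt[OF conv p(1) q(1), of t] that by (simp add: algebra_simps)
    have l: "segment_lift F p (F q) (\<lambda>t. branch F r (F p + t *\<^sub>R (F q - F p)))"
      unfolding segment_lift_def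
      by (intro conjI ballI continuous_on_compose2[OF continuous_branch] continuous_intros)
         (use seg p F_branch in auto)
    then show ?thesis using branch_eq[OF l] q by (auto simp: R_def reach_def)
  qed
  have "R p q"
  proof (rule connected_equivalence_relation[of UNIV p q R])
    fix x :: 'a
    obtain s where s: "s > 0" "inj_on F (ball x s)" using locally_inj by blast
    obtain \<delta> where d: "\<delta> > 0" "ball (F x) \<delta> \<subseteq> reach F x" "continuous_on (ball (F x) \<delta>) (branch F x)"
      using reach_neighborhood[OF start_in_reach(1)] by metis
    have "isCont (branch F x) (F x)" using d by (simp add: continuous_on_eq_continuous_at)
    then have "isCont (\<lambda>y. branch F x (F y)) x" using isCont_o2[OF isCont_F] by blast
    then have "(\<lambda>y. branch F x (F y)) \<midarrow>x\<rightarrow> x"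
      using start_in_reach(2)[of x] by (simp add: isCont_def)
    then have "\<forall>\<^sub>F y in at x. dist (branch F x (F y)) x < s"
      using s(1) by (rule tendstoD)
    moreover have "\<forall>\<^sub>F y in at x. dist (F y) (F x) < \<delta>"
      using isCont_F[of x] d(1) unfolding isCont_def by (rule tendstoD)
    moreover have "\<forall>\<^sub>F y in at x. dist y x < s"
      unfolding eventually_at using s(1) by blast
    ultimately have "\<forall>\<^sub>F y in at x. R x y"
    proof eventually_elim
      case (elim y)
      have "F y \<in> reach F x" using elim(2) d(2) by (auto simp: dist_commute)
      then have "F (branch F x (F y)) = F y" by (rule F_branch)
      then have "branch F x (F y) = y" using s(2) elim(1,3) by (auto simp: inj_on_def dist_commute)
      then show ?case using \<open>F y \<in> reach F x\<close> by (simp add: R_def)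
    qed
    moreover have "R x x" using start_in_reach by (simp add: R_def)
    ultimately have "\<forall>\<^sub>F y in nhds x. R x y"
      unfolding eventually_nhds_conv_at by blast
    then show "\<exists>T. openin (top_of_set UNIV) T \<and> x \<in> T \<and> (\<forall>y\<in>T. R x y)"
      unfolding eventually_nhds by (simp flip: open_openin)
  qed (blast intro: sym trans)+
  then show ?thesis by (simp add: R_def)
qed

lemma convex_reach_imp_injective_convex_range:
  assumes "\<And>p. convex (reach F p)"
  shows "inj F" "convex (range F)"
proof -
  note all = convex_reach_imp_all_reached[OF assms]
  show "inj F"
  proof (rule injI)
    fix p q assume "F p = F q"
    then show "p = q" using all[where p = p and q = q] all[where p = p and q = p] by simp
  qed
  show "convex (range F)"
    unfolding convex_alt
  proof (clarify)
    fix p q and u :: real assume u: "0 \<le> u" "u \<le> 1"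
    have "F p + u *\<^sub>R (F q - F p) \<in> reach F p" using reach_star[of "F q" p u] all u by simp
    then have "F p + u *\<^sub>R (F q - F p) \<in> range F" by (metis F_branch rangeI)
    then show "(1 - u) *\<^sub>R F p + u *\<^sub>R F q \<in> range F" by (simp add: algebra_simps)
  qed
qed

end

section \<open>Maps of Jacobian one\<close>

locale unimodular_map =
  fixes F :: "real^2 \<Rightarrow> real^2"
  assumes diff: "\<And>x. F differentiable (at x)" and unimodular: "\<And>x. det (jacobian F (at x)) = 1"

lemma (in unimodular_map) complex_derivative:
  "\<exists>\<alpha> \<beta>. norm \<beta> < norm \<alpha> \<and>
     ((\<lambda>z. to_complex (F (from_complex z))) has_derivative (\<lambda>w. \<alpha> * w + \<beta> * cnj w)) (at x)"
proof -
  let ?J = "jacobian F (at (from_complex x))"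
  let ?a = "?J$1$1" and ?b = "?J$1$2" and ?c = "?J$2$1" and ?d = "?J$2$2"
  define \<alpha> \<beta> where "\<alpha> = Complex ((?a + ?d) / 2) ((?c - ?b) / 2)" and "\<beta> = Complex ((?a - ?d) / 2) ((?c + ?b) / 2)"
  have "(norm \<alpha>)\<^sup>2 - (norm \<beta>)\<^sup>2 = det ?J"
    unfolding cmod_power2 \<alpha>_def \<beta>_def det_2 by (simp add: power2_eq_square field_simps)
  then have "(norm \<beta>)\<^sup>2 < (norm \<alpha>)\<^sup>2"
    using unimodular[of "from_complex x"] by linarith
  then have "norm \<beta> < norm \<alpha>" by (rule power2_less_imp_less) (rule norm_ge_zero)
  moreover have "((\<lambda>z. to_complex (F (from_complex z))) has_derivative (\<lambda>w. to_complex (?J *v from_complex w))) (at x)"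
    by (rule has_derivative_compose[OF has_derivative_compose[OF
          bounded_linear_imp_has_derivative[OF bounded_linear_from_complex] derivative_jacobian[OF diff]]
          bounded_linear_imp_has_derivative[OF bounded_linear_to_complex]])
  moreover have "to_complex (?J *v from_complex w) = \<alpha> * w + \<beta> * cnj w" for w
    by (simp add: complex_eq_iff to_complex_def from_complex_def matrix_vector_mult_2 \<alpha>_def \<beta>_def field_simps)
  ultimately show ?thesis by (intro exI[of _ \<alpha>] exI[of _ \<beta>]) simp
qed

sublocale unimodular_map \<subseteq> locally_injective F
proof
  show "continuous_on UNIV F"
    using diff by (simp add: continuous_at_imp_continuous_on differentiable_imp_continuous_within)
  show "\<exists>s>0. inj_on F (ball p s)" for p
  proof -
    obtain s where s: "s > 0" "inj_on (\<lambda>z. to_complex (F (from_complex z))) (ball (to_complex p) s)"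
      using locally_injective_of_positive_derivative[OF complex_derivative] by blast
    have "dist (to_complex x) (to_complex y) = dist x y" for x y
      by (simp add: to_complex_def dist_norm cmod_def norm_vec_def L2_set_def sum_2)
    then have "inj_on F (ball p s)"
      using s(2) unfolding inj_on_def by (metis from_to_complex mem_ball)
    then show ?thesis using s(1) by blast
  qed
qed

context unimodular_map
begin

lemma branch_derivative:
  assumes z: "z \<in> reach F p"
  obtains A where "(branch F p has_derivative (\<lambda>v. A *v v)) (at z)" "det A = 1"
    "jacobian F (at (branch F p z)) ** A = mat 1" "A ** jacobian F (at (branch F p z)) = mat 1"
proof -
  let ?J = "jacobian F (at (branch F p z))"
  have inv: "invertible ?J" using unimodular invertible_det_nz by (metis zero_neq_one)
  then obtain A where A: "?J ** A = mat 1" "A ** ?J = mat 1"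
    unfolding invertible_def by blast
  have "det A = 1" using det_mul[of ?J A] A unimodular by simp
  moreover have "(branch F p has_derivative (\<lambda>v. A *v v)) (at z)"
  proof (rule has_derivative_inverse_basic)
    show "(F has_derivative (\<lambda>v. ?J *v v)) (at (branch F p z))" by (rule derivative_jacobian[OF diff])
    show "bounded_linear (\<lambda>v. A *v v)" by simp
    show "(\<lambda>v. A *v v) \<circ> (\<lambda>v. ?J *v v) = id" by (simp add: fun_eq_iff matrix_vector_mul_assoc A)
    show "continuous (at z) (branch F p)"
      using continuous_branch open_reach z by (simp add: continuous_on_eq_continuous_at)
    show "open (reach F p)" by (rule open_reach)
  qed (use z F_branch in auto)
  ultimately show thesis using that A by blast
qed

end

section \<open>Strips\<close>

locale W_map = unimodular_map +
  assumes W: "W_condition F"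
begin

text \<open>
  The quantity bounded here is the maximum over the chord at parameter \<open>t\<close> of the coordinate of the
  branch perpendicular to the chord direction. When it is large it is attained inside the chord, since
  the ends of the chords stay in a compact part of \<open>reach F p\<close>.
\<close>
lemma triangle_bound_above:
  fixes p :: "real^2"
  defines "a \<equiv> F p"
  assumes bc: "b \<in> reach F p" "c \<in> reach F p" "b \<noteq> c" and sg: "\<bar>\<sigma>\<bar> = 1"
    and tri: "\<And>t s. t \<in> {0..<1} \<Longrightarrow> s \<in> {0..1} \<Longrightarrow> a + t *\<^sub>R (b + s *\<^sub>R (c - b) - a) \<in> reach F p"
  shows "\<exists>B. \<forall>t\<in>{0..<1}. \<forall>s\<in>{0..1}.
      \<sigma> * cross2 (c - b) (branch F p (a + t *\<^sub>R (b + s *\<^sub>R (c - b) - a))) \<le> B"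
proof -
  define d where "d = c - b"
  define G where "G = branch F p"
  define Z where "Z t s = a + t *\<^sub>R (b + s *\<^sub>R d - a)" for t s
  have d0: "d \<noteq> 0" using bc by (simp add: d_def)
  then have nd: "norm d > 0" by simp
  have Zr: "Z t s \<in> reach F p" if "t \<in> {0..<1}" "s \<in> {0..1}" for t s
    using tri[OF that] by (simp add: Z_def d_def)
  define m :: "real^2" where "m = (\<sigma> / norm d) *\<^sub>R vector [- d $ 2, d $ 1]"
  have norm_perp: "norm (vector [- d $ 2, d $ 1] :: real^2) = norm d"
    by (simp add: norm_vec_def L2_set_def sum_2 add.commute)
  have m1: "norm m = 1" using sg nd by (simp add: m_def norm_perp)
  have mx: "m \<bullet> x = \<sigma> / norm d * cross2 d x" for x
    by (simp add: m_def inner_2 cross2_def right_diff_distrib diff_divide_distrib mult.assoc)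
  define h where "h = (\<lambda>(t, s). m \<bullet> G (Z t s))"
  have contZ: "continuous_on A (\<lambda>x. Z (fst x) (snd x))" for A
    unfolding Z_def by (intro continuous_intros)
  have conth: "continuous_on ({0..<1} \<times> {0..1}) h"
    unfolding h_def case_prod_unfold G_def
    by (intro continuous_intros continuous_on_compose2[OF continuous_branch contZ]) (use Zr in auto)
  have slice: "\<exists>s\<in>{0..1}. \<forall>s'\<in>{0..1}. h (t, s') \<le> h (t, s)" if t: "t \<in> {0..<1}" for t
  proof (rule continuous_attains_sup)
    show "continuous_on {0..1} (\<lambda>s. h (t, s))"
      by (rule continuous_on_compose2[OF conth]) (use t in \<open>auto intro!: continuous_intros\<close>)
  qed auto
  then obtain \<mu> where mu: "\<And>t. t \<in> {0..<1} \<Longrightarrow> \<mu> t \<in> {0..1}"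
      "\<And>t s. t \<in> {0..<1} \<Longrightarrow> s \<in> {0..1} \<Longrightarrow> h (t, s) \<le> h (t, \<mu> t)" by metis
  define \<phi> where "\<phi> t = h (t, \<mu> t)" for t
  have cphi: "continuous_on {0..<1} \<phi>"
    by (rule continuous_on_slice_max[OF conth]) (use mu in \<open>auto simp: \<phi>_def\<close>)
  \<comment> \<open>The two ends of the chords run inside the reached set, where the branch is bounded.\<close>
  have side: "\<exists>B. \<forall>t\<in>{0..<1}. m \<bullet> G (a + t *\<^sub>R (e - a)) \<le> B" if e: "e \<in> reach F p" for e
  proof -
    have "continuous_on {0..1} (\<lambda>t. m \<bullet> G (a + t *\<^sub>R (e - a)))"
      unfolding G_def a_def
      by (intro continuous_intros continuous_on_compose2[OF continuous_branch]) (use reach_star[OF e] in auto)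
    then obtain t0 where "\<forall>t\<in>{0..1}. m \<bullet> G (a + t *\<^sub>R (e - a)) \<le> m \<bullet> G (a + t0 *\<^sub>R (e - a))"
      using continuous_attains_sup[of "{0..1::real}" "\<lambda>t. m \<bullet> G (a + t *\<^sub>R (e - a))"] by auto
    then show ?thesis by (intro exI[of _ "m \<bullet> G (a + t0 *\<^sub>R (e - a))"]) auto
  qed
  have "\<exists>B. \<forall>t\<in>{0..<1}. h (t, 0) \<le> B" "\<exists>B. \<forall>t\<in>{0..<1}. h (t, 1) \<le> B"
    using side[OF bc(1)] side[OF bc(2)] by (simp_all add: h_def Z_def d_def)
  then obtain B0 B1 where B0: "\<And>t. t \<in> {0..<1} \<Longrightarrow> h (t, 0) \<le> B0"
      and B1: "\<And>t. t \<in> {0..<1} \<Longrightarrow> h (t, 1) \<le> B1"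
    by blast
  define R where "R = norm a + (norm b + norm d + norm a)"
  have ZR: "norm (Z t s) \<le> R" if "t \<in> {0..<1}" "s \<in> {0..1}" for t s
  proof -
    have "norm (b + s *\<^sub>R d - a) \<le> norm b + norm (s *\<^sub>R d) + norm a"
      using norm_triangle_ineq4[of "b + s *\<^sub>R d" a] norm_triangle_ineq[of b "s *\<^sub>R d"] by linarith
    also have "norm (s *\<^sub>R d) \<le> norm d" using that by (simp add: mult_left_le_one_le)
    finally have 1: "norm (b + s *\<^sub>R d - a) \<le> norm b + norm d + norm a" by simp
    have "norm (Z t s) \<le> norm a + norm (t *\<^sub>R (b + s *\<^sub>R d - a))"
      unfolding Z_def by (rule norm_triangle_ineq)
    also have "norm (t *\<^sub>R (b + s *\<^sub>R d - a)) \<le> norm (b + s *\<^sub>R d - a)"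
      using that by (simp add: mult_left_le_one_le)
    finally show ?thesis using 1 by (simp add: R_def)
  qed
  obtain P where P: "P \<in> weight_functions"
    "\<And>m R. norm m = 1 \<Longrightarrow> \<exists>\<delta>>0. \<exists>X. \<forall>x c. m \<bullet> x \<ge> X \<and> norm (F x) \<le> R \<and>
       real_eigenvalue (jacobian F (at x)) c \<longrightarrow> \<delta> \<le> \<bar>c\<bar> * P (m \<bullet> x)"
    using W_condition_eigenvalue_bound[OF diff W] by blast
  obtain \<delta> X0 where dX: "\<delta> > 0" "\<And>x c. m \<bullet> x \<ge> X0 \<Longrightarrow> norm (F x) \<le> R \<Longrightarrow>
       real_eigenvalue (jacobian F (at x)) c \<Longrightarrow> \<delta> \<le> \<bar>c\<bar> * P (m \<bullet> x)"
    using P(2)[OF m1, of R] by metis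
  define X where "X = max X0 (max B0 B1 + 1)"
  \<comment> \<open>The quotient \<open>\<bar>H\<bar> / norm d\<close> is the height of the triangle, at which rate the chords move.\<close>
  define H where "H = cross2 d (b - a)"
  define K where "K = \<bar>H\<bar> / (norm d * \<delta>) + 1"
  have K: "K > 0" unfolding K_def using nd dX(1) by (intro add_nonneg_pos divide_nonneg_nonneg) auto
  have "\<exists>B. \<forall>t\<in>{0..<1}. \<phi> t \<le> B"
  proof (rule slow_growth_bounded[OF P(1) K cphi, of X])
    fix t :: real assume t: "0 < t" "t < 1" "X \<le> \<phi> t"
    define s where "s = \<mu> t"
    have tI: "t \<in> {0..<1}" using t by simp
    have s01: "s \<in> {0..1}" using mu(1)[OF tI] by (simp add: s_def)
    have phis: "\<phi> t = m \<bullet> G (Z t s)" by (simp add: \<phi>_def h_def s_def)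
    have "s \<noteq> 0" "s \<noteq> 1" using t(3) B0[OF tI] B1[OF tI] by (auto simp: \<phi>_def s_def X_def)
    then have s: "0 < s" "s < 1" using s01 by auto
    have zr: "Z t s \<in> reach F p" by (rule Zr[OF tI s01])
    obtain A where A: "(G has_derivative (\<lambda>v. A *v v)) (at (Z t s))" "det A = 1"
        "jacobian F (at (G (Z t s))) ** A = mat 1" "A ** jacobian F (at (G (Z t s))) = mat 1"
      using branch_derivative[OF zr] unfolding G_def by blast
    define y where "y = b + s *\<^sub>R d - a"
    \<comment> \<open>At the maximum on the chord the image of the chord direction is parallel to the chord.\<close>
    have ds: "((\<lambda>s'. Z t s') has_derivative (\<lambda>r. r *\<^sub>R (t *\<^sub>R d))) (at s)"
      unfolding Z_def by (auto intro!: derivative_eq_intros simp: algebra_simps)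
    have "((\<lambda>s'. m \<bullet> G (Z t s')) has_derivative (\<lambda>r. m \<bullet> (A *v (r *\<^sub>R (t *\<^sub>R d))))) (at s)"
      by (rule has_derivative_inner_right[OF has_derivative_compose[OF ds A(1)]])
    then have D: "((\<lambda>s'. m \<bullet> G (Z t s')) has_real_derivative (t * (m \<bullet> (A *v d)))) (at s)"
      unfolding has_field_derivative_def
      by (rule has_derivative_eq_rhs) (simp add: fun_eq_iff matrix_vector_mult_scaleR mult_ac)
    have "t * (m \<bullet> (A *v d)) = 0"
    proof (rule DERIV_local_max[OF D])
      show "0 < min s (1 - s)" using s by simp
      show "\<forall>s'. \<bar>s - s'\<bar> < min s (1 - s) \<longrightarrow> m \<bullet> G (Z t s') \<le> m \<bullet> G (Z t s)"
        using mu(2)[OF tI] by (auto simp: h_def s_def abs_less_iff)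
    qed
    then have "cross2 d (A *v d) = 0" using t sg nd by (auto simp: mx)
    then obtain k where k: "k \<noteq> 0" "real_eigenvalue (jacobian F (at (G (Z t s)))) k"
        "\<And>y. k * cross2 d (A *v y) = cross2 d y"
      using eigenvalue_of_inverse_area_preserving[OF A(3,4,2) d0] by blast
    have dt: "((\<lambda>t'. Z t' s) has_derivative (\<lambda>r. r *\<^sub>R y)) (at t)"
      unfolding Z_def y_def by (auto intro!: derivative_eq_intros)
    have "((\<lambda>t'. m \<bullet> G (Z t' s)) has_derivative (\<lambda>r. m \<bullet> (A *v (r *\<^sub>R y)))) (at t)"
      by (rule has_derivative_inner_right[OF has_derivative_compose[OF dt A(1)]])
    then have Dt: "((\<lambda>t'. m \<bullet> G (Z t' s)) has_real_derivative (m \<bullet> (A *v y))) (at t)"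
      unfolding has_field_derivative_def
      by (rule has_derivative_eq_rhs) (simp add: fun_eq_iff matrix_vector_mult_scaleR mult_ac)
    have Fz: "F (G (Z t s)) = Z t s" unfolding G_def by (rule F_branch[OF zr])
    have ev: "\<delta> \<le> \<bar>k\<bar> * P (\<phi> t)"
      unfolding phis by (rule dX(2)) (use t(3) ZR[OF tI s01] k(2) in \<open>auto simp: phis X_def Fz\<close>)
    have "cross2 d y = H" by (simp add: y_def H_def cross2_simps)
    then have "cross2 d (A *v y) = H / k" using k(1) k(3)[of y] by (simp add: field_simps)
    then have "\<bar>m \<bullet> (A *v y)\<bar> = \<bar>H\<bar> / (norm d * \<bar>k\<bar>)"
      using sg by (simp add: mx abs_mult abs_divide)
    also have "\<dots> \<le> \<bar>H\<bar> / (norm d * \<delta>) * P (\<phi> t)"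
    proof -
      have "\<bar>H\<bar> * \<delta> \<le> \<bar>H\<bar> * (\<bar>k\<bar> * P (\<phi> t))" using ev by (intro mult_left_mono) auto
      then show ?thesis using nd dX(1) k(1) by (simp add: field_simps)
    qed
    also have "\<dots> \<le> K * P (\<phi> t)"
    proof -
      have "0 \<le> P (\<phi> t)" using ev dX(1) k(1) by (smt (verit) mult_nonneg_nonpos abs_ge_zero)
      then show ?thesis by (simp add: K_def algebra_simps)
    qed
    finally have slope: "m \<bullet> (A *v y) \<le> K * P (\<phi> t)" by simp
    show "\<exists>\<psi> \<mu>. (\<psi> has_real_derivative \<mu>) (at t) \<and> \<psi> t = \<phi> t \<and> \<mu> \<le> K * P (\<phi> t) \<and>
        (\<forall>t'. 0 \<le> t' \<and> t' < t \<longrightarrow> \<psi> t' \<le> \<phi> t')"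
    proof (intro exI conjI allI impI)
      show "m \<bullet> G (Z t' s) \<le> \<phi> t'" if "0 \<le> t' \<and> t' < t" for t'
        using mu(2)[of t' s] that t s01 by (simp add: \<phi>_def h_def)
    qed (use Dt phis slope in auto)
  qed
  then obtain B where B: "\<And>t. t \<in> {0..<1} \<Longrightarrow> \<phi> t \<le> B" by blast
  have "\<sigma> * cross2 d (G (Z t s)) \<le> norm d * B" if ts: "t \<in> {0..<1}" "s \<in> {0..1}" for t s
  proof -
    have "m \<bullet> G (Z t s) \<le> B" using mu(2)[OF ts] B[OF ts(1)] by (simp add: \<phi>_def h_def)
    then show ?thesis using nd by (simp add: mx field_simps)
  qed
  then show ?thesis unfolding Z_def G_def d_def by blast
qed

lemma triangle_strip:
  fixes p :: "real^2"
  defines "a \<equiv> F p"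
  assumes bc: "b \<in> reach F p" "c \<in> reach F p" "b \<noteq> c"
    and tri: "\<And>t s. t \<in> {0..<1} \<Longrightarrow> s \<in> {0..1} \<Longrightarrow> a + t *\<^sub>R (b + s *\<^sub>R (c - b) - a) \<in> reach F p"
  shows "\<exists>B. \<forall>t\<in>{0..<1}. \<forall>s\<in>{0..1}.
      \<bar>cross2 (c - b) (branch F p (a + t *\<^sub>R (b + s *\<^sub>R (c - b) - a)))\<bar> \<le> B"
proof -
  note above = triangle_bound_above[OF bc _ tri[unfolded a_def], folded a_def]
  obtain B1 where 1: "\<forall>t\<in>{0..<1}. \<forall>s\<in>{0..1}.
      1 * cross2 (c - b) (branch F p (a + t *\<^sub>R (b + s *\<^sub>R (c - b) - a))) \<le> B1"
    using above[of 1] by auto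
  obtain B2 where 2: "\<forall>t\<in>{0..<1}. \<forall>s\<in>{0..1}.
      -1 * cross2 (c - b) (branch F p (a + t *\<^sub>R (b + s *\<^sub>R (c - b) - a))) \<le> B2"
    using above[of "-1"] by auto
  show ?thesis
  proof (intro exI[of _ "max B1 B2"] ballI)
    fix t s :: real assume ts: "t \<in> {0..<1}" "s \<in> {0..1}"
    show "\<bar>cross2 (c - b) (branch F p (a + t *\<^sub>R (b + s *\<^sub>R (c - b) - a)))\<bar> \<le> max B1 B2"
      using 1[rule_format, OF ts] 2[rule_format, OF ts] unfolding abs_le_iff by (auto simp: le_max_iff_disj)
  qed
qed

end

section \<open>Angles along disjoint legs\<close>

definition angle_along :: "(real \<Rightarrow> complex) \<Rightarrow> (real \<Rightarrow> real) \<Rightarrow> bool" where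
  "angle_along k y \<longleftrightarrow> continuous_on {0..1} y \<and> (\<forall>t\<in>{0..1}. k t = of_real (norm (k t)) * cis (y t))"

lemma angle_lift:
  fixes k :: "'a::real_normed_vector \<Rightarrow> complex"
  assumes "convex S" "continuous_on S k" "\<And>x. x \<in> S \<Longrightarrow> k x \<noteq> 0"
  obtains y where "continuous_on S y" "\<And>x. x \<in> S \<Longrightarrow> k x = of_real (norm (k x)) * cis (y x)"
proof -
  obtain h where h: "continuous_on S h" "\<And>x. x \<in> S \<Longrightarrow> k x = exp (h x)"
    using continuous_logarithm_on_contractible[OF assms(2) convex_imp_contractible[OF assms(1)] assms(3)] by blast
  show thesis
  proof (rule that[of "\<lambda>x. Im (h x)"])
    show "k x = of_real (norm (k x)) * cis (Im (h x))" if "x \<in> S" for x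
      using h(2)[OF that] by (simp add: exp_eq_polar[of "h x"] norm_mult)
  qed (intro continuous_intros h(1))
qed

lemma cross_polar: "Im (cnj (of_real r * cis a) * (of_real s * cis b)) = r * s * sin (b - a)"
  by (simp add: sin_diff algebra_simps)

lemma cross_along:
  assumes "angle_along k1 y1" "angle_along k2 y2" "t \<in> {0..1}"
  shows "Im (cnj (k1 t) * k2 t) = norm (k1 t) * norm (k2 t) * sin (y2 t - y1 t)"
proof -
  have "k1 t = of_real (norm (k1 t)) * cis (y1 t)" "k2 t = of_real (norm (k2 t)) * cis (y2 t)"
    using assms by (auto simp: angle_along_def)
  then show ?thesis using cross_polar[of "norm (k1 t)" "y1 t" "norm (k2 t)" "y2 t"] by presburger
qed

lemma angle_difference_constant:
  fixes y z :: "real \<Rightarrow> real"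
  assumes cont: "continuous_on {0..1} y" "continuous_on {0..1} z"
    and eq: "\<And>t. t \<in> {0..1} \<Longrightarrow> cis (y t) = cis (z t)"
  shows "y 1 - z 1 = y 0 - z 0"
proof -
  have "(\<lambda>t. y t - z t) constant_on {0..1}"
  proof (rule continuous_discrete_range_constant)
    show "continuous_on {0..1} (\<lambda>t. y t - z t)" by (intro continuous_intros cont)
    fix t :: real assume t: "t \<in> {0..1}"
    have "2 * pi \<le> norm ((y s - z s) - (y t - z t))" if s: "s \<in> {0..1}" and ne: "y s - z s \<noteq> y t - z t" for s
    proof -
      have "cis ((y s - z s) - (y t - z t)) = 1"
        unfolding cis_divide[symmetric] eq[OF s] eq[OF t] by simp
      then have "cos ((y s - z s) - (y t - z t)) = 1" by (simp add: complex_eq_iff)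
      then obtain n :: int where n: "(y s - z s) - (y t - z t) = real_of_int n * 2 * pi"
        using cos_one_2pi_int[THEN iffD1] by blast
      then have "n \<noteq> 0" using ne by auto
      then have "1 \<le> \<bar>real_of_int n\<bar>" by linarith
      then have "2 * pi * 1 \<le> 2 * pi * \<bar>real_of_int n\<bar>" by (intro mult_left_mono) auto
      then show ?thesis using n by (simp add: abs_mult)
    qed
    then show "\<exists>e>0. \<forall>s. s \<in> {0..1} \<and> y s - z s \<noteq> y t - z t \<longrightarrow> e \<le> norm ((y s - z s) - (y t - z t))"
      by (intro exI[of _ "2 * pi"]) auto
  qed simp
  then show ?thesis unfolding constant_on_def by (metis atLeastAtMost_iff order_refl zero_le_one)
qed

text \<open>
  A curve that stays on one side of a line through the origin turns by less than \<open>\<pi>\<close>, so the sign of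
  its turn can be read off from its end points.
\<close>
lemma half_plane_turn:
  fixes \<theta> :: "real \<Rightarrow> real" and Q :: "real \<Rightarrow> complex"
  assumes \<theta>: "continuous_on {a..b} \<theta>" "a \<le> b"
    and Q: "\<And>r. r \<in> {a..b} \<Longrightarrow> Q r = of_real (norm (Q r)) * cis (\<theta> r)"
    and side: "(\<forall>r\<in>{a..b}. 0 < Im (cnj d * Q r)) \<or> (\<forall>r\<in>{a..b}. Im (cnj d * Q r) < 0)"
  shows "\<bar>\<theta> b - \<theta> a\<bar> < pi" "Im (cnj (Q a) * Q b) < 0 \<Longrightarrow> \<theta> b < \<theta> a"
    "0 < Im (cnj (Q a) * Q b) \<Longrightarrow> \<theta> a < \<theta> b"
proof -
  define \<sigma> where "\<sigma> = Arg d"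
  have d: "d = of_real (norm d) * cis \<sigma>"
    by (metis \<sigma>_def rcis_cmod_Arg rcis_def)
  have dQ: "Im (cnj d * Q r) = norm d * norm (Q r) * sin (\<theta> r - \<sigma>)" if "r \<in> {a..b}" for r
    using cross_polar[of "norm d" \<sigma> "norm (Q r)" "\<theta> r"] d Q[OF that] by simp
  have snz: "sin (\<theta> r - \<sigma>) \<noteq> 0" if "r \<in> {a..b}" for r
    using side dQ[OF that] that by force
  \<comment> \<open>A continuous angle that stays off the line \<open>d\<close> cannot change by \<open>\<pi>\<close> or more.\<close>
  show small: "\<bar>\<theta> b - \<theta> a\<bar> < pi"
  proof (rule ccontr)
    assume big: "\<not> ?thesis"
    define lo where "lo = min (\<theta> a) (\<theta> b) - \<sigma>"
    define n where "n = \<lceil>lo / pi\<rceil>"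
    have "lo / pi \<le> n" "n - 1 < lo / pi" using ceiling_correct[of "lo / pi"] by (auto simp: n_def)
    then have "lo \<le> n * pi" "(n - 1) * pi < lo"
      by (simp_all only: pos_divide_le_eq pos_less_divide_eq pi_gt_zero)
    then have "lo \<le> n * pi" "n * pi < lo + pi" by (simp_all add: left_diff_distrib)
    then have m: "min (\<theta> a) (\<theta> b) \<le> n * pi + \<sigma>" "n * pi + \<sigma> \<le> max (\<theta> a) (\<theta> b)"
      using big by (auto simp: lo_def min_def max_def abs_if split: if_splits)
    obtain r where r: "r \<in> {a..b}" "\<theta> r = n * pi + \<sigma>"
    proof (cases "\<theta> a \<le> \<theta> b")
      case True
      then show thesis using IVT'[of \<theta> a "n * pi + \<sigma>" b] m \<theta> that by (auto simp: min_def max_def)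
    next
      case False
      then show thesis using IVT2'[of \<theta> b "n * pi + \<sigma>" a] m \<theta> that by (auto simp: min_def max_def)
    qed
    then have "sin (\<theta> r - \<sigma>) = 0" by (simp add: sin_zero_iff_int2)
    then show False using snz[OF r(1)] by simp
  qed
  have sin: "Im (cnj (Q a) * Q b) = norm (Q a) * norm (Q b) * sin (\<theta> b - \<theta> a)"
    using cross_polar[of "norm (Q a)" "\<theta> a" "norm (Q b)" "\<theta> b"] Q[of a] Q[of b] \<theta>(2) by simp
  show "\<theta> b < \<theta> a" if "Im (cnj (Q a) * Q b) < 0"
  proof (rule ccontr)
    assume "\<not> ?thesis"
    then have "0 \<le> sin (\<theta> b - \<theta> a)" using small by (intro sin_ge_zero) auto
    then have "0 \<le> norm (Q a) * norm (Q b) * sin (\<theta> b - \<theta> a)" by (intro mult_nonneg_nonneg) auto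
    then show False using that unfolding sin by simp
  qed
  show "\<theta> a < \<theta> b" if "0 < Im (cnj (Q a) * Q b)"
  proof (rule ccontr)
    assume "\<not> ?thesis"
    then have "0 \<le> sin (\<theta> a - \<theta> b)" using small by (intro sin_ge_zero) auto
    then have "sin (\<theta> b - \<theta> a) \<le> 0" by (metis minus_diff_eq neg_0_le_iff_le sin_minus)
    then have "norm (Q a) * norm (Q b) * sin (\<theta> b - \<theta> a) \<le> 0" by (intro mult_nonneg_nonpos) auto
    then show False using that unfolding sin by simp
  qed
qed

text \<open>
  Two legs \<open>t k1 t\<close> and \<open>t k2 t\<close> start at the origin in directions in which the second is clockwise from the first, and
  end with the second counterclockwise from the first. The lemma says that relative to each other they
  have turned the long way round. To see this, follow the argument of the difference of a point of the first leg and a point of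
  the second: keep the first point at the tip while the second runs out, then let the first point run back. This
  interpolates between the direction of the first leg and the reverse of the second. The
  total sweep along this path is known at \<open>t = 0\<close>, where the legs are straight, and at \<open>t = 1\<close>, where the
  half plane conditions leave no ambiguity.
\<close>
lemma two_legs_turn:
  fixes k1 k2 :: "real \<Rightarrow> complex"
  assumes k: "continuous_on {0..1} k1" "continuous_on {0..1} k2"
    and ne: "\<And>s t. s \<in> {0..1} \<Longrightarrow> t \<in> {0..1} \<Longrightarrow> (s, t) \<noteq> (0, 0) \<Longrightarrow> of_real s * k1 s \<noteq> of_real t * k2 t"
    and y1: "angle_along k1 y1" and y2: "angle_along k2 y2"
    and start: "0 < y1 0 - y2 0" "y1 0 - y2 0 < pi" and w: "k1 0 \<noteq> 0" "k2 0 \<noteq> 0"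
    and finish: "0 < Im (cnj (k1 1) * k2 1)"
    and side2: "(\<forall>r\<in>{0..1}. 0 < Im (cnj d2 * (k1 1 - of_real r * k2 r))) \<or>
                (\<forall>r\<in>{0..1}. Im (cnj d2 * (k1 1 - of_real r * k2 r)) < 0)"
    and side1: "(\<forall>r\<in>{0..1}. 0 < Im (cnj d1 * (of_real r * k1 r - k2 1))) \<or>
                (\<forall>r\<in>{0..1}. Im (cnj d1 * (of_real r * k1 r - k2 1)) < 0)"
  shows "pi < y1 1 - y2 1" "y1 1 - y2 1 < 2 * pi"
proof -
  \<comment> \<open>The difference of a point of each leg, divided by \<open>t\<close>, which makes it nonzero at \<open>t = 0\<close> too.\<close>
  define \<alpha> \<beta> :: "real \<Rightarrow> real" where "\<alpha> r = min 1 (2 - r)" and "\<beta> r = min 1 r" for r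
  define Q where "Q = (\<lambda>(t, r). of_real (\<alpha> r) * k1 (t * \<alpha> r) - of_real (\<beta> r) * k2 (t * \<beta> r))"
  let ?S = "{0..1::real} \<times> {0..2::real}"
  have ab: "\<alpha> r \<in> {0..1}" "\<beta> r \<in> {0..1}" "\<alpha> r = 1 \<or> \<beta> r = 1" if "r \<in> {0..2}" for r
    using that by (auto simp: \<alpha>_def \<beta>_def)
  have tab: "t * \<alpha> r \<in> {0..1}" "t * \<beta> r \<in> {0..1}" if "t \<in> {0..1}" "r \<in> {0..2}" for t r
    using ab[OF that(2)] that(1) by (auto simp: mult_le_one)
  have k1: "k1 t = of_real (norm (k1 t)) * cis (y1 t)" and k2: "k2 t = of_real (norm (k2 t)) * cis (y2 t)"
    if "t \<in> {0..1}" for t using y1 y2 that by (auto simp: angle_along_def)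
  define \<delta> where "\<delta> = y1 0 - y2 0"
  have rot1: "Im (cnj (k1 0) * k2 0) = - (norm (k1 0) * norm (k2 0) * sin \<delta>)"
  proof -
    have "Im (cnj (k1 0) * k2 0) = norm (k1 0) * norm (k2 0) * sin (- \<delta>)"
      using cross_polar[of "norm (k1 0)" "y1 0" "norm (k2 0)" "y2 0"]
      unfolding k1[of 0, simplified, symmetric] k2[of 0, simplified, symmetric] by (simp add: \<delta>_def)
    then show ?thesis by simp
  qed
  have sind: "sin \<delta> > 0" using start by (simp add: \<delta>_def sin_gt_zero)
  have neg0: "Im (cnj (k1 0) * k2 0) < 0" unfolding rot1 using sind w by simp
  have "Q (t, r) \<noteq> 0" if tr: "t \<in> {0..1}" "r \<in> {0..2}" for t r
  proof (cases "t = 0")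
    case True
    have e: "Q (t, r) = of_real (\<alpha> r) * k1 0 - of_real (\<beta> r) * k2 0" using True by (simp add: Q_def)
    show ?thesis
    proof
      assume "Q (t, r) = 0"
      then have z: "of_real (\<alpha> r) * k1 0 = of_real (\<beta> r) * k2 0" using e by simp
      have "\<beta> r * Im (cnj (k1 0) * k2 0) = Im (cnj (k1 0) * (of_real (\<beta> r) * k2 0))"
        by (simp add: algebra_simps)
      also have "\<dots> = Im (cnj (k1 0) * (of_real (\<alpha> r) * k1 0))" using z by simp
      also have "\<dots> = 0" by (simp add: algebra_simps)
      finally have "\<beta> r = 0" using neg0 by simp
      then have "\<alpha> r = 1" using ab[OF tr(2)] by auto
      then show False using z \<open>\<beta> r = 0\<close> w by simp
    qed
  next
    case False
    have "(t * \<alpha> r, t * \<beta> r) \<noteq> (0, 0)" using ab(3)[OF tr(2)] False by auto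
    from ne[OF tab[OF tr] this] have "of_real t * Q (t, r) \<noteq> 0"
      by (simp add: Q_def right_diff_distrib mult.assoc)
    then show ?thesis by auto
  qed
  then have Qne: "\<And>x. x \<in> ?S \<Longrightarrow> Q x \<noteq> 0" by auto
  have ca: "continuous_on A (\<lambda>x. \<alpha> (snd x))" and cb: "continuous_on A (\<lambda>x. \<beta> (snd x))" for A :: "(real \<times> real) set"
    unfolding \<alpha>_def \<beta>_def by (intro continuous_intros)+
  have "continuous_on ?S Q"
    unfolding Q_def case_prod_unfold
    by (intro continuous_intros ca cb continuous_on_compose2[OF k(1)] continuous_on_compose2[OF k(2)])
       (use tab in force)+
  then obtain \<Theta> where \<Theta>: "continuous_on ?S \<Theta>" "\<And>x. x \<in> ?S \<Longrightarrow> Q x = of_real (norm (Q x)) * cis (\<Theta> x)"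
    using angle_lift[of ?S Q] Qne by (metis convex_Times convex_real_interval(5))
  have \<Theta>_slice: "continuous_on A (\<lambda>t. \<Theta> (f t, g t))"
    if "continuous_on A f" "continuous_on A g" "\<And>t. t \<in> A \<Longrightarrow> (f t, g t) \<in> ?S" for A :: "real set" and f g
    by (rule continuous_on_compose2[OF \<Theta>(1) continuous_on_Pair[OF that(1,2)]]) (use that(3) in blast)
  have unit: "cis a = cis b" if "of_real r * cis a = of_real r * cis b" "r \<noteq> 0" for a b r
    using that by simp
  have cis0: "cis (y1 t) = cis (\<Theta> (t, 0))" if t: "t \<in> {0..1}" for t
  proof -
    have "Q (t, 0) = k1 t" by (simp add: Q_def \<alpha>_def \<beta>_def)
    then show ?thesis
      using k1[OF t] \<Theta>(2)[of "(t, 0)"] Qne[of "(t, 0)"] t by (intro unit[of "norm (k1 t)"]) auto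
  qed
  have cis2: "cis (y2 t + pi) = cis (\<Theta> (t, 2))" if t: "t \<in> {0..1}" for t
  proof -
    have eq: "Q (t, 2) = - k2 t" by (simp add: Q_def \<alpha>_def \<beta>_def)
    then have N: "norm (Q (t, 2)) = norm (k2 t)" "norm (k2 t) \<noteq> 0" using Qne[of "(t, 2)"] t by auto
    have "of_real (norm (k2 t)) * cis (y2 t + pi) = - k2 t"
      using k2[OF t] unfolding cis_mult[symmetric] by simp
    also have "\<dots> = of_real (norm (k2 t)) * cis (\<Theta> (t, 2))"
      unfolding eq[symmetric] N(1)[symmetric] by (rule \<Theta>(2)) (use t in simp)
    finally show ?thesis using N(2) by (rule unit)
  qed
  \<comment> \<open>The angle of the difference vector tracks the first leg at one end and the reversed second leg at the other.\<close>
  have end0: "y1 1 - \<Theta> (1, 0) = y1 0 - \<Theta> (0, 0)"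
  proof (rule angle_difference_constant)
    show "continuous_on {0..1} y1" using y1 by (simp add: angle_along_def)
    show "continuous_on {0..1} (\<lambda>t. \<Theta> (t, 0))" by (intro \<Theta>_slice continuous_intros) auto
  qed (rule cis0)
  have end2: "(y2 1 + pi) - \<Theta> (1, 2) = (y2 0 + pi) - \<Theta> (0, 2)"
  proof (rule angle_difference_constant)
    show "continuous_on {0..1} (\<lambda>t. y2 t + pi)" using y2 by (auto simp: angle_along_def intro!: continuous_intros)
    show "continuous_on {0..1} (\<lambda>t. \<Theta> (t, 2))" by (intro \<Theta>_slice continuous_intros) auto
  qed (rule cis2)
  \<comment> \<open>At the branch point the sweep is the supplement of the angle between the legs.\<close>
  have \<Theta>_r: "continuous_on {a..b} (\<lambda>r. \<Theta> (t, r))" if "t \<in> {0..1}" "0 \<le> a" "b \<le> 2" for t a b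
    by (intro \<Theta>_slice continuous_intros) (use that in auto)
  have q1: "Q (t, r) = k1 t - of_real r * k2 (t * r)" if "r \<in> {0..1}" for t r
    using that by (simp add: Q_def \<alpha>_def \<beta>_def)
  have q2: "Q (t, r) = of_real (2 - r) * k1 (t * (2 - r)) - k2 t" if "r \<in> {1..2}" for t r
    using that by (simp add: Q_def \<alpha>_def \<beta>_def)
  have sweep0: "\<Theta> (0, 2) - \<Theta> (0, 0) = pi - \<delta>"
  proof -
    let ?c = "Im (cnj (k1 0) * k2 0)"
    have e1: "Im (cnj (- k2 0) * Q (0, r)) = ?c" if "r \<in> {0..1}" for r
      unfolding q1[OF that] by (simp add: algebra_simps)
    have e2: "Im (cnj (k1 0) * Q (0, r)) = - ?c" if "r \<in> {1..2}" for r
      unfolding q2[OF that] by (simp add: algebra_simps)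
    have t1: "Im (cnj (Q (0, 0)) * Q (0, 1)) = - ?c" "Im (cnj (Q (0, 1)) * Q (0, 2)) = - ?c"
    proof -
      have Q0: "Q (0, 0) = k1 0" "Q (0, 1) = k1 0 - k2 0" "Q (0, 2) = - k2 0"
        using q1[of 0 0] q1[of 1 0] q2[of 2 0] by simp_all
      show "Im (cnj (Q (0, 0)) * Q (0, 1)) = - ?c" "Im (cnj (Q (0, 1)) * Q (0, 2)) = - ?c"
        unfolding Q0 by (simp_all add: algebra_simps)
    qed
    have side1: "(\<forall>r\<in>{0..1}. 0 < Im (cnj (- k2 0) * Q (0, r))) \<or> (\<forall>r\<in>{0..1}. Im (cnj (- k2 0) * Q (0, r)) < 0)"
      using e1 neg0 by (intro disjI2 ballI) metis
    have side2: "(\<forall>r\<in>{1..2}. 0 < Im (cnj (k1 0) * Q (0, r))) \<or> (\<forall>r\<in>{1..2}. Im (cnj (k1 0) * Q (0, r)) < 0)"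
      using e2 neg0 by (intro disjI1 ballI) (metis neg_0_less_iff_less)
    have "\<bar>\<Theta> (0, 1) - \<Theta> (0, 0)\<bar> < pi" "\<Theta> (0, 0) < \<Theta> (0, 1)"
      using half_plane_turn(1,3)[OF \<Theta>_r[of 0 0 1] _ \<Theta>(2) side1] t1 neg0 by simp_all
    moreover have "\<bar>\<Theta> (0, 2) - \<Theta> (0, 1)\<bar> < pi" "\<Theta> (0, 1) < \<Theta> (0, 2)"
      using half_plane_turn(1,3)[OF \<Theta>_r[of 0 1 2] _ \<Theta>(2) side2] t1 neg0 by simp_all
    ultimately have X: "0 < \<Theta> (0, 2) - \<Theta> (0, 0)" "\<Theta> (0, 2) - \<Theta> (0, 0) < 2 * pi" by linarith+
    have "cis (\<Theta> (0, 2) - \<Theta> (0, 0)) = cis (pi - \<delta>)"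
    proof -
      have "cis (\<Theta> (0, 2) - \<Theta> (0, 0)) = cis (y2 0 + pi) / cis (y1 0)"
        using cis0[of 0] cis2[of 0] unfolding cis_divide[symmetric] by simp
      also have "\<dots> = cis (pi - \<delta>)"
        unfolding cis_divide by (simp add: \<delta>_def algebra_simps)
      finally show ?thesis .
    qed
    then obtain n :: int where n: "\<Theta> (0, 2) - \<Theta> (0, 0) = (pi - \<delta>) + 2 * pi * n"
    proof -
      have "sin (\<Theta> (0, 2) - \<Theta> (0, 0)) = sin (pi - \<delta>) \<and> cos (\<Theta> (0, 2) - \<Theta> (0, 0)) = cos (pi - \<delta>)"
        using \<open>cis (\<Theta> (0, 2) - \<Theta> (0, 0)) = cis (pi - \<delta>)\<close> by (simp only: complex_eq_iff cis.simps)
      then show thesis using sin_cos_eq_iff[THEN iffD1] that by blast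
    qed
    have "2 * pi * n < 2 * pi" "- (2 * pi) < 2 * pi * n"
      using X start n pi_gt_zero unfolding \<delta>_def by linarith+
    then have "\<bar>2 * pi * n\<bar> < 2 * pi * 1" by linarith
    then have "n = 0" by (simp add: abs_mult)
    then show ?thesis using n by simp
  qed
  \<comment> \<open>At the tips both half turns are clockwise and less than \<open>\<pi>\<close>.\<close>
  have cross1: "Im (cnj (k1 1) * (k1 1 - k2 1)) < 0" and cross2: "Im (cnj (k1 1 - k2 1) * (- k2 1)) < 0"
    using finish by (simp_all add: algebra_simps)
  have turn1: "\<bar>\<Theta> (1, 1) - \<Theta> (1, 0)\<bar> < pi" "\<Theta> (1, 1) < \<Theta> (1, 0)"
  proof -
    have side: "(\<forall>r\<in>{0..1}. 0 < Im (cnj d2 * Q (1, r))) \<or> (\<forall>r\<in>{0..1}. Im (cnj d2 * Q (1, r)) < 0)"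
      using side2 q1[of _ 1] unfolding mult_1 by metis
    have "Im (cnj (Q (1, 0)) * Q (1, 1)) < 0"
      using cross1 q1[of 0 1] q1[of 1 1] by simp
    then show "\<bar>\<Theta> (1, 1) - \<Theta> (1, 0)\<bar> < pi" "\<Theta> (1, 1) < \<Theta> (1, 0)"
      using half_plane_turn(1,2)[OF \<Theta>_r[of 1 0 1] _ \<Theta>(2) side] by simp_all
  qed
  have turn2: "\<bar>\<Theta> (1, 2) - \<Theta> (1, 1)\<bar> < pi" "\<Theta> (1, 2) < \<Theta> (1, 1)"
  proof -
    have "2 - r \<in> {0..1}" if "r \<in> {1..2}" for r :: real using that by simp
    then have side: "(\<forall>r\<in>{1..2}. 0 < Im (cnj d1 * Q (1, r))) \<or> (\<forall>r\<in>{1..2}. Im (cnj d1 * Q (1, r)) < 0)"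
      using side1 q2[of _ 1] unfolding mult_1 by metis
    have "Im (cnj (Q (1, 1)) * Q (1, 2)) < 0"
      using cross2 q1[of 1 1] q2[of 2 1] by simp
    then show "\<bar>\<Theta> (1, 2) - \<Theta> (1, 1)\<bar> < pi" "\<Theta> (1, 2) < \<Theta> (1, 1)"
      using half_plane_turn(1,2)[OF \<Theta>_r[of 1 1 2] _ \<Theta>(2) side] by simp_all
  qed
  have total: "pi < y1 1 - y2 1" "y1 1 - y2 1 < 3 * pi"
    using end0 end2 sweep0 turn1 turn2 by (auto simp: \<delta>_def)
  have "norm (k1 1) * norm (k2 1) * sin (y2 1 - y1 1) > 0"
    using finish cross_polar[of "norm (k1 1)" "y1 1" "norm (k2 1)" "y2 1"] k1[of 1] k2[of 1] by simp
  then have "sin (y2 1 - y1 1) > 0"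
    by (metis mult_nonneg_nonpos mult_nonneg_nonneg norm_ge_zero not_less)
  then have "sin (y1 1 - y2 1) < 0" by (metis minus_diff_eq neg_less_0_iff_less sin_minus)
  moreover have "sin (y1 1 - y2 1) \<ge> 0" if "2 * pi \<le> y1 1 - y2 1"
    using sin_ge_zero[of "y1 1 - y2 1 - 2 * pi"] that total by (simp add: sin_diff)
  ultimately show "pi < y1 1 - y2 1" "y1 1 - y2 1 < 2 * pi" using total by force+
qed

text \<open>
  The legs are the curves \<open>t k1 t\<close> and \<open>t k2 t\<close>; working with the quotients \<open>k1\<close> and \<open>k2\<close>
  makes the starting directions the values at \<open>0\<close>. The last two conditions hold when each leg lies in
  a strip that the tip of the other leg avoids.
\<close>
definition reversed_legs :: "(real \<Rightarrow> complex) \<Rightarrow> complex \<Rightarrow> (real \<Rightarrow> complex) \<Rightarrow> complex \<Rightarrow> bool" where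
  "reversed_legs k1 d1 k2 d2 \<longleftrightarrow>
     (\<forall>s\<in>{0..1}. \<forall>t\<in>{0..1}. (s, t) \<noteq> (0, 0) \<longrightarrow> of_real s * k1 s \<noteq> of_real t * k2 t) \<and>
     Im (cnj (k1 0) * k2 0) < 0 \<and> 0 < Im (cnj (k1 1) * k2 1) \<and>
     ((\<forall>r\<in>{0..1}. 0 < Im (cnj d2 * (k1 1 - of_real r * k2 r))) \<or>
      (\<forall>r\<in>{0..1}. Im (cnj d2 * (k1 1 - of_real r * k2 r)) < 0)) \<and>
     ((\<forall>r\<in>{0..1}. 0 < Im (cnj d1 * (of_real r * k1 r - k2 1))) \<or>
      (\<forall>r\<in>{0..1}. Im (cnj d1 * (of_real r * k1 r - k2 1)) < 0))"

lemma reversed_legs_disjoint: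
  assumes "reversed_legs k1 d1 k2 d2" "s \<in> {0..1}" "t \<in> {0..1}" "(s, t) \<noteq> (0, 0)"
  shows "of_real s * k1 s \<noteq> of_real t * k2 t"
  using assms unfolding reversed_legs_def by blast

lemma angle_along_shift:
  assumes "angle_along k y" shows "angle_along k (\<lambda>t. y t + 2 * pi * real_of_int n)"
proof -
  have "cis (y t + 2 * pi * real_of_int n) = cis (y t)" for t
    unfolding cis_mult[symmetric] by (simp add: cis_multiple_2pi)
  then show ?thesis using assms unfolding angle_along_def by (auto intro!: continuous_intros)
qed

lemma sin_pos_shift:
  assumes "0 < sin x"
  obtains n :: int where "0 < x - 2 * pi * real_of_int n" "x - 2 * pi * real_of_int n < pi"
proof -
  define n where "n = \<lfloor>x / (2 * pi)\<rfloor>"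
  let ?z = "x - 2 * pi * real_of_int n"
  have "real_of_int n \<le> x / (2 * pi)" "x / (2 * pi) < real_of_int n + 1"
    unfolding n_def by linarith+
  then have z: "0 \<le> ?z" "?z < 2 * pi"
    by (simp_all add: pos_le_divide_eq pos_divide_less_eq algebra_simps)
  have s: "sin ?z = sin x"
    by (simp add: sin_diff)
  have "?z \<noteq> 0" "?z < pi"
  proof -
    show "?z \<noteq> 0" using s assms by force
    show "?z < pi"
    proof (rule ccontr)
      assume "\<not> ?thesis"
      then have "0 \<le> sin (?z - pi)" using z by (intro sin_ge_zero) auto
      then have "sin ?z \<le> 0" by (simp add: sin_diff)
      then show False using s assms by simp
    qed
  qed
  then show thesis using z that by force
qed

text \<open>
  Measure the angles between the legs continuously from the start. At time \<open>1\<close> the angles between the legs \<open>1, 2\<close> and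
  between the legs \<open>2, 3\<close> exceed \<open>\<pi>\<close>; the angle between the legs \<open>1, 3\<close> is their sum and yet less than \<open>2 \<pi>\<close>.
\<close>
lemma no_three_reversed_legs:
  assumes k: "\<And>i. i \<in> {1, 2, 3::nat} \<Longrightarrow> continuous_on {0..1} (k i)"
    and rev: "\<And>i j. i \<in> {1, 2, 3} \<Longrightarrow> j \<in> {1, 2, 3} \<Longrightarrow> i < j \<Longrightarrow> reversed_legs (k i) (d i) (k j) (d j)"
  shows False
proof -
  have "\<exists>y. angle_along (k i) y" if i: "i \<in> {1, 2, 3}" for i
  proof -
    have ne: "k i t \<noteq> 0" if t: "t \<in> {0..1}" for t
    proof -
      obtain j where j: "(j \<in> {1, 2, 3} \<and> i < j) \<or> (j \<in> {1, 2, 3} \<and> j < i)"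
      proof (cases "i = 1")
        case True
        then show thesis using that[of 2] by simp
      next
        case False
        then show thesis using that[of 1] i by auto
      qed
      show ?thesis
      proof (cases "t = 0")
        case True
        then show ?thesis using j rev[of i j] rev[of j i] i by (auto simp: reversed_legs_def)
      next
        case False
        from j show ?thesis
        proof (elim disjE conjE)
          assume "j \<in> {1, 2, 3}" "i < j"
          then have "of_real t * k i t \<noteq> of_real 0 * k j 0"
            using reversed_legs_disjoint[OF rev[of i j], of t 0] i t False by simp
          then show ?thesis by auto
        next
          assume "j \<in> {1, 2, 3}" "j < i"
          then have "of_real 0 * k j 0 \<noteq> of_real t * k i t"
            using reversed_legs_disjoint[OF rev[of j i], of 0 t] i t False by simp
          then show ?thesis by auto
        qed
      qed
    qed
    obtain y where "continuous_on {0..1} y" "\<And>t. t \<in> {0..1} \<Longrightarrow> k i t = of_real (norm (k i t)) * cis (y t)"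
      using angle_lift[of "{0..1}" "k i"] k[OF i] ne by (metis convex_real_interval(5))
    then show ?thesis unfolding angle_along_def by blast
  qed
  then obtain y where y: "\<And>i. i \<in> {1, 2, 3} \<Longrightarrow> angle_along (k i) (y i)" by metis
  have pos: "0 < sin (f i 0 - f j 0)"
    if ij: "i \<in> {1, 2, 3}" "j \<in> {1, 2, 3}" "i < j" and f: "angle_along (k i) (f i)" "angle_along (k j) (f j)" for i j f
  proof -
    have "Im (cnj (k i 0) * k j 0) = norm (k i 0) * norm (k j 0) * sin (f j 0 - f i 0)"
      by (rule cross_along[OF f]) simp
    moreover have "Im (cnj (k i 0) * k j 0) < 0" using rev[OF ij] by (simp add: reversed_legs_def)
    ultimately have "norm (k i 0) * norm (k j 0) * sin (f j 0 - f i 0) < 0" by simp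
    then have "sin (f j 0 - f i 0) < 0" by (metis mult_nonneg_nonneg norm_ge_zero not_less)
    then show ?thesis by (metis minus_diff_eq neg_less_0_iff_less sin_minus)
  qed
  have "\<exists>n::int. 0 < y 1 0 - y i 0 - 2 * pi * n \<and> y 1 0 - y i 0 - 2 * pi * n < pi" if i: "i \<in> {2, 3}" for i
  proof -
    have i': "i \<in> {1, 2, 3}" "1 < i" "1 \<in> {1, 2, 3::nat}" using i by auto
    have "0 < sin (y 1 0 - y i 0)" by (rule pos[OF i'(3,1,2) y y]) (use i' in simp_all)
    then show ?thesis using sin_pos_shift by blast
  qed
  then obtain n :: "nat \<Rightarrow> int" where n: "\<And>i. i \<in> {2, 3} \<Longrightarrow>
      0 < y 1 0 - y i 0 - 2 * pi * n i \<and> y 1 0 - y i 0 - 2 * pi * n i < pi" by metis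
  define z where "z i = (if i = 1 then y 1 else (\<lambda>t. y i t + 2 * pi * n i))" for i :: nat
  have z: "angle_along (k i) (z i)" if "i \<in> {1, 2, 3}" for i
    using y[OF that] angle_along_shift[OF y[OF that]] by (cases "i = 1") (simp_all add: z_def)
  have z12: "0 < z 1 0 - z 2 0" "z 1 0 - z 2 0 < pi" and z13: "0 < z 1 0 - z 3 0" "z 1 0 - z 3 0 < pi"
    using n[of 2] n[of 3] by (auto simp: z_def algebra_simps)
  have z23: "0 < z 2 0 - z 3 0" "z 2 0 - z 3 0 < pi"
  proof -
    show lt: "z 2 0 - z 3 0 < pi" using z12 z13 by linarith
    have s: "0 < sin (z 2 0 - z 3 0)" by (rule pos[of 2 3 z]) (use z in auto)
    show "0 < z 2 0 - z 3 0"
    proof (rule ccontr)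
      assume "\<not> ?thesis"
      then have "0 \<le> sin (z 3 0 - z 2 0)" using z12 z13 by (intro sin_ge_zero) auto
      then show False using s by (metis minus_diff_eq neg_0_le_iff_le not_less sin_minus)
    qed
  qed
  have turn: "pi < z i 1 - z j 1 \<and> z i 1 - z j 1 < 2 * pi"
    if ij: "i \<in> {1, 2, 3}" "j \<in> {1, 2, 3}" "i < j" and st: "0 < z i 0 - z j 0" "z i 0 - z j 0 < pi" for i j
  proof -
    have r: "reversed_legs (k i) (d i) (k j) (d j)" by (rule rev[OF ij])
    then have "k i 0 \<noteq> 0" "k j 0 \<noteq> 0" by (auto simp: reversed_legs_def)
    then show ?thesis
      using two_legs_turn[OF k[OF ij(1)] k[OF ij(2)] _ z[OF ij(1)] z[OF ij(2)] st, of "d j" "d i"] r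
      unfolding reversed_legs_def by blast
  qed
  have "pi < z 1 1 - z 2 1" "pi < z 2 1 - z 3 1" "z 1 1 - z 3 1 < 2 * pi"
    using turn[of 1 2] turn[of 2 3] turn[of 1 3] z12 z13 z23 by auto
  then show False by linarith
qed

text \<open>
  This is the isotopy from a map to its derivative, along one ray.
\<close>
lemma continuous_difference_quotient:
  fixes g :: "'a::real_normed_vector \<Rightarrow> 'b::real_normed_vector"
  assumes der: "(g has_derivative g') (at a)" and cont: "continuous_on {0..1} (\<lambda>t. g (a + t *\<^sub>R w))"
  shows "continuous_on {0..1::real} (\<lambda>t. if t = 0 then g' w else (g (a + t *\<^sub>R w) - g a) /\<^sub>R t)"
  unfolding continuous_on_def
proof
  fix t :: real assume t: "t \<in> {0..1}"
  let ?q = "\<lambda>t. (g (a + t *\<^sub>R w) - g a) /\<^sub>R t"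
  show "((\<lambda>t. if t = 0 then g' w else ?q t) \<longlongrightarrow> (if t = 0 then g' w else ?q t)) (at t within {0..1})"
  proof (cases "t = 0")
    case True
    have "((\<lambda>t. a + t *\<^sub>R w) has_derivative (\<lambda>t. t *\<^sub>R w)) (at 0)"
      by (auto intro!: derivative_eq_intros)
    moreover have "(g has_derivative g') (at (a + 0 *\<^sub>R w))" using der by simp
    ultimately have "((\<lambda>t. g (a + t *\<^sub>R w)) has_derivative (\<lambda>t. g' (t *\<^sub>R w))) (at 0)"
      by (rule has_derivative_compose)
    then have N: "((\<lambda>y. norm (g (a + y *\<^sub>R w) - g a - g' (y *\<^sub>R w)) / norm y) \<longlongrightarrow> 0) (at 0)"
      unfolding has_derivative_iff_norm by simp
    have "norm (g (a + y *\<^sub>R w) - g a - g' (y *\<^sub>R w)) / norm y = norm (?q y - g' w)" if "y \<noteq> 0" for y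
    proof -
      have "?q y - g' w = (g (a + y *\<^sub>R w) - g a - g' (y *\<^sub>R w)) /\<^sub>R y"
        using that linear_cmul[OF has_derivative_linear[OF der]] by (simp add: scaleR_right_diff_distrib)
      then show ?thesis by (simp add: divide_inverse mult.commute)
    qed
    then have "\<forall>\<^sub>F y in at 0. norm (g (a + y *\<^sub>R w) - g a - g' (y *\<^sub>R w)) / norm y = norm (?q y - g' w)"
      by (simp add: eventually_at_filter)
    from Lim_transform_eventually[OF N this] have "(?q \<longlongrightarrow> g' w) (at 0)"
      by (rule LIM_zero_cancel[OF tendsto_norm_zero_cancel])
    then have "(?q \<longlongrightarrow> g' w) (at 0 within {0..1})" by (rule tendsto_within_subset) simp
    then have "((\<lambda>t. if t = 0 then g' w else ?q t) \<longlongrightarrow> g' w) (at 0 within {0..1})"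
      by (rule Lim_transform_eventually) (simp add: eventually_at_filter)
    then show ?thesis using True by simp
  next
    case False
    have "((\<lambda>t. g (a + t *\<^sub>R w)) \<longlongrightarrow> g (a + t *\<^sub>R w)) (at t within {0..1})"
      using cont t by (auto simp: continuous_on_def)
    then have "(?q \<longlongrightarrow> ?q t) (at t within {0..1})"
      using False by (intro tendsto_intros) auto
    moreover have "\<forall>\<^sub>F s in at t within {0..1}. s \<noteq> 0"
      by (rule tendsto_imp_eventually_ne[OF tendsto_ident_at False])
    ultimately have "((\<lambda>t. if t = 0 then g' w else ?q t) \<longlongrightarrow> ?q t) (at t within {0..1})"
      by (rule Lim_transform_eventually[OF _ eventually_mono]) auto
    then show ?thesis using False by simp
  qed
qed

section \<open>Tilted triangles\<close>

lemma infinite_reals_three_ordered: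
  assumes "infinite (A :: real set)"
  obtains x y z where "x \<in> A" "y \<in> A" "z \<in> A" "x < y" "y < z"
proof -
  obtain B where B: "finite B" "card B = 3" "B \<subseteq> A" using infinite_arbitrarily_large[OF assms] by blast
  then obtain x y z where xyz: "B = {x, y, z}" "x \<noteq> y" "y \<noteq> z" "x \<noteq> z" by (auto simp: card_3_iff)
  then have "x \<in> A" "y \<in> A" "z \<in> A" using B by auto
  then show thesis using that xyz by (metis linorder_neqE_linordered_idom)
qed

context W_map
begin

text \<open>
  The rays in directions \<open>v i\<close> are clockwise ordered and the strips in directions \<open>d i\<close> counterclockwise.
  Cutting each ray at a point whose image is sufficiently far out in its strip produces three mutually
  reversed legs.
\<close>
lemma no_three_strips:
  fixes p :: "real^2" and d v :: "nat \<Rightarrow> real^2"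
  defines "a \<equiv> F p" and "E \<equiv> (\<lambda>i t. branch F p (F p + t *\<^sub>R v i) - p)"
  assumes inside: "\<And>i t. i \<in> {1, 2, 3} \<Longrightarrow> t \<in> {0..<1} \<Longrightarrow> a + t *\<^sub>R v i \<in> reach F p"
    and strip: "\<And>i t. i \<in> {1, 2, 3} \<Longrightarrow> t \<in> {0..<1} \<Longrightarrow> \<bar>cross2 (d i) (E i t)\<bar> \<le> M"
    and far: "\<And>i K. i \<in> {1, 2, 3} \<Longrightarrow> \<exists>t\<in>{0..<1}. K \<le> \<epsilon> * (d i \<bullet> E i t)" and \<epsilon>: "\<bar>\<epsilon>\<bar> = 1"
    and source: "\<And>i j. i \<in> {1, 2, 3} \<Longrightarrow> j \<in> {1, 2, 3} \<Longrightarrow> i < j \<Longrightarrow> cross2 (v i) (v j) < 0"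
    and target: "\<And>i j. i \<in> {1, 2, 3} \<Longrightarrow> j \<in> {1, 2, 3} \<Longrightarrow> i < j \<Longrightarrow> 0 < cross2 (d i) (d j)"
  shows False
proof -
  have E0: "E i 0 = 0" for i by (simp add: E_def start_in_reach)
  have M: "0 \<le> M" using strip[of 1 0] by simp
  define I where "I = {1, 2, 3::nat}"
  have "\<exists>K>0. i \<in> I \<and> j \<in> I \<and> i < j \<longrightarrow> (\<forall>E1 E2. \<bar>cross2 (d i) E1\<bar> \<le> M \<and> \<bar>cross2 (d j) E2\<bar> \<le> M \<and>
      K \<le> \<epsilon> * (d i \<bullet> E1) \<and> K \<le> \<epsilon> * (d j \<bullet> E2) \<longrightarrow>
      0 < cross2 E1 E2 \<and> M < \<bar>cross2 (d j) E1\<bar> \<and> M < \<bar>cross2 (d i) E2\<bar>)" for i j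
  proof (cases "i \<in> I \<and> j \<in> I \<and> i < j")
    case True
    then show ?thesis
      using far_vectors_cross[OF target M, of i j] \<epsilon> unfolding I_def by meson
  qed (auto intro: exI[of _ 1])
  then obtain K where K: "\<And>i j. 0 < K i j"
    "\<And>i j E1 E2. i \<in> I \<Longrightarrow> j \<in> I \<Longrightarrow> i < j \<Longrightarrow> \<bar>cross2 (d i) E1\<bar> \<le> M \<Longrightarrow> \<bar>cross2 (d j) E2\<bar> \<le> M \<Longrightarrow>
      K i j \<le> \<epsilon> * (d i \<bullet> E1) \<Longrightarrow> K i j \<le> \<epsilon> * (d j \<bullet> E2) \<Longrightarrow>
      0 < cross2 E1 E2 \<and> M < \<bar>cross2 (d j) E1\<bar> \<and> M < \<bar>cross2 (d i) E2\<bar>" by metis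
  define L where "L = K 1 2 + K 2 3 + K 1 3"
  have L: "K i j \<le> L" if "i \<in> I" "j \<in> I" "i < j" for i j
    using that K(1)[of 1 2] K(1)[of 2 3] K(1)[of 1 3] by (auto simp: I_def L_def)
  have L0: "0 < L" using K(1) by (simp add: L_def add_pos_pos)
  obtain \<tau> where \<tau>: "\<And>i. i \<in> I \<Longrightarrow> \<tau> i \<in> {0..<1}" "\<And>i. i \<in> I \<Longrightarrow> L \<le> \<epsilon> * (d i \<bullet> E i (\<tau> i))"
  proof -
    have "\<exists>t. t \<in> {0..<1} \<and> L \<le> \<epsilon> * (d i \<bullet> E i t)" if "i \<in> I" for i
      using far[of i L] that unfolding I_def by blast
    then show thesis using that by metis
  qed
  have \<tau>0: "0 < \<tau> i" if "i \<in> I" for i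
  proof -
    have "\<tau> i \<noteq> 0" using \<tau>(2)[OF that] L0 E0 by force
    then show ?thesis using \<tau>(1)[OF that] by simp
  qed
  have s\<tau>: "s * \<tau> i \<in> {0..<1}" if "i \<in> I" "s \<in> {0..1}" for s i
    using \<tau>(1)[OF that(1)] that(2) mult_right_mono[of s 1 "\<tau> i"] by auto
  obtain A where A: "(branch F p has_derivative (\<lambda>v. A *v v)) (at a)" "det A = 1"
    using branch_derivative[OF start_in_reach(1)] unfolding a_def by metis
  define k where "k i t = to_complex (if t = 0 then A *v (\<tau> i *\<^sub>R v i)
      else (branch F p (a + t *\<^sub>R (\<tau> i *\<^sub>R v i)) - branch F p a) /\<^sub>R t)" for i and t :: real
  have tk: "of_real t * k i t = to_complex (E i (t * \<tau> i))" for i t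
    by (simp add: k_def E_def a_def start_in_reach E0[unfolded E_def] to_complex_def complex_eq_iff)
  have k1: "k i 1 = to_complex (E i (\<tau> i))" for i using tk[of 1 i] by simp
  show False
  proof (rule no_three_reversed_legs[of k "\<lambda>i. to_complex (d i)"])
    fix i assume i: "i \<in> {1, 2, 3::nat}"
    then have iI: "i \<in> I" by (simp add: I_def)
    show "continuous_on {0..1} (k i)"
      unfolding k_def
    proof (rule linear_continuous_on_compose[OF _ bounded_linear_to_complex[THEN bounded_linear.linear]])
      have "continuous_on {0..1} (\<lambda>t. branch F p (a + t *\<^sub>R (\<tau> i *\<^sub>R v i)))"
        by (rule continuous_on_compose2[OF continuous_branch])
           (use inside[OF i s\<tau>[OF iI]] in \<open>auto intro!: continuous_intros\<close>)
      then show "continuous_on {0..1} (\<lambda>t. if t = 0 then A *v (\<tau> i *\<^sub>R v i)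
          else (branch F p (a + t *\<^sub>R (\<tau> i *\<^sub>R v i)) - branch F p a) /\<^sub>R t)"
        by (rule continuous_difference_quotient[OF A(1)])
    qed
  next
    fix i j assume i: "i \<in> {1, 2, 3::nat}" and j: "j \<in> {1, 2, 3::nat}" and ij: "i < j"
    then have iI: "i \<in> I" "j \<in> I" by (simp_all add: I_def)
    have str: "\<bar>cross2 (d l) (E l (s * \<tau> l))\<bar> \<le> M" if "l \<in> I" "s \<in> {0..1}" for l s
      using strip s\<tau>[OF that] that(1) by (simp add: I_def)
    have far': "0 < cross2 (E i (\<tau> i)) (E j (\<tau> j)) \<and> M < \<bar>cross2 (d j) (E i (\<tau> i))\<bar> \<and> M < \<bar>cross2 (d i) (E j (\<tau> j))\<bar>"
      by (rule K(2)[OF iI ij]) (use \<tau>(2)[OF iI(1)] \<tau>(2)[OF iI(2)] L[OF iI ij] str[OF iI(1), of 1] str[OF iI(2), of 1] in auto)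
    show "reversed_legs (k i) (to_complex (d i)) (k j) (to_complex (d j))"
      unfolding reversed_legs_def
    proof (intro conjI ballI impI)
      fix s t :: real assume st: "s \<in> {0..1}" "t \<in> {0..1}" "(s, t) \<noteq> (0, 0)"
      show "of_real s * k i s \<noteq> of_real t * k j t"
      proof
        assume "of_real s * k i s = of_real t * k j t"
        then have "E i (s * \<tau> i) = E j (t * \<tau> j)" unfolding tk by (metis from_to_complex)
        then have "branch F p (a + (s * \<tau> i) *\<^sub>R v i) = branch F p (a + (t * \<tau> j) *\<^sub>R v j)"
          by (simp add: E_def a_def)
        then have "a + (s * \<tau> i) *\<^sub>R v i = a + (t * \<tau> j) *\<^sub>R v j"
          using F_branch inside[OF i s\<tau>[OF iI(1) st(1)]] inside[OF j s\<tau>[OF iI(2) st(2)]] by metis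
        then have eq: "(s * \<tau> i) *\<^sub>R v i = (t * \<tau> j) *\<^sub>R v j" by simp
        have "s * \<tau> i * cross2 (v i) (v j) = cross2 ((t * \<tau> j) *\<^sub>R v j) (v j)"
          unfolding eq[symmetric] by (simp add: cross2_simps)
        then have "s = 0" using source[OF i j ij] \<tau>0[OF iI(1)] by (simp add: cross2_simps)
        have "t * \<tau> j * cross2 (v i) (v j) = cross2 (v i) ((s * \<tau> i) *\<^sub>R v i)"
          unfolding eq by (simp add: cross2_simps)
        then have "t = 0" using source[OF i j ij] \<tau>0[OF iI(2)] by (simp add: cross2_simps)
        then show False using st(3) \<open>s = 0\<close> by simp
      qed
    next
      have "cross2 (A *v (\<tau> i *\<^sub>R v i)) (A *v (\<tau> j *\<^sub>R v j)) = \<tau> i * \<tau> j * cross2 (v i) (v j)"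
        by (simp add: cross2_matrix A(2) cross2_simps)
      also have "\<dots> < 0" using \<tau>0[OF iI(1)] \<tau>0[OF iI(2)] source[OF i j ij] by (simp add: mult_pos_neg)
      finally show "Im (cnj (k i 0) * k j 0) < 0" by (simp add: k_def cross2_to_complex del: complex_cnj times_complex.sel cnj.sel)
      show "0 < Im (cnj (k i 1) * k j 1)" unfolding k1 cross2_to_complex using far' by blast
    next
      have *: "to_complex x - to_complex y = to_complex (x - y)" for x y by (simp add: to_complex_def complex_eq_iff)
      have c1: "Im (cnj (to_complex (d j)) * (k i 1 - of_real r * k j r))
          = cross2 (d j) (E i (\<tau> i)) - cross2 (d j) (E j (r * \<tau> j))" for r
        unfolding tk k1 * cross2_to_complex by (simp add: cross2_simps)
      show "(\<forall>r\<in>{0..1}. 0 < Im (cnj (to_complex (d j)) * (k i 1 - of_real r * k j r))) \<or>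
          (\<forall>r\<in>{0..1}. Im (cnj (to_complex (d j)) * (k i 1 - of_real r * k j r)) < 0)"
        unfolding c1 using far' str[OF iI(2)] by (smt (verit))
      have c2: "Im (cnj (to_complex (d i)) * (of_real r * k i r - k j 1))
          = cross2 (d i) (E i (r * \<tau> i)) - cross2 (d i) (E j (\<tau> j))" for r
        unfolding tk k1 * cross2_to_complex by (simp add: cross2_simps)
      show "(\<forall>r\<in>{0..1}. 0 < Im (cnj (to_complex (d i)) * (of_real r * k i r - k j 1))) \<or>
          (\<forall>r\<in>{0..1}. Im (cnj (to_complex (d i)) * (of_real r * k i r - k j 1)) < 0)"
        unfolding c2 using far' str[OF iI(1)] by (smt (verit))
    qed
  qed
qed

text \<open>
  In the coordinates \<open>x, y\<close> along the two sides of the triangle, the tilted chords are the lines \<open>x + \<kappa> y = const\<close>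
  with \<open>1 \<le> \<kappa> \<le> 1 + \<eta>\<close>, and the exit point is where \<open>x + \<kappa> y\<close> is minimal on the complement of \<open>reach F p\<close>.
  As \<open>\<kappa>\<close> grows, the minimizer moves towards larger \<open>x\<close> and smaller \<open>y\<close>, while the chord direction
  turns the other way. Two tilts cannot share an exit point, because the branch would be bounded on the
  ray to it by two transversal strips.
\<close>
lemma convex_reach: "convex (reach F p)"
proof (rule ccontr)
  assume nc: "\<not> convex (reach F p)"
  define S a where "S = reach F p" and "a = F p"
  have S: "open S" and star: "\<And>z t. z \<in> S \<Longrightarrow> t \<in> {0..1} \<Longrightarrow> a + t *\<^sub>R (z - a) \<in> S"
    using open_reach reach_star by (auto simp: S_def a_def)
  obtain b c s0 where bc: "b \<in> S" "c \<in> S" and s0: "s0 \<in> {0..1}" "(1 - s0) *\<^sub>R b + s0 *\<^sub>R c \<notin> S"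
    using nc unfolding S_def convex_alt by auto
  \<comment> \<open>Affine coordinates in which the triangle with vertices \<open>a\<close>, \<open>b\<close>, \<open>c\<close> is the standard one.\<close>
  define B C where "B = b - a" and "C = c - a"
  define pt where "pt x y = a + x *\<^sub>R B + y *\<^sub>R C" for x y
  define \<Delta> where "\<Delta> = cross2 B C"
  have q: "pt (1 - s0) s0 \<notin> S"
    using s0(2) by (simp add: pt_def B_def C_def algebra_simps)
  have scale: "pt (t * x) (t * y) \<in> S" if "pt x y \<in> S" "t \<in> {0..1}" for x y t
    using star[OF that] by (simp add: pt_def algebra_simps)
  have b_pt: "pt 1 0 \<in> S" and c_pt: "pt 0 1 \<in> S" using bc by (simp_all add: pt_def B_def C_def)
  \<comment> \<open>In a degenerate triangle the side \<open>[b, c]\<close> would be covered by the segments from \<open>a\<close> to \<open>b\<close> and to \<open>c\<close>.\<close>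
  have \<Delta>0: "\<Delta> \<noteq> 0"
  proof
    assume 0: "\<Delta> = 0"
    show False
    proof (cases "B = 0")
      case True
      then have "pt (1 - s0) s0 = pt (s0 * 0) (s0 * 1)" by (simp add: pt_def)
      then show False using q scale[OF c_pt s0(1)] by simp
    next
      case False
      then obtain l where l: "C = l *\<^sub>R B" using parallel_of_cross2_zero 0 unfolding \<Delta>_def by blast
      define w where "w = 1 - s0 + s0 * l"
      have w: "pt (1 - s0) s0 = a + w *\<^sub>R B" by (simp add: pt_def l w_def algebra_simps)
      show False
      proof (cases "w \<in> {0..1}")
        case True
        have "pt (1 - s0) s0 \<in> S" unfolding w using scale[OF b_pt True] by (simp add: pt_def)
        then show False using q by simp
      next
        case False
        have wl: "(w < 0 \<and> l \<le> w) \<or> (1 < w \<and> w \<le> l)"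
        proof -
          have e: "w - l = (1 - s0) * (1 - l)" "w - 1 = s0 * (l - 1)" by (simp_all add: w_def algebra_simps)
          show ?thesis
          proof (cases "l \<le> 1")
            case True
            then have "0 \<le> w - l" "w - 1 \<le> 0" unfolding e using s0(1) by (auto intro: mult_nonneg_nonneg mult_nonneg_nonpos)
            then show ?thesis using False by auto
          next
            case l1: False
            then have "w - l \<le> 0" "0 \<le> w - 1" unfolding e using s0(1) by (auto intro: mult_nonneg_nonneg mult_nonneg_nonpos)
            then show ?thesis using False by auto
          qed
        qed
        then have "w / l \<in> {0..1}" "l \<noteq> 0" by (auto simp: divide_simps)
        then have "pt (w / l * 0) (w / l * 1) \<in> S" using scale[OF c_pt] by blast
        moreover have "pt (w / l * 0) (w / l * 1) = a + w *\<^sub>R B" using \<open>l \<noteq> 0\<close> by (simp add: pt_def l)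
        ultimately show False using q unfolding w by simp
      qed
    qed
  qed
  have "((\<lambda>\<eta>. pt (1 + \<eta>) 0) \<longlongrightarrow> pt (1 + 0) 0) (at_right 0)" "((\<lambda>\<eta>. pt 0 (1 + \<eta>)) \<longlongrightarrow> pt 0 (1 + 0)) (at_right 0)"
    unfolding pt_def by (intro tendsto_intros)+
  then have "\<forall>\<^sub>F \<eta> in at_right 0. pt (1 + \<eta>) 0 \<in> S" "\<forall>\<^sub>F \<eta> in at_right 0. pt 0 (1 + \<eta>) \<in> S"
    using b_pt c_pt by (auto intro: topological_tendstoD[OF _ S])
  moreover have "\<forall>\<^sub>F \<eta> in at_right (0::real). 0 < \<eta>" by (simp add: eventually_at_right_less)
  ultimately have "\<forall>\<^sub>F \<eta> in at_right 0. 0 < \<eta> \<and> pt (1 + \<eta>) 0 \<in> S \<and> pt 0 (1 + \<eta>) \<in> S"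
    by eventually_elim auto
  then obtain \<eta> where \<eta>: "0 < \<eta>" "pt (1 + \<eta>) 0 \<in> S" "pt 0 (1 + \<eta>) \<in> S"
    using eventually_happens'[OF trivial_limit_at_right_real] by blast
  have side1: "pt x 0 \<in> S" and side2: "pt 0 x \<in> S" if "0 \<le> x" "x \<le> 1 + \<eta>" for x
  proof -
    have "x / (1 + \<eta>) \<in> {0..1}" using that \<eta>(1) by simp
    from scale[OF \<eta>(2) this] scale[OF \<eta>(3) this] show "pt x 0 \<in> S" "pt 0 x \<in> S" using \<eta>(1) by auto
  qed
  \<comment> \<open>The minimizers are sought in a slightly larger parallelogram, because tilted chords may end beyond \<open>b\<close>.\<close>
  define Z where "Z = ({0..1 + \<eta>} \<times> {0..1 + \<eta>}) \<inter> (\<lambda>(x, y). pt x y) -` (- S)"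
  have "compact Z"
  proof -
    have "closed Z" unfolding Z_def
      by (intro continuous_closed_preimage) (use S in \<open>auto simp: pt_def case_prod_unfold closed_Times intro!: continuous_intros\<close>)
    then have "compact (({0..1 + \<eta>} \<times> {0..1 + \<eta>}) \<inter> Z)" by (intro compact_Int_closed compact_Times compact_Icc)
    moreover have "({0..1 + \<eta>} \<times> {0..1 + \<eta>}) \<inter> Z = Z" by (auto simp: Z_def)
    ultimately show ?thesis by simp
  qed
  have qZ: "(1 - s0, s0) \<in> Z" using q s0(1) \<eta>(1) by (auto simp: Z_def)
  have Zpos: "0 < x" "0 < y" "pt x y \<notin> S" if xy: "(x, y) \<in> Z" for x y
  proof -
    have *: "0 \<le> x" "x \<le> 1 + \<eta>" "0 \<le> y" "y \<le> 1 + \<eta>" "pt x y \<notin> S" using xy by (auto simp: Z_def)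
    then have "y \<noteq> 0" "x \<noteq> 0" using side1[of x] side2[of y] by auto
    then show "0 < x" "0 < y" "pt x y \<notin> S" using * by auto
  qed
  define I where "I = {1..1 + \<eta>}"
  have "\<exists>z\<in>Z. \<forall>z'\<in>Z. fst z + \<kappa> * snd z \<le> fst z' + \<kappa> * snd z'" for \<kappa>
    by (rule continuous_attains_inf[OF \<open>compact Z\<close>]) (use qZ in \<open>auto intro!: continuous_intros\<close>)
  then obtain m where m: "\<And>\<kappa>. m \<kappa> \<in> Z" "\<And>\<kappa> z. z \<in> Z \<Longrightarrow> fst (m \<kappa>) + \<kappa> * snd (m \<kappa>) \<le> fst z + \<kappa> * snd z" by metis
  define X Y where "X \<kappa> = fst (m \<kappa>)" and "Y \<kappa> = snd (m \<kappa>)" for \<kappa>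
  define \<sigma> where "\<sigma> \<kappa> = X \<kappa> + \<kappa> * Y \<kappa>" for \<kappa>
  have XYZ: "(X \<kappa>, Y \<kappa>) \<in> Z" for \<kappa> using m(1) by (simp add: X_def Y_def)
  have XY: "0 < X \<kappa>" "0 < Y \<kappa>" "pt (X \<kappa>) (Y \<kappa>) \<notin> S" for \<kappa> using Zpos[OF XYZ] by auto
  have \<sigma>_min: "\<sigma> \<kappa> \<le> x + \<kappa> * y" if "(x, y) \<in> Z" for \<kappa> x y using m(2)[OF that, of \<kappa>] by (simp add: \<sigma>_def X_def Y_def)
  have \<sigma>: "0 < \<sigma> \<kappa>" "\<sigma> \<kappa> \<le> \<kappa>" "0 < \<kappa>" "\<kappa> \<le> 1 + \<eta>" if "\<kappa> \<in> I" for \<kappa>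
  proof -
    show "0 < \<kappa>" "\<kappa> \<le> 1 + \<eta>" using that by (auto simp: I_def)
    then show "0 < \<sigma> \<kappa>" using XY[of \<kappa>] by (simp add: \<sigma>_def add_pos_pos)
    have "\<sigma> \<kappa> \<le> (1 - s0) + \<kappa> * s0" by (rule \<sigma>_min[OF qZ])
    also have "\<dots> \<le> (1 - s0) * \<kappa> + \<kappa> * s0" using that s0(1) by (auto simp: I_def mult_le_cancel_left1)
    also have "\<dots> = \<kappa>" by (simp add: algebra_simps)
    finally show "\<sigma> \<kappa> \<le> \<kappa>" .
  qed
  have low: "pt x y \<in> S" if k: "\<kappa> \<in> I" and xy: "0 \<le> x" "0 \<le> y" "x + \<kappa> * y < \<sigma> \<kappa>" for \<kappa> x y
  proof (rule ccontr)
    assume n: "pt x y \<notin> S"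
    have "0 \<le> \<kappa> * y" using xy \<sigma>(3)[OF k] by simp
    then have "x \<le> 1 + \<eta>" "\<kappa> * y < \<kappa> * 1" using xy \<sigma>[OF k] by linarith+
    then have "x \<le> 1 + \<eta>" "y < 1" using \<sigma>(3)[OF k] by simp_all
    then have "(x, y) \<in> Z" using n xy \<eta>(1) by (simp add: Z_def)
    then show False using \<sigma>_min[of x y \<kappa>] xy by simp
  qed
  define bk ck d v where "bk \<kappa> = pt (\<sigma> \<kappa>) 0" and "ck \<kappa> = pt 0 (\<sigma> \<kappa> / \<kappa>)" and "d \<kappa> = ck \<kappa> - bk \<kappa>"
    and "v \<kappa> = X \<kappa> *\<^sub>R B + Y \<kappa> *\<^sub>R C" for \<kappa>
  define E where "E \<kappa> t = branch F p (a + t *\<^sub>R v \<kappa>) - p" for \<kappa> t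
  have d: "d \<kappa> = \<sigma> \<kappa> *\<^sub>R ((1 / \<kappa>) *\<^sub>R C - B)" for \<kappa> by (simp add: d_def bk_def ck_def pt_def algebra_simps)
  have d0: "d \<kappa> \<noteq> 0" if k: "\<kappa> \<in> I" for \<kappa>
  proof
    assume "d \<kappa> = 0"
    then have "cross2 (d \<kappa>) C = 0" by (simp add: cross2_def)
    then show False using \<sigma>(1)[OF k] \<Delta>0 unfolding d \<Delta>_def by (simp add: cross2_simps)
  qed
  have v_cross: "cross2 (v \<kappa>) (v \<kappa>') = (X \<kappa> * Y \<kappa>' - Y \<kappa> * X \<kappa>') * \<Delta>" for \<kappa> \<kappa>'
    unfolding v_def \<Delta>_def by (simp add: cross2_simps cross2_swap[of B C] algebra_simps)
  have d_cross: "cross2 (d \<kappa>) (d \<kappa>') = \<sigma> \<kappa> * \<sigma> \<kappa>' * ((1 / \<kappa> - 1 / \<kappa>') * \<Delta>)" for \<kappa> \<kappa>'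
    unfolding d \<Delta>_def by (simp add: cross2_simps cross2_swap[of B C] algebra_simps)
  have pt_v: "pt (t * X \<kappa>) (t * Y \<kappa>) = a + t *\<^sub>R v \<kappa>" for \<kappa> t by (simp add: pt_def v_def algebra_simps)
  have inside: "a + t *\<^sub>R v \<kappa> \<in> S" if k: "\<kappa> \<in> I" and t: "t \<in> {0..<1}" for \<kappa> t
    unfolding pt_v[symmetric]
  proof (rule low[OF k])
    show "t * X \<kappa> + \<kappa> * (t * Y \<kappa>) < \<sigma> \<kappa>"
      using t \<sigma>(1)[OF k] mult_strict_right_mono[of t 1 "\<sigma> \<kappa>"] by (simp add: \<sigma>_def algebra_simps)
  qed (use t XY[of \<kappa>] in auto)
  have "\<exists>M. \<forall>t\<in>{0..<1}. \<bar>cross2 (d \<kappa>) (E \<kappa> t)\<bar> \<le> M" if k: "\<kappa> \<in> I" for \<kappa>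
  proof -
    have pts: "a + t *\<^sub>R (bk \<kappa> + s *\<^sub>R (ck \<kappa> - bk \<kappa>) - a) = pt (t * ((1 - s) * \<sigma> \<kappa>)) (t * (s * \<sigma> \<kappa> / \<kappa>))" for t s
      by (simp add: bk_def ck_def pt_def algebra_simps)
    have bkS: "bk \<kappa> \<in> S" unfolding bk_def using \<sigma>[OF k] by (intro side1) auto
    have ckS: "ck \<kappa> \<in> S" unfolding ck_def using \<sigma>[OF k] \<eta>(1) by (intro side2) (auto simp: divide_le_eq intro: order_trans[of _ \<kappa>])
    have ne: "bk \<kappa> \<noteq> ck \<kappa>" using d0[OF k] by (auto simp: d_def)
    have "a + t *\<^sub>R (bk \<kappa> + s *\<^sub>R (ck \<kappa> - bk \<kappa>) - a) \<in> S" if t: "t \<in> {0..<1}" and s: "s \<in> {0..1}" for t s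
      unfolding pts
    proof (rule low[OF k])
      have "t * ((1 - s) * \<sigma> \<kappa>) + \<kappa> * (t * (s * \<sigma> \<kappa> / \<kappa>)) = t * \<sigma> \<kappa>"
        using \<sigma>(3)[OF k] by (simp add: field_simps)
      also have "\<dots> < \<sigma> \<kappa>" using t \<sigma>(1)[OF k] by simp
      finally show "t * ((1 - s) * \<sigma> \<kappa>) + \<kappa> * (t * (s * \<sigma> \<kappa> / \<kappa>)) < \<sigma> \<kappa>" .
    qed (use t s \<sigma>[OF k] in auto)
    then obtain M where M: "\<forall>t\<in>{0..<1}. \<forall>s\<in>{0..1}.
        \<bar>cross2 (d \<kappa>) (branch F p (a + t *\<^sub>R (bk \<kappa> + s *\<^sub>R (ck \<kappa> - bk \<kappa>) - a)))\<bar> \<le> M"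
      using triangle_strip[OF bkS[unfolded S_def] ckS[unfolded S_def] ne] unfolding S_def a_def d_def by blast
    define s where "s = \<kappa> * Y \<kappa> / \<sigma> \<kappa>"
    have s: "s \<in> {0..1}" "(1 - s) * \<sigma> \<kappa> = X \<kappa>" "s * \<sigma> \<kappa> / \<kappa> = Y \<kappa>"
    proof -
      have s\<sigma>: "s * \<sigma> \<kappa> = \<kappa> * Y \<kappa>" using \<sigma>(1)[OF k] by (simp add: s_def)
      have "0 \<le> \<kappa> * Y \<kappa>" "\<kappa> * Y \<kappa> \<le> \<sigma> \<kappa>" using \<sigma>(3)[OF k] XY[of \<kappa>] by (auto simp: \<sigma>_def)
      then show "s \<in> {0..1}" using \<sigma>(1)[OF k] by (simp add: s_def)
      show "(1 - s) * \<sigma> \<kappa> = X \<kappa>" unfolding left_diff_distrib s\<sigma> by (simp add: \<sigma>_def)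
      show "s * \<sigma> \<kappa> / \<kappa> = Y \<kappa>" unfolding s\<sigma> using \<sigma>(3)[OF k] by simp
    qed
    have "\<bar>cross2 (d \<kappa>) (E \<kappa> t)\<bar> \<le> M + \<bar>cross2 (d \<kappa>) p\<bar>" if t: "t \<in> {0..<1}" for t
    proof -
      have "\<bar>cross2 (d \<kappa>) (branch F p (a + t *\<^sub>R v \<kappa>))\<bar> \<le> M"
        using M[rule_format, OF t s(1)] unfolding pts s(2,3) pt_v .
      then show ?thesis unfolding E_def by (simp add: cross2_simps)
    qed
    then show ?thesis by blast
  qed
  then obtain M where M: "\<And>\<kappa> t. \<kappa> \<in> I \<Longrightarrow> t \<in> {0..<1} \<Longrightarrow> \<bar>cross2 (d \<kappa>) (E \<kappa> t)\<bar> \<le> M \<kappa>" by metis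
  have unb: "\<exists>t\<in>{0..<1}. R < norm (E \<kappa> t)" if k: "\<kappa> \<in> I" for \<kappa> R
  proof -
    have "a + v \<kappa> \<notin> reach F p" using XY(3)[of \<kappa>] pt_v[of 1 \<kappa>] by (simp add: S_def)
    then obtain t where t: "t \<in> {0..<1}" "R + norm p < norm (branch F p (F p + t *\<^sub>R (a + v \<kappa> - F p)))"
      using branch_unbounded_at_first_exit[of "a + v \<kappa>" p "R + norm p"] inside[OF k] by (auto simp: S_def a_def)
    then have "R < norm (E \<kappa> t)"
      using norm_triangle_ineq2[of "branch F p (a + t *\<^sub>R v \<kappa>)" p] by (simp add: E_def a_def)
    then show ?thesis using t(1) by blast
  qed
  \<comment> \<open>Distinct tilts exit along distinct rays, in an order opposite to that of their strips.\<close>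
  have exit_order: "X \<kappa> * Y \<kappa>' - Y \<kappa> * X \<kappa>' < 0" if k: "\<kappa> \<in> I" "\<kappa>' \<in> I" "\<kappa> < \<kappa>'" for \<kappa> \<kappa>'
  proof -
    have i1: "X \<kappa> + \<kappa> * Y \<kappa> \<le> X \<kappa>' + \<kappa> * Y \<kappa>'" using \<sigma>_min[OF XYZ, of \<kappa> \<kappa>'] by (simp add: \<sigma>_def)
    have i2: "X \<kappa>' + \<kappa>' * Y \<kappa>' \<le> X \<kappa> + \<kappa>' * Y \<kappa>" using \<sigma>_min[OF XYZ, of \<kappa>' \<kappa>] by (simp add: \<sigma>_def)
    have "(\<kappa>' - \<kappa>) * (Y \<kappa>' - Y \<kappa>) \<le> 0" using i1 i2 by (simp add: algebra_simps)
    then have y: "Y \<kappa>' \<le> Y \<kappa>" using k(3) by (simp add: mult_le_0_iff)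
    then have "0 \<le> \<kappa> * (Y \<kappa> - Y \<kappa>')" using \<sigma>(3)[OF k(1)] by simp
    then have x: "X \<kappa> \<le> X \<kappa>'" using i1 by (simp add: algebra_simps)
    have p1: "X \<kappa> * Y \<kappa>' \<le> X \<kappa> * Y \<kappa>" using y XY(1)[of \<kappa>] by simp
    have p2: "X \<kappa> * Y \<kappa> \<le> X \<kappa>' * Y \<kappa>" using x XY(2)[of \<kappa>] by simp
    have "X \<kappa> * Y \<kappa>' \<noteq> Y \<kappa> * X \<kappa>'"
    proof
      assume e: "X \<kappa> * Y \<kappa>' = Y \<kappa> * X \<kappa>'"
      have e': "X \<kappa> * Y \<kappa>' = X \<kappa>' * Y \<kappa>" using e by (simp only: mult.commute)
      have "X \<kappa> * Y \<kappa>' = X \<kappa> * Y \<kappa>" "X \<kappa> * Y \<kappa> = X \<kappa>' * Y \<kappa>" using e' p1 p2 by linarith+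
      then have "v \<kappa> = v \<kappa>'" using XY(1,2)[of \<kappa>] by (simp add: v_def)
      then have E: "E \<kappa> t = E \<kappa>' t" for t by (simp add: E_def)
      define g where "g = cross2 (d \<kappa>) (d \<kappa>')"
      have "g \<noteq> 0" unfolding g_def d_cross using \<sigma>[OF k(1)] \<sigma>[OF k(2)] \<Delta>0 k(3) by auto
      define R where "R = (M \<kappa>' * norm (d \<kappa>) + M \<kappa> * norm (d \<kappa>')) / \<bar>g\<bar>"
      obtain t where t: "t \<in> {0..<1}" "R < norm (E \<kappa> t)" using unb[OF k(1)] by blast
      have "\<bar>g\<bar> * norm (E \<kappa> t) = norm (cross2 (E \<kappa> t) (d \<kappa>') *\<^sub>R d \<kappa> + cross2 (d \<kappa>) (E \<kappa> t) *\<^sub>R d \<kappa>')"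
        using arg_cong[OF cross2_resolve[of "d \<kappa>" "d \<kappa>'" "E \<kappa> t"], of norm] by (simp add: g_def)
      also have "\<dots> \<le> \<bar>cross2 (E \<kappa> t) (d \<kappa>')\<bar> * norm (d \<kappa>) + \<bar>cross2 (d \<kappa>) (E \<kappa> t)\<bar> * norm (d \<kappa>')"
        by (rule order_trans[OF norm_triangle_ineq]) simp
      also have "\<dots> \<le> M \<kappa>' * norm (d \<kappa>) + M \<kappa> * norm (d \<kappa>')"
        using M[OF k(1) t(1)] M[OF k(2) t(1)] by (intro add_mono mult_right_mono) (simp_all add: E cross2_swap[of "d \<kappa>'"])
      finally have "norm (E \<kappa> t) \<le> R" using \<open>g \<noteq> 0\<close> by (simp add: R_def field_simps)
      then show False using t(2) by simp
    qed
    then show ?thesis using p1 p2 by (simp add: mult.commute)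
  qed
  \<comment> \<open>The branch escapes along the ray inside a strip, hence towards at least one of its two ends.\<close>
  define far where "far \<epsilon> \<kappa> \<longleftrightarrow> (\<forall>K. \<exists>t\<in>{0..<1}. K \<le> \<epsilon> * (d \<kappa> \<bullet> E \<kappa> t))" for \<epsilon> :: real and \<kappa>
  have "far 1 \<kappa> \<or> far (-1) \<kappa>" if k: "\<kappa> \<in> I" for \<kappa>
  proof (rule ccontr)
    assume "\<not> ?thesis"
    then have "\<exists>K. \<forall>t\<in>{0..<1}. d \<kappa> \<bullet> E \<kappa> t < K" "\<exists>K. \<forall>t\<in>{0..<1}. - (d \<kappa> \<bullet> E \<kappa> t) < K"
      by (simp_all add: far_def not_le)
    then obtain K1 K2 where K: "\<And>t. t \<in> {0..<1} \<Longrightarrow> d \<kappa> \<bullet> E \<kappa> t < K1" "\<And>t. t \<in> {0..<1} \<Longrightarrow> - (d \<kappa> \<bullet> E \<kappa> t) < K2"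
      by blast
    have dd: "0 < d \<kappa> \<bullet> d \<kappa>" using d0[OF k] by simp
    define L where "L = max \<bar>K1\<bar> \<bar>K2\<bar>"
    define R where "R = sqrt ((L\<^sup>2 + (M \<kappa>)\<^sup>2) / (d \<kappa> \<bullet> d \<kappa>))"
    obtain t where t: "t \<in> {0..<1}" "R < norm (E \<kappa> t)" using unb[OF k] by blast
    have "\<bar>d \<kappa> \<bullet> E \<kappa> t\<bar> \<le> L" using K[OF t(1)] by (auto simp: L_def)
    then have "(d \<kappa> \<bullet> E \<kappa> t)\<^sup>2 \<le> L\<^sup>2" by (simp add: abs_le_square_iff[symmetric])
    moreover have "(cross2 (d \<kappa>) (E \<kappa> t))\<^sup>2 \<le> (M \<kappa>)\<^sup>2" using M[OF k t(1)] by (simp add: abs_le_square_iff[symmetric])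
    ultimately have "(d \<kappa> \<bullet> d \<kappa>) * (E \<kappa> t \<bullet> E \<kappa> t) \<le> L\<^sup>2 + (M \<kappa>)\<^sup>2" unfolding inner_cross2_pythagoras by simp
    then have "(norm (E \<kappa> t))\<^sup>2 \<le> (L\<^sup>2 + (M \<kappa>)\<^sup>2) / (d \<kappa> \<bullet> d \<kappa>)"
      using dd by (simp add: power2_norm_eq_inner pos_le_divide_eq mult.commute)
    then have "norm (E \<kappa> t) \<le> R" unfolding R_def by (rule real_le_rsqrt)
    then show False using t(2) by simp
  qed
  then have "I = {\<kappa>\<in>I. far 1 \<kappa>} \<union> {\<kappa>\<in>I. far (-1) \<kappa>}" by blast
  moreover have "infinite I" unfolding I_def using \<eta>(1) by (simp add: infinite_Icc)
  ultimately obtain \<epsilon> where \<epsilon>: "\<bar>\<epsilon>\<bar> = 1" "infinite {\<kappa>\<in>I. far \<epsilon> \<kappa>}"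
    by (metis abs_1 abs_minus finite_UnI)
  obtain x y z where xyz: "x \<in> {\<kappa>\<in>I. far \<epsilon> \<kappa>}" "y \<in> {\<kappa>\<in>I. far \<epsilon> \<kappa>}" "z \<in> {\<kappa>\<in>I. far \<epsilon> \<kappa>}" "x < y" "y < z"
    using infinite_reals_three_ordered[OF \<epsilon>(2)] by blast
  \<comment> \<open>The tilts increase or decrease with the index according to the orientation of the triangle.\<close>
  define \<kappa> where "\<kappa> = (\<lambda>i::nat. if i = 2 then y else if (i = 1) = (0 < \<Delta>) then x else z)"
  have \<kappa>I: "\<kappa> i \<in> I" "far \<epsilon> (\<kappa> i)" for i using xyz by (auto simp: \<kappa>_def)
  have \<kappa>_order: "if 0 < \<Delta> then \<kappa> i < \<kappa> j else \<kappa> j < \<kappa> i" if "i \<in> {1, 2, 3}" "j \<in> {1, 2, 3}" "i < j" for i j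
    using that xyz by (auto simp: \<kappa>_def)
  show False
  proof (rule no_three_strips[where p = p and v = "\<lambda>i. v (\<kappa> i)" and d = "\<lambda>i. d (\<kappa> i)"
        and M = "max (M x) (max (M y) (M z))" and \<epsilon> = \<epsilon>])
    fix i t assume t: "t \<in> {0..<1::real}"
    show "F p + t *\<^sub>R v (\<kappa> i) \<in> reach F p" using inside[OF \<kappa>I(1) t] by (simp add: S_def a_def)
    have "\<bar>cross2 (d (\<kappa> i)) (E (\<kappa> i) t)\<bar> \<le> M (\<kappa> i)" by (rule M[OF \<kappa>I(1) t])
    also have "\<dots> \<le> max (M x) (max (M y) (M z))" by (auto simp: \<kappa>_def)
    finally show "\<bar>cross2 (d (\<kappa> i)) (branch F p (F p + t *\<^sub>R v (\<kappa> i)) - p)\<bar> \<le> max (M x) (max (M y) (M z))"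
      by (simp add: E_def a_def)
  next
    fix i K
    show "\<exists>t\<in>{0..<1}. K \<le> \<epsilon> * (d (\<kappa> i) \<bullet> (branch F p (F p + t *\<^sub>R v (\<kappa> i)) - p))"
      using \<kappa>I(2)[of i] by (simp add: far_def E_def a_def)
  next
    fix i j :: nat assume ij: "i \<in> {1, 2, 3}" "j \<in> {1, 2, 3}" "i < j"
    show "cross2 (v (\<kappa> i)) (v (\<kappa> j)) < 0"
    proof (cases "0 < \<Delta>")
      case True
      then show ?thesis unfolding v_cross using \<kappa>_order[OF ij] exit_order[OF \<kappa>I(1) \<kappa>I(1), of i j] by (simp add: mult_neg_pos)
    next
      case False
      then have "X (\<kappa> j) * Y (\<kappa> i) - Y (\<kappa> j) * X (\<kappa> i) < 0" using \<kappa>_order[OF ij] exit_order[OF \<kappa>I(1) \<kappa>I(1), of j i] by simp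
      then have "0 < X (\<kappa> i) * Y (\<kappa> j) - Y (\<kappa> i) * X (\<kappa> j)" by (simp add: mult.commute)
      then show ?thesis unfolding v_cross using False \<Delta>0 by (simp add: mult_pos_neg)
    qed
    have "0 < (1 / \<kappa> i - 1 / \<kappa> j) * \<Delta>"
    proof (cases "0 < \<Delta>")
      case True
      then show ?thesis using \<kappa>_order[OF ij] \<sigma>(3)[OF \<kappa>I(1)[of i]] \<sigma>(3)[OF \<kappa>I(1)[of j]]
        by (intro mult_pos_pos) (simp_all add: field_simps)
    next
      case False
      then show ?thesis using \<kappa>_order[OF ij] \<sigma>(3)[OF \<kappa>I(1)[of i]] \<sigma>(3)[OF \<kappa>I(1)[of j]] \<Delta>0
        by (intro mult_neg_neg) (simp_all add: field_simps)
    qed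
    then show "0 < cross2 (d (\<kappa> i)) (d (\<kappa> j))"
      unfolding d_cross using \<sigma>(1)[OF \<kappa>I(1)] by simp
  qed (rule \<epsilon>(1))
qed

end

section \<open>Measure\<close>

lemma unimodular_injective_measure_preserving:
  fixes F :: "real^2 \<Rightarrow> real^2"
  assumes "unimodular_map F" "inj F"
  shows "lebesgue_measure_preserving F"
proof -
  interpret unimodular_map F by fact
  let ?J = "\<lambda>x v. jacobian F (at x) *v v"
  have der: "(F has_derivative ?J x) (at x within S)" for x S
    using derivative_jacobian[OF diff] has_derivative_at_withinI by blast
  have one: "\<bar>det (matrix (?J x))\<bar> = 1" for x by (simp add: unimodular)
  have inj: "inj_on F S" for S using assms(2) inj_on_subset by blast
  have bdd: "F ` S \<in> sets lebesgue \<and> emeasure lebesgue (F ` S) = emeasure lebesgue S" if S: "S \<in> lmeasurable" for S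
  proof -
    have "((\<lambda>x. 1) has_integral measure lebesgue S) S"
      using S integrable_integral[of "\<lambda>x. 1::real" S] by (simp add: lmeasurable_iff_integrable_on lmeasure_integral)
    then have "((\<lambda>x. \<bar>det (matrix (?J x))\<bar>) has_integral measure lebesgue S) S" unfolding one .
    then have "F ` S \<in> lmeasurable \<and> measure lebesgue (F ` S) = measure lebesgue S"
      by (rule has_measure_differentiable_image[OF fmeasurableD[OF S] der inj, THEN iffD2])
    then show ?thesis using S by (auto simp: emeasure_eq_measure2 intro: fmeasurableD)
  qed
  show ?thesis
    unfolding lebesgue_measure_preserving_def
  proof
    fix S :: "(real^2) set" assume S: "S \<in> sets lebesgue"
    \<comment> \<open>The change of variables formula concerns sets of finite measure, so \<open>S\<close> is cut into annular pieces.\<close>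
    define D where "D n = S \<inter> (ball 0 (real (Suc n)) - ball 0 (real n))" for n
    have D: "D n \<in> lmeasurable" for n
    proof -
      have "ball 0 (real (Suc n)) - ball 0 (real n) \<in> lmeasurable" for n by (intro fmeasurable.Diff) auto
      then show ?thesis unfolding D_def using S fmeasurable_Int_fmeasurable by (metis inf_commute)
    qed
    have sep: "D i \<inter> D j = {}" if "i < j" for i j
    proof -
      have "real (Suc i) \<le> real j" using that by (simp only: of_nat_le_iff Suc_le_eq)
      then show ?thesis unfolding D_def by force
    qed
    have disj: "disjoint_family D"
      unfolding disjoint_family_on_def
    proof (intro ballI impI)
      fix i j :: nat assume "i \<noteq> j"
      then show "D i \<inter> D j = {}" using sep[of i j] sep[of j i] by (cases "i < j") auto
    qed
    have un: "(\<Union>n. D n) = S"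
    proof
      show "S \<subseteq> (\<Union>n. D n)"
      proof
        fix x assume x: "x \<in> S"
        define n where "n = nat \<lfloor>norm x\<rfloor>"
        have "norm x < real (Suc n)" "real n \<le> norm x"
          using floor_correct[of "norm x"] norm_ge_zero[of x] by (simp_all add: n_def of_nat_nat add.commute)
        then have "x \<in> D n" using x by (simp add: D_def)
        then show "x \<in> (\<Union>n. D n)" by blast
      qed
    qed (auto simp: D_def)
    have FD: "F ` D n \<in> sets lebesgue" "emeasure lebesgue (F ` D n) = emeasure lebesgue (D n)" for n using bdd[OF D] by auto
    have Fun: "F ` S = (\<Union>n. F ` D n)" using un by blast
    have Fdisj: "disjoint_family (\<lambda>n. F ` D n)"
      using disj unfolding disjoint_family_on_def by (simp add: image_Int[OF assms(2), symmetric])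
    have "emeasure lebesgue (F ` S) = (\<Sum>n. emeasure lebesgue (F ` D n))"
      unfolding Fun by (rule suminf_emeasure[symmetric]) (use FD Fdisj in auto)
    also have "\<dots> = (\<Sum>n. emeasure lebesgue (D n))" by (simp add: FD)
    also have "\<dots> = emeasure lebesgue (\<Union>n. D n)"
      by (rule suminf_emeasure) (use D disj in \<open>auto intro: fmeasurableD\<close>)
    finally have "emeasure lebesgue (F ` S) = emeasure lebesgue S" unfolding un .
    moreover have "F ` S \<in> sets lebesgue" unfolding Fun using FD by auto
    ultimately show "F ` S \<in> sets lebesgue \<and> emeasure lebesgue (F ` S) = emeasure lebesgue S" by blast
  qed
qed

theorem theorem1p7:
  fixes F :: "real^2 \<Rightarrow> real^2"
  assumes "\<forall>z. F differentiable (at z)"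
    and "\<forall>z. det (jacobian F (at z)) = 1"
    and "W_condition F"
  shows "inj F \<and> lebesgue_measure_preserving F \<and> convex (range F)"
proof -
  interpret W_map F by unfold_locales (use assms in auto)
  have "inj F" "convex (range F)"
    using convex_reach_imp_injective_convex_range[OF convex_reach] by auto
  moreover have "lebesgue_measure_preserving F"
    by (rule unimodular_injective_measure_preserving) (unfold_locales, fact)
  ultimately show ?thesis by blast
qed
end
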